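(* Let $q\in\mathbb{C}$ with $0<|q|<1$. For $l_1,l_2\in\frac12\mathbb{N}$ and $m,n\in\mathbb{Z}$, the tensor product of irreducible corepresentations of $\mathcal{O}(U_q(2))$ decomposes as $$T_{l_1}D^m\otimes T_{l_2}D^n\;\simeq\;T_{l_1+l_2}D^{m+n}\oplus T_{l_1+l_2-1}D^{m+n+1}\oplus\cdots\oplus T_{|l_1-l_2|}D^{m+n+2\min\{l_1,l_2\}},$$ i.e. $T_{l_1}D^m\otimes T_{l_2}D^n\simeq\bigoplus_{r=0}^{2\min\{l_1,l_2\}}T_{l_1+l_2-r}D^{m+n+r}$.
   Context: $\mathbb{N}=\{0,1,2,\dots\}$. For $q\in\mathbb{C}\setminus\{0\}$, $C(U_q(2))$ is the universal unital $C^*$-algebra generated by $a,b,D$ subject to $$ba=qab,\quad a^*b=qba^*,\quad bb^*=b^*b,\quad aa^*+bb^*=1,\quad aD=Da,\quad bD=q^2|q|^{-2}Db,\quad DD^*=D^*D=1,\quad a^*a+|q|^2b^*b=1,$$ with comultiplication $\Delta(a)=a\otimes a-\bar q\,b\otimes Db^*$, $\Delta(b)=a\otimes b+b\otimes Da^*$, $\Delta(D)=D\otimes D$. $\mathcal{A}_q=\mathcal{O}(U_q(2))$ is the $*$-subalgebra generated by $a,b,D$; it is a Hopf $*$-algebra with antipode $S(a)=a^*$, $S(b)=-qbD^*$, $S(D)=D^*$, $S(a^* )=a$, $S(b^* )=-\bar q^{-1}b^*D$ and counit $\epsilon(a)=1,\epsilon(b)=0,\epsilon(D)=1$. Put $(\alpha,s)_n=\prod_{r=0}^{n-1}(1-\alpha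 s^r)$, $\binom{n}{m}_{s}=\frac{(s,s)_n}{(s,s)_m(s,s)_{n-m}}$, $I_l=\{-l,-l+1,\dots,l\}$. For $l\in\frac12\mathbb{N}$ and $j\in I_l$ let $f^l_j=\binom{2l}{l+j}_{|q|^2}^{1/2}a^{l-j}b^{l+j}$ and $V_l=\bigoplus_{j\in I_l}\mathbb{C}f^l_j\subset\mathcal{A}_q$. $T_l$ is (up to equivalence) the $(2l+1)$-dimensional right corepresentation $\Delta|_{V_l}:V_l\to V_l\otimes\mathcal{A}_q$, with matrix coefficients $t^l_{ij}$ given by $\Delta(f^l_j)=\sum_{i\in I_l}f^l_i\otimes t^l_{ij}$. For $m\in\mathbb{Z}$, $T_lD^m$ is the corepresentation on $\bigoplus_i\mathbb{C}f^l_iD^m$ given by $f^l_iD^m\mapsto\sum_{j\in I_l}f^l_jD^m\otimes t^l_{ji}D^m$. Tensor product of corepresentations is the usual one (matrix coefficients multiply in $\mathcal{A}_q$), and $\simeq$ denotes equivalence of corepresentations. *)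

theory Defs
  imports
    Complex_Main
    "HOL-Library.Poly_Mapping"
    "HOL-Algebra.Ring"
begin

section \<open>Complex unital $*$-algebras with explicit carrier\<close>

record 'a star_alg = "'a ring" +
  scale :: "complex \<Rightarrow> 'a \<Rightarrow> 'a"
  star :: "'a \<Rightarrow> 'a"

definition star_hom :: "'a star_alg \<Rightarrow> 'b star_alg \<Rightarrow> ('a \<Rightarrow> 'b) \<Rightarrow> bool" where
  "star_hom A B h \<longleftrightarrow>
     (\<forall>x\<in>carrier A. h x \<in> carrier B) \<and>
     h \<one>\<^bsub>A\<^esub> = \<one>\<^bsub>B\<^esub> \<and>
     (\<forall>x\<in>carrier A. \<forall>y\<in>carrier A. h (x \<oplus>\<^bsub>A\<^esub> y) = h x \<oplus>\<^bsub>B\<^esub> h y) \<and>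
     (\<forall>x\<in>carrier A. \<forall>y\<in>carrier A. h (x \<otimes>\<^bsub>A\<^esub> y) = h x \<otimes>\<^bsub>B\<^esub> h y) \<and>
     (\<forall>c. \<forall>x\<in>carrier A. h (scale A c x) = scale B c (h x)) \<and>
     (\<forall>x\<in>carrier A. h (star A x) = star B (h x))"

inductive_set star_generated :: "'a star_alg \<Rightarrow> 'a set \<Rightarrow> 'a set"
  for A :: "'a star_alg" and G :: "'a set" where
  gen: "x \<in> G \<Longrightarrow> x \<in> star_generated A G"
| one: "\<one>\<^bsub>A\<^esub> \<in> star_generated A G"
| add: "x \<in> star_generated A G \<Longrightarrow> y \<in> star_generated A G \<Longrightarrow> x \<oplus>\<^bsub>A\<^esub> y \<in> star_generated A G"
| mult: "x \<in> star_generated A G \<Longrightarrow> y \<in> star_generated A G \<Longrightarrow> x \<otimes>\<^bsub>A\<^esub> y \<in> star_generated A G"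
| scale: "x \<in> star_generated A G \<Longrightarrow> scale A c x \<in> star_generated A G"
| star: "x \<in> star_generated A G \<Longrightarrow> star A x \<in> star_generated A G"

definition star_subalgebra :: "'a star_alg \<Rightarrow> 'a set \<Rightarrow> 'a star_alg" where
  "star_subalgebra A G = A\<lparr>carrier := star_generated A G\<rparr>"

definition quot_alg :: "'a star_alg \<Rightarrow> ('a \<times> 'a) set \<Rightarrow> 'a set star_alg" where
  "quot_alg A R = \<lparr>
     carrier = carrier A // R,
     mult = (\<lambda>X Y. \<Union>x\<in>X. \<Union>y\<in>Y. R `` {x \<otimes>\<^bsub>A\<^esub> y}),
     one = R `` {\<one>\<^bsub>A\<^esub>},
     zero = R `` {\<zero>\<^bsub>A\<^esub>},
     add = (\<lambda>X Y. \<Union>x\<in>X. \<Union>y\<in>Y. R `` {x \<oplus>\<^bsub>A\<^esub> y}),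
     scale = (\<lambda>c X. \<Union>x\<in>X. R `` {scale A c x}),
     star = (\<lambda>X. \<Union>x\<in>X. R `` {star A x})\<rparr>"


section \<open>The free unital $*$-algebra on $a$, $b$, $D$\<close>

datatype generator = Gen_a | Gen_b | Gen_D

text \<open>A letter \<open>(g, s)\<close> stands for \<open>g\<close> if \<open>s\<close> is false and for its adjoint if \<open>s\<close> is true.\<close>

datatype word = Word "(generator \<times> bool) list"

instantiation word :: monoid_add
begin

definition zero_word :: word where
  "0 = Word []"

fun plus_word :: "word \<Rightarrow> word \<Rightarrow> word" where
  "Word u + Word v = Word (u @ v)"

instance
proof
  fix u v w :: word
  show "u + v + w = u + (v + w)"
    by (cases u; cases v; cases w) simp
  show "0 + u = u" "u + 0 = u"
    by (cases u; simp add: zero_word_def)+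
qed

end

text \<open>As words form a monoid (written additively) under concatenation, the ring structure of the
  library on finitely supported functions is that of the monoid algebra.\<close>

type_synonym free_alg = "word \<Rightarrow>\<^sub>0 complex"

definition pm_scale :: "complex \<Rightarrow> ('k \<Rightarrow>\<^sub>0 complex) \<Rightarrow> ('k \<Rightarrow>\<^sub>0 complex)" where
  "pm_scale c x = Poly_Mapping.map (\<lambda>z. c * z) x"

fun word_star :: "word \<Rightarrow> word" where
  "word_star (Word u) = Word (rev (map (\<lambda>(g, s). (g, \<not> s)) u))"

definition free_star :: "free_alg \<Rightarrow> free_alg" where
  "free_star x =
     (\<Sum>w\<in>Poly_Mapping.keys x. Poly_Mapping.single (word_star w) (cnj (Poly_Mapping.lookup x w)))"

definition free_gen :: "generator \<Rightarrow> free_alg" where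
  "free_gen g = Poly_Mapping.single (Word [(g, False)]) 1"


section \<open>The universal $C^*$-algebra $C(U_q(2))$ and its $*$-subalgebra $\mathcal O(U_q(2))$\<close>

definition relators :: "complex \<Rightarrow> free_alg set" where
  "relators q =
     (let a = free_gen Gen_a; b = free_gen Gen_b; D = free_gen Gen_D;
          a' = free_star a; b' = free_star b; D' = free_star D
      in {b * a - pm_scale q (a * b),
          a' * b - pm_scale q (b * a'),
          b * b' - b' * b,
          a * a' + b * b' - 1,
          a * D - D * a,
          b * D - pm_scale (q\<^sup>2 / of_real ((cmod q)\<^sup>2)) (D * b),
          D * D' - 1,
          D' * D - 1,
          a' * a + pm_scale (of_real ((cmod q)\<^sup>2)) (b' * b) - 1})"

definition cstar_seminorm :: "(free_alg \<Rightarrow> real) \<Rightarrow> bool" where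
  "cstar_seminorm p \<longleftrightarrow>
     (\<forall>x y. p (x + y) \<le> p x + p y) \<and>
     (\<forall>c x. p (pm_scale c x) = cmod c * p x) \<and>
     (\<forall>x y. p (x * y) \<le> p x * p y) \<and>
     (\<forall>x. p (free_star x * x) = (p x)\<^sup>2)"

text \<open>The \<open>C\<^sup>*\<close>-seminorms vanishing on the relators are exactly the seminorms \<open>x \<mapsto> \<parallel>\<pi> x\<parallel>\<close> given by
  representations \<open>\<pi>\<close> of the defining relations in \<open>C\<^sup>*\<close>-algebras. For \<open>0 < \<bar>q\<bar> < 1\<close> the relations
  force \<open>p b\<^sup>2 \<le> 2 / (1 - \<bar>q\<bar>\<^sup>2)\<close>, and similarly bound \<open>p a\<close> and \<open>p D\<close>, so the supremum below is
  taken over a bounded set; the zero seminorm makes it nonempty.\<close>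

definition univ_norm :: "complex \<Rightarrow> free_alg \<Rightarrow> real" where
  "univ_norm q x = (SUP p \<in> {p. cstar_seminorm p \<and> (\<forall>r\<in>relators q. p r = 0)}. p x)"

text \<open>The universal unital \<open>C\<^sup>*\<close>-algebra of the relations is the Hausdorff completion of the free
  \<open>*\<close>-algebra in the universal seminorm: Cauchy sequences modulo null sequences.\<close>

definition cauchy_alg :: "complex \<Rightarrow> (nat \<Rightarrow> free_alg) star_alg" where
  "cauchy_alg q = \<lparr>
     carrier = {s. \<forall>e>0. \<exists>N. \<forall>m\<ge>N. \<forall>n\<ge>N. univ_norm q (s m - s n) < e},
     mult = (\<lambda>s t n. s n * t n),
     one = (\<lambda>n. 1),
     zero = (\<lambda>n. 0),
     add = (\<lambda>s t n. s n + t n),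
     scale = (\<lambda>c s n. pm_scale c (s n)),
     star = (\<lambda>s n. free_star (s n))\<rparr>"

definition null_rel :: "complex \<Rightarrow> ((nat \<Rightarrow> free_alg) \<times> (nat \<Rightarrow> free_alg)) set" where
  "null_rel q = {(s, t). s \<in> carrier (cauchy_alg q) \<and> t \<in> carrier (cauchy_alg q) \<and>
                         (\<lambda>n. univ_norm q (s n - t n)) \<longlonglongrightarrow> 0}"

type_synonym uq2 = "(nat \<Rightarrow> free_alg) set"

definition C_Uq2 :: "complex \<Rightarrow> uq2 star_alg" where
  "C_Uq2 q = quot_alg (cauchy_alg q) (null_rel q)"

definition uq2_gen :: "complex \<Rightarrow> generator \<Rightarrow> uq2" where
  "uq2_gen q g = null_rel q `` {\<lambda>n. free_gen g}"

definition O_Uq2 :: "complex \<Rightarrow> uq2 star_alg" where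
  "O_Uq2 q = star_subalgebra (C_Uq2 q) {uq2_gen q Gen_a, uq2_gen q Gen_b, uq2_gen q Gen_D}"


section \<open>Algebraic tensor products\<close>

text \<open>Formal linear combinations of pairs, with the product \<open>(x, y) (x', y') = (x x', y y')\<close> extended
  bilinearly, modulo the span of the bilinearity relations.\<close>

definition formal_tensor :: "'a star_alg \<Rightarrow> 'b star_alg \<Rightarrow> ('a \<times> 'b \<Rightarrow>\<^sub>0 complex) star_alg" where
  "formal_tensor A B = \<lparr>
     carrier = {s. Poly_Mapping.keys s \<subseteq> carrier A \<times> carrier B},
     mult = (\<lambda>s t. \<Sum>(x, y)\<in>Poly_Mapping.keys s. \<Sum>(x', y')\<in>Poly_Mapping.keys t.
               Poly_Mapping.single (x \<otimes>\<^bsub>A\<^esub> x', y \<otimes>\<^bsub>B\<^esub> y')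
                 (Poly_Mapping.lookup s (x, y) * Poly_Mapping.lookup t (x', y'))),
     one = Poly_Mapping.single (\<one>\<^bsub>A\<^esub>, \<one>\<^bsub>B\<^esub>) 1,
     zero = 0,
     add = (\<lambda>s t. s + t),
     scale = pm_scale,
     star = (\<lambda>s. \<Sum>(x, y)\<in>Poly_Mapping.keys s.
               Poly_Mapping.single (star A x, star B y) (cnj (Poly_Mapping.lookup s (x, y))))\<rparr>"

definition bilinearity_relators :: "'a star_alg \<Rightarrow> 'b star_alg \<Rightarrow> ('a \<times> 'b \<Rightarrow>\<^sub>0 complex) set" where
  "bilinearity_relators A B =
     {Poly_Mapping.single (x \<oplus>\<^bsub>A\<^esub> x', y) 1 - Poly_Mapping.single (x, y) 1 - Poly_Mapping.single (x', y) 1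
        | x x' y. x \<in> carrier A \<and> x' \<in> carrier A \<and> y \<in> carrier B} \<union>
     {Poly_Mapping.single (x, y \<oplus>\<^bsub>B\<^esub> y') 1 - Poly_Mapping.single (x, y) 1 - Poly_Mapping.single (x, y') 1
        | x y y'. x \<in> carrier A \<and> y \<in> carrier B \<and> y' \<in> carrier B} \<union>
     {Poly_Mapping.single (scale A c x, y) 1 - Poly_Mapping.single (x, y) c
        | c x y. x \<in> carrier A \<and> y \<in> carrier B} \<union>
     {Poly_Mapping.single (x, scale B c y) 1 - Poly_Mapping.single (x, y) c
        | c x y. x \<in> carrier A \<and> y \<in> carrier B}"

definition tensor_rel ::
  "'a star_alg \<Rightarrow> 'b star_alg \<Rightarrow> (('a \<times> 'b \<Rightarrow>\<^sub>0 complex) \<times> ('a \<times> 'b \<Rightarrow>\<^sub>0 complex)) set" where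
  "tensor_rel A B = {(s, t). s \<in> carrier (formal_tensor A B) \<and> t \<in> carrier (formal_tensor A B) \<and>
                             s - t \<in> module.span pm_scale (bilinearity_relators A B)}"

definition tensor_alg :: "'a star_alg \<Rightarrow> 'b star_alg \<Rightarrow> ('a \<times> 'b \<Rightarrow>\<^sub>0 complex) set star_alg" where
  "tensor_alg A B = quot_alg (formal_tensor A B) (tensor_rel A B)"

definition tensor_elt ::
  "'a star_alg \<Rightarrow> 'b star_alg \<Rightarrow> 'a \<Rightarrow> 'b \<Rightarrow> ('a \<times> 'b \<Rightarrow>\<^sub>0 complex) set" where
  "tensor_elt A B x y = tensor_rel A B `` {Poly_Mapping.single (x, y) 1}"


section \<open>Comultiplication\<close>

text \<open>There is exactly one such map on \<open>carrier (O_Uq2 q)\<close>; uniqueness is clear, as the three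
  generators generate the \<open>*\<close>-algebra.\<close>

type_synonym uq2_tensor = "(uq2 \<times> uq2 \<Rightarrow>\<^sub>0 complex) set"

definition is_comultiplication :: "complex \<Rightarrow> (uq2 \<Rightarrow> uq2_tensor) \<Rightarrow> bool" where
  "is_comultiplication q \<Delta> \<longleftrightarrow>
     (let A = O_Uq2 q; AA = tensor_alg A A; tens = tensor_elt A A;
          a = uq2_gen q Gen_a; b = uq2_gen q Gen_b; D = uq2_gen q Gen_D
      in star_hom A AA \<Delta> \<and>
         \<Delta> a = tens a a \<oplus>\<^bsub>AA\<^esub> scale AA (- cnj q) (tens b (D \<otimes>\<^bsub>A\<^esub> star A b)) \<and>
         \<Delta> b = tens a b \<oplus>\<^bsub>AA\<^esub> tens b (D \<otimes>\<^bsub>A\<^esub> star A a) \<and>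
         \<Delta> D = tens D D)"


section \<open>Finite-dimensional corepresentations\<close>

text \<open>A right corepresentation on the space with basis \<open>(e\<^sub>i)\<close>, \<open>i \<in> index u\<close>, is recorded by its matrix
  coefficients: \<open>e\<^sub>j \<mapsto> \<Sum>\<^sub>i e\<^sub>i \<otimes> coeff u i j\<close>.\<close>

record ('i, 'a) corep =
  index :: "'i set"
  coeff :: "'i \<Rightarrow> 'i \<Rightarrow> 'a"

definition corep_tensor ::
  "'a star_alg \<Rightarrow> ('i, 'a) corep \<Rightarrow> ('j, 'a) corep \<Rightarrow> ('i \<times> 'j, 'a) corep" where
  "corep_tensor A u v = \<lparr>
     index = index u \<times> index v,
     coeff = (\<lambda>(i, k) (j, l). coeff u i j \<otimes>\<^bsub>A\<^esub> coeff v k l)\<rparr>"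

definition corep_direct_sum ::
  "'a star_alg \<Rightarrow> 'k set \<Rightarrow> ('k \<Rightarrow> ('i, 'a) corep) \<Rightarrow> ('k \<times> 'i, 'a) corep" where
  "corep_direct_sum A K u = \<lparr>
     index = (SIGMA k:K. index (u k)),
     coeff = (\<lambda>(k, i) (k', j). if k = k' then coeff (u k) i j else \<zero>\<^bsub>A\<^esub>)\<rparr>"

text \<open>Equivalence: an invertible linear map \<open>e\<^sub>j \<mapsto> \<Sum>\<^sub>k M k j e\<^sub>k\<close> that intertwines the two coactions.\<close>

definition corep_equiv :: "'a star_alg \<Rightarrow> ('i, 'a) corep \<Rightarrow> ('j, 'a) corep \<Rightarrow> bool" where
  "corep_equiv A u v \<longleftrightarrow>
     (\<exists>(M :: 'j \<Rightarrow> 'i \<Rightarrow> complex) (N :: 'i \<Rightarrow> 'j \<Rightarrow> complex).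
        (\<forall>i\<in>index u. \<forall>j\<in>index u. (\<Sum>k\<in>index v. N i k * M k j) = (if i = j then 1 else 0)) \<and>
        (\<forall>k\<in>index v. \<forall>l\<in>index v. (\<Sum>i\<in>index u. M k i * N i l) = (if k = l then 1 else 0)) \<and>
        (\<forall>k\<in>index v. \<forall>j\<in>index u.
           (\<Oplus>\<^bsub>A\<^esub>i\<in>index u. scale A (M k i) (coeff u i j)) =
           (\<Oplus>\<^bsub>A\<^esub>l\<in>index v. scale A (M l j) (coeff v k l))))"


section \<open>The corepresentations $T_l D^m$\<close>

definition half_nats :: "real set" where
  "half_nats = {real n / 2 | n :: nat. True}"

definition spin_index :: "real \<Rightarrow> real set" where
  "spin_index l = {- l + real k | k :: nat. - l + real k \<le> l}"

definition q_poch :: "real \<Rightarrow> real \<Rightarrow> nat \<Rightarrow> real" where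
  "q_poch \<alpha> s n = (\<Prod>r<n. 1 - \<alpha> * s ^ r)"

definition q_binom :: "real \<Rightarrow> nat \<Rightarrow> nat \<Rightarrow> real" where
  "q_binom s n m = q_poch s s n / (q_poch s s m * q_poch s s (n - m))"

definition f_vec :: "complex \<Rightarrow> real \<Rightarrow> real \<Rightarrow> uq2" where
  "f_vec q l j =
     (let A = O_Uq2 q
      in scale A (of_real (sqrt (q_binom ((cmod q)\<^sup>2) (nat \<lfloor>2 * l\<rfloor>) (nat \<lfloor>l + j\<rfloor>))))
           (uq2_gen q Gen_a [^]\<^bsub>A\<^esub> nat \<lfloor>l - j\<rfloor> \<otimes>\<^bsub>A\<^esub> uq2_gen q Gen_b [^]\<^bsub>A\<^esub> nat \<lfloor>l + j\<rfloor>))"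

text \<open>The coefficients with indices in \<open>spin_index l\<close> are uniquely determined, because the
  vectors \<open>f_vec q l i\<close>, \<open>i \<in> spin_index l\<close>, are linearly independent.\<close>

definition t_coeff :: "complex \<Rightarrow> (uq2 \<Rightarrow> uq2_tensor) \<Rightarrow> real \<Rightarrow> real \<Rightarrow> real \<Rightarrow> uq2" where
  "t_coeff q \<Delta> l =
     (SOME t. (\<forall>i\<in>spin_index l. \<forall>j\<in>spin_index l. t i j \<in> carrier (O_Uq2 q)) \<and>
              (\<forall>j\<in>spin_index l.
                 \<Delta> (f_vec q l j) =
                 (\<Oplus>\<^bsub>tensor_alg (O_Uq2 q) (O_Uq2 q)\<^esub>i\<in>spin_index l.
                    tensor_elt (O_Uq2 q) (O_Uq2 q) (f_vec q l i) (t i j))))"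

text \<open>\<open>D\<close> is unitary, so the library's integer power is taken with \<open>inv D = star D\<close>.\<close>

definition TD :: "complex \<Rightarrow> (uq2 \<Rightarrow> uq2_tensor) \<Rightarrow> real \<Rightarrow> int \<Rightarrow> (real, uq2) corep" where
  "TD q \<Delta> l m = \<lparr>
     index = spin_index l,
     coeff = (\<lambda>i j. t_coeff q \<Delta> l i j \<otimes>\<^bsub>O_Uq2 q\<^esub> (uq2_gen q Gen_D [^]\<^bsub>O_Uq2 q\<^esub> m))\<rparr>"

end

theory Submission
  imports
    Defs
    "HOL-Analysis.L2_Norm"
    "Jordan_Normal_Form.Determinant"
begin

text \<open>Write \<open>V k\<close> and \<open>T k\<close> for the space and corepresentation of spin \<open>k / 2\<close>. Multiplication
  \<open>V m \<otimes> V n \<rightarrow> V (m + n)\<close> intertwines \<open>T m \<otimes> T n\<close> with \<open>T (m + n)\<close>, and inserting the quantum determinant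
  \<open>a \<otimes> b - q\<^bsup>-1\<^esup> b \<otimes> a\<close> between the factors embeds \<open>T (m - 1) D \<otimes> T (n - 1)\<close> into the kernel. In the
  normalised bases all \<open>T k\<close> are unitary, by induction on \<open>k\<close>, so adjoints of intertwiners are intertwiners;
  the adjoint of multiplication and the embedding together form an injective square matrix. Hence
  \<open>T m \<otimes> T n \<simeq> T (m + n) \<oplus> T (m - 1) D \<otimes> T (n - 1)\<close>, and one iterates, moving \<open>D\<close> to the right by a
  diagonal change of basis.

  The matrix coefficients are pinned down by their defining equation because the monomials
  \<open>a\<^bsup>n - k\<^esup> b\<^sup>k\<close> are linearly independent in the universal \<open>C\<^sup>*\<close>-algebra, as the representation by
  weighted shifts shows.\<close>

section \<open>Matrices over a ring\<close>

definition mprod :: "'j set \<Rightarrow> ('i \<Rightarrow> 'j \<Rightarrow> 'r::semiring_1) \<Rightarrow> ('j \<Rightarrow> 'k \<Rightarrow> 'r) \<Rightarrow> 'i \<Rightarrow> 'k \<Rightarrow> 'r" where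
  "mprod J M N i k = (\<Sum>j\<in>J. M i j * N j k)"

definition mid :: "'i \<Rightarrow> 'i \<Rightarrow> 'r::semiring_1" where
  "mid i j = (if i = j then 1 else 0)"

definition meq :: "'i set \<Rightarrow> 'j set \<Rightarrow> ('i \<Rightarrow> 'j \<Rightarrow> 'r) \<Rightarrow> ('i \<Rightarrow> 'j \<Rightarrow> 'r) \<Rightarrow> bool" where
  "meq I J M N \<longleftrightarrow> (\<forall>i\<in>I. \<forall>j\<in>J. M i j = N i j)"

lemma meqI: "(\<And>i j. i \<in> I \<Longrightarrow> j \<in> J \<Longrightarrow> M i j = N i j) \<Longrightarrow> meq I J M N"
  by (simp add: meq_def)

lemma meqD: "meq I J M N \<Longrightarrow> i \<in> I \<Longrightarrow> j \<in> J \<Longrightarrow> M i j = N i j"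
  by (simp add: meq_def)

lemma meq_refl [simp]: "meq I J M M"
  by (simp add: meq_def)

lemma meq_sym: "meq I J M N \<Longrightarrow> meq I J N M"
  by (simp add: meq_def)

lemma meq_trans [trans]: "meq I J M N \<Longrightarrow> meq I J N P \<Longrightarrow> meq I J M P"
  by (simp add: meq_def)

lemma eq_meq_trans [trans]: "M = N \<Longrightarrow> meq I J N P \<Longrightarrow> meq I J M P"
  and meq_eq_trans [trans]: "meq I J M N \<Longrightarrow> N = P \<Longrightarrow> meq I J M P"
  by simp_all

lemma mprod_cong:
  assumes "meq I J M M'" and "meq J K N N'"
  shows "meq I K (mprod J M N) (mprod J M' N')"
  using assms unfolding meq_def mprod_def by (auto intro!: sum.cong)

lemma mprod_cong_left: "meq I J M M' \<Longrightarrow> meq I K (mprod J M N) (mprod J M' N)"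
  by (rule mprod_cong) auto

lemma mprod_cong_right: "meq J K N N' \<Longrightarrow> meq I K (mprod J M N) (mprod J M N')"
  by (rule mprod_cong) auto

lemma mprod_assoc: "mprod K (mprod J M N) P = mprod J M (mprod K N P)"
proof (intro ext)
  fix i l
  have "mprod K (mprod J M N) P i l = (\<Sum>k\<in>K. \<Sum>j\<in>J. M i j * N j k * P k l)"
    by (simp add: mprod_def sum_distrib_right)
  also have "\<dots> = (\<Sum>j\<in>J. \<Sum>k\<in>K. M i j * N j k * P k l)"
    by (rule sum.swap)
  also have "\<dots> = mprod J M (mprod K N P) i l"
    by (simp add: mprod_def sum_distrib_left mult.assoc)
  finally show "mprod K (mprod J M N) P i l = mprod J M (mprod K N P) i l" .
qed

lemma if_zero_mult: "(if P then y else 0) * (x::'r::semiring_1) = (if P then y * x else 0)"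
  and mult_if_zero: "(x::'r::semiring_1) * (if P then y else 0) = (if P then x * y else 0)"
  by simp_all

lemma mprod_mid_left: "finite I \<Longrightarrow> meq I J (mprod I mid M) M"
  unfolding meq_def mprod_def mid_def by (simp add: if_zero_mult mult_if_zero)

lemma mprod_mid_right: "finite J \<Longrightarrow> meq I J (mprod J M mid) M"
  unfolding meq_def mprod_def mid_def by (simp add: if_zero_mult mult_if_zero)

lemma square_injective_imp_invertible:
  fixes M :: "'j \<Rightarrow> 'i \<Rightarrow> complex"
  assumes fin: "finite I" "finite J" and card: "card I = card J"
    and inj: "\<And>x. (\<And>k. k \<in> J \<Longrightarrow> (\<Sum>i\<in>I. M k i * x i) = 0) \<Longrightarrow> (\<And>i. i \<in> I \<Longrightarrow> x i = 0)"
  obtains N where "meq I I (mprod J N M) mid" and "meq J J (mprod I M N) mid"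
proof -
  define n where "n = card I"
  obtain f where f: "bij_betw f {0..<n} I"
    using fin n_def ex_bij_betw_nat_finite by blast
  obtain g where g: "bij_betw g {0..<n} J"
    using fin card n_def ex_bij_betw_nat_finite by metis
  define A where "A = mat n n (\<lambda>(k, i). M (g k) (f i))"
  have A: "A \<in> carrier_mat n n" by (simp add: A_def)
  have "det A \<noteq> 0"
  proof
    assume "det A = 0"
    then obtain v where v: "v \<in> carrier_vec n" "v \<noteq> 0\<^sub>v n" "A *\<^sub>v v = 0\<^sub>v n"
      using det_0_iff_vec_prod_zero_field[OF A] by blast
    define x where "x i = v $ (the_inv_into {0..<n} f i)" for i
    have xf: "x (f i) = v $ i" if "i < n" for i
      using that f by (simp add: x_def the_inv_into_f_f bij_betw_def)
    have "(\<Sum>i\<in>I. M k i * x i) = 0" if k: "k \<in> J" for k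
    proof -
      obtain k' where k': "k' < n" "k = g k'"
        using k g by (auto simp: bij_betw_def)
      have "(\<Sum>i\<in>I. M k i * x i) = (\<Sum>i\<in>{0..<n}. M k (f i) * x (f i))"
        using sum.reindex_bij_betw[OF f, of "\<lambda>i. M k i * x i"] by simp
      also have "\<dots> = (A *\<^sub>v v) $ k'"
        using k' v(1) by (simp add: A_def scalar_prod_def xf)
      also have "\<dots> = 0" using v(3) k' by simp
      finally show ?thesis .
    qed
    then have x0: "x i = 0" if "i \<in> I" for i using inj that by blast
    have "v = 0\<^sub>v n"
    proof (rule eq_vecI)
      show "v $ i = 0\<^sub>v n $ i" if "i < dim_vec (0\<^sub>v n)" for i
        using that x0[of "f i"] xf[of i] f by (auto simp: bij_betw_def)
    qed (use v(1) in auto)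
    with v(2) show False by simp
  qed
  then have "A \<in> Units (ring_mat TYPE(complex) n ())"
    by (rule det_non_zero_imp_unit[OF A])
  then obtain B where B: "B \<in> carrier_mat n n" "B * A = 1\<^sub>m n" "A * B = 1\<^sub>m n"
    by (auto simp: Units_def ring_mat_def)
  define f' where "f' = the_inv_into {0..<n} f"
  define g' where "g' = the_inv_into {0..<n} g"
  define N where "N i k = B $$ (f' i, g' k)" for i k
  have f': "f' i < n" "f (f' i) = i" if "i \<in> I" for i
    using that f unfolding f'_def bij_betw_def
    by (metis atLeastLessThan_iff subset_refl the_inv_into_into, metis f_the_inv_into_f)
  have g': "g' k < n" "g (g' k) = k" if "k \<in> J" for k
    using that g unfolding g'_def bij_betw_def
    by (metis atLeastLessThan_iff subset_refl the_inv_into_into, metis f_the_inv_into_f)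
  have ff': "f' (f i) = i" if "i < n" for i
    using that f by (simp add: f'_def the_inv_into_f_f bij_betw_def)
  have gg': "g' (g i) = i" if "i < n" for i
    using that g by (simp add: g'_def the_inv_into_f_f bij_betw_def)
  show thesis
  proof
    show "meq I I (mprod J N M) mid"
    proof (rule meqI)
      fix i j assume ij: "i \<in> I" "j \<in> I"
      have "mprod J N M i j = (\<Sum>k\<in>{0..<n}. N i (g k) * M (g k) j)"
        unfolding mprod_def using sum.reindex_bij_betw[OF g, of "\<lambda>k. N i k * M k j"] by simp
      also have "\<dots> = (\<Sum>k\<in>{0..<n}. B $$ (f' i, k) * A $$ (k, f' j))"
        using f' ij by (intro sum.cong) (auto simp: N_def A_def gg')
      also have "\<dots> = (B * A) $$ (f' i, f' j)"
        using A B(1) f' ij by (simp add: scalar_prod_def)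
      also have "\<dots> = mid i j"
      proof -
        have "f' i = f' j \<longleftrightarrow> i = j" using f'(2) ij by metis
        then show ?thesis using f'(1) ij by (simp add: B(2) mid_def)
      qed
      finally show "mprod J N M i j = mid i j" .
    qed
    show "meq J J (mprod I M N) mid"
    proof (rule meqI)
      fix i j assume ij: "i \<in> J" "j \<in> J"
      have "mprod I M N i j = (\<Sum>k\<in>{0..<n}. M i (f k) * N (f k) j)"
        unfolding mprod_def using sum.reindex_bij_betw[OF f, of "\<lambda>k. M i k * N k j"] by simp
      also have "\<dots> = (\<Sum>k\<in>{0..<n}. A $$ (g' i, k) * B $$ (k, g' j))"
        using g' ij by (intro sum.cong) (auto simp: N_def A_def ff')
      also have "\<dots> = (A * B) $$ (g' i, g' j)"
        using A B(1) g' ij by (simp add: scalar_prod_def)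
      also have "\<dots> = mid i j"
      proof -
        have "g' i = g' j \<longleftrightarrow> i = j" using g'(2) ij by metis
        then show ?thesis using g'(1) ij by (simp add: B(3) mid_def)
      qed
      finally show "mprod I M N i j = mid i j" .
    qed
  qed
qed

section \<open>Coefficient matrices over a complex star-algebra\<close>

locale complex_star_algebra = vector_space sc
  for sc :: "complex \<Rightarrow> 'r::ring_1 \<Rightarrow> 'r" (infixr "\<cdot>" 75) +
  fixes st :: "'r \<Rightarrow> 'r"
  assumes sc_mult_left [simp]: "(z \<cdot> x) * y = z \<cdot> (x * y)"
    and sc_mult_right [simp]: "x * (z \<cdot> y) = z \<cdot> (x * y)"
    and st_add [simp]: "st (x + y) = st x + st y"
    and st_mult [simp]: "st (x * y) = st y * st x"
    and st_st [simp]: "st (st x) = x"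
    and st_sc [simp]: "st (z \<cdot> x) = cnj z \<cdot> st x"
begin

lemma st_one [simp]: "st 1 = 1"
  by (metis mult_1 mult.right_neutral st_mult st_st)

lemma st_zero [simp]: "st 0 = 0"
  using st_add[of 0 0] by simp

lemma st_minus [simp]: "st (- x) = - st x"
  using st_add[of x "- x"] by (simp add: eq_neg_iff_add_eq_0 add.commute)

lemma st_sum: "st (\<Sum>i\<in>I. f i) = (\<Sum>i\<in>I. st (f i))"
  by (induction I rule: infinite_finite_induct) auto

definition em :: "('i \<Rightarrow> 'j \<Rightarrow> complex) \<Rightarrow> 'i \<Rightarrow> 'j \<Rightarrow> 'r" where
  "em M i j = M i j \<cdot> 1"

definition adj :: "('i \<Rightarrow> 'j \<Rightarrow> 'r) \<Rightarrow> 'j \<Rightarrow> 'i \<Rightarrow> 'r" where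
  "adj u i j = st (u j i)"

definition cadj :: "('i \<Rightarrow> 'j \<Rightarrow> complex) \<Rightarrow> 'j \<Rightarrow> 'i \<Rightarrow> complex" where
  "cadj M i j = cnj (M j i)"

lemma cadj_cadj [simp]: "cadj (cadj M) = M"
  by (simp add: cadj_def fun_eq_iff)

lemma adj_em: "adj (em M) = em (cadj M)"
  by (simp add: adj_def em_def cadj_def fun_eq_iff)

lemma adj_mprod: "adj (mprod J u v) = mprod J (adj v) (adj u)"
  by (simp add: adj_def mprod_def fun_eq_iff st_sum)

lemma em_mprod: "em (mprod J M N) = mprod J (em M) (em N)"
  by (simp add: em_def mprod_def fun_eq_iff scale_sum_left mult.commute)

lemma em_mid: "em mid = mid"
  by (simp add: em_def mid_def fun_eq_iff)

lemma meq_adj: "meq I J u v \<Longrightarrow> meq J I (adj u) (adj v)"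
  by (simp add: meq_def adj_def)

lemma meq_em: "meq I J M N \<Longrightarrow> meq I J (em M) (em N)"
  by (simp add: meq_def em_def)

definition intertwines where
  "intertwines I J M u v \<longleftrightarrow> meq J I (mprod I (em M) u) (mprod J v (em M))"

lemma intertwines_adj:
  assumes fin: "finite I" "finite J"
    and M: "intertwines I J M u v"
    and u: "meq I I (mprod I u (adj u)) mid"
    and v: "meq J J (mprod J (adj v) v) mid"
  shows "intertwines J I (cadj M) v u"
proof -
  let ?M' = "em (cadj M)"
  have M': "meq I J (mprod I (adj u) ?M') (mprod J ?M' (adj v))"
    using meq_adj[OF M[unfolded intertwines_def]] by (simp add: adj_mprod adj_em)
  have "meq I J (mprod J ?M' v) (mprod I mid (mprod J ?M' v))"
    using fin by (intro meq_sym[OF mprod_mid_left])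
  also have "meq I J \<dots> (mprod I (mprod I u (adj u)) (mprod J ?M' v))"
    by (intro mprod_cong_left meq_sym[OF u])
  also have "mprod I (mprod I u (adj u)) (mprod J ?M' v) = mprod I u (mprod J (mprod I (adj u) ?M') v)"
    by (simp add: mprod_assoc)
  also have "meq I J \<dots> (mprod I u (mprod J (mprod J ?M' (adj v)) v))"
    by (intro mprod_cong_right mprod_cong_left M')
  also have "mprod I u (mprod J (mprod J ?M' (adj v)) v) = mprod I u (mprod J ?M' (mprod J (adj v) v))"
    by (simp add: mprod_assoc)
  also have "meq I J \<dots> (mprod I u (mprod J ?M' mid))"
    by (intro mprod_cong_right v)
  also have "meq I J \<dots> (mprod I u ?M')"
    using fin by (intro mprod_cong_right mprod_mid_right)
  finally show ?thesis by (simp add: intertwines_def)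
qed

definition unitary :: "'i set \<Rightarrow> ('i \<Rightarrow> 'i \<Rightarrow> 'r) \<Rightarrow> bool" where
  "unitary I u \<longleftrightarrow> meq I I (mprod I u (adj u)) mid \<and> meq I I (mprod I (adj u) u) mid"

end

section \<open>The quantum group relations\<close>

locale uq2_relations = complex_star_algebra sc st
  for sc :: "complex \<Rightarrow> 'r::ring_1 \<Rightarrow> 'r" (infixr "\<cdot>" 75) and st :: "'r \<Rightarrow> 'r" +
  fixes q :: complex and a b D :: 'r
  assumes q0: "0 < cmod q" and q1: "cmod q < 1"
    and ba: "b * a = q \<cdot> (a * b)"
    and a'b: "st a * b = q \<cdot> (b * st a)"
    and bb': "b * st b = st b * b"
    and aa': "a * st a + b * st b = 1"
    and aD: "a * D = D * a"
    and bD: "b * D = (q\<^sup>2 / of_real ((cmod q)\<^sup>2)) \<cdot> (D * b)"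
    and DD': "D * st D = 1" "st D * D = 1"
    and a'a: "st a * a + of_real ((cmod q)\<^sup>2) \<cdot> (st b * b) = 1"
begin

definition c :: 'r where "c = (- cnj q) \<cdot> (D * st b)"
definition d :: 'r where "d = D * st a"

definition theta :: complex where "theta = q / cnj q"

lemma q_nz [simp]: "q \<noteq> 0"
  using q0 by auto

lemma theta_nz [simp]: "theta \<noteq> 0"
  by (simp add: theta_def)

lemma cmod2: "of_real ((cmod q)\<^sup>2) = q * cnj q"
  using complex_norm_square[of q] by simp

lemma bD_theta: "b * D = theta \<cdot> (D * b)"
  using bD unfolding cmod2 theta_def by (simp add: power2_eq_square)

lemma cnj_theta: "cnj theta = inverse theta"
  by (simp add: theta_def)

lemma D_cancel [simp]: "D * (st D * x) = x" "st D * (D * x) = x"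
  using DD' by (metis mult.assoc mult_1)+

lemma move_D:
  assumes "x * D = z \<cdot> (D * x)" and "z \<noteq> 0"
  shows "D * x = inverse z \<cdot> (x * D)" and "st D * x = z \<cdot> (x * st D)"
proof -
  show *: "D * x = inverse z \<cdot> (x * D)" using assms by simp
  have "z \<cdot> (x * st D) = z \<cdot> (st D * (D * x) * st D)" by simp
  also have "D * x = inverse z \<cdot> (x * D)" by (fact *)
  also have "z \<cdot> (st D * (inverse z \<cdot> (x * D)) * st D) = st D * x"
    using assms(2) by (simp add: mult.assoc DD')
  finally show "st D * x = z \<cdot> (x * st D)" ..
qed

lemma D_a': "st a * D = D * st a"
proof -
  have "st D * a = a * st D" using move_D(2)[of a 1] aD by simp
  then have "st (st D * a) = st (a * st D)" by simp
  then show ?thesis by simp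
qed

lemma b'_D: "st b * D = inverse theta \<cdot> (D * st b)"
proof -
  have "st (st D * b) = st (theta \<cdot> (b * st D))" using move_D(2)[OF bD_theta] by simp
  then show ?thesis by (simp add: cnj_theta)
qed

lemma a'b': "st a * st b = cnj q \<cdot> (st b * st a)"
  using arg_cong[OF ba, of st] by simp

lemma dc: "d * c = q \<cdot> (c * d)"
proof -
  have 1: "d * c = (- cnj q * cnj q) \<cdot> (D * (D * (st b * st a)))"
    by (simp add: c_def d_def mult.assoc, subst mult.assoc[symmetric, of "st a"])
      (simp add: D_a' mult.assoc a'b')
  have 2: "c * d = (- cnj q * inverse theta) \<cdot> (D * (D * (st b * st a)))"
    by (simp add: c_def d_def mult.assoc, subst mult.assoc[symmetric, of "st b"])
      (simp add: b'_D mult.assoc)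
  show ?thesis unfolding 1 2 by (simp add: theta_def)
qed

lemma ad: "a * d = D * (a * st a)"
  by (simp add: d_def mult.assoc[symmetric] aD)

lemma da: "d * a = D * (st a * a)"
  by (simp add: d_def mult.assoc)

lemma bc: "b * c = (- q) \<cdot> (D * (b * st b))"
  by (simp add: c_def mult.assoc[symmetric] bD_theta) (simp add: theta_def)

lemma cb: "c * b = (- cnj q) \<cdot> (D * (b * st b))"
  by (simp add: c_def mult.assoc bb')

lemma aa'_eq: "a * st a = 1 - b * st b"
  using aa' by (simp add: algebra_simps)

lemma a'a_eq: "st a * a = 1 - (q * cnj q) \<cdot> (b * st b)"
  using a'a unfolding cmod2 by (simp add: bb' algebra_simps)

lemma mixed: "b * c + q \<cdot> (d * a) = q \<cdot> (a * d + q \<cdot> (c * b))"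
  by (simp add: ad da bc cb aa'_eq a'a_eq algebra_simps)

lemma det_right: "a * d - inverse q \<cdot> (b * c) = D"
  by (simp add: ad bc aa'_eq algebra_simps)

lemma det_left: "c * b - inverse q \<cdot> (d * a) = - inverse q \<cdot> D"
  by (simp add: cb da a'a_eq algebra_simps)

lemma ab_zero: "a * b - inverse q \<cdot> (b * a) = 0"
  by (simp add: ba)

lemma cd_zero: "c * d - inverse q \<cdot> (d * c) = 0"
  by (simp add: dc)

lemma D_b: "D * b = inverse theta \<cdot> (b * D)"
  by (rule move_D(1)[OF bD_theta]) simp

lemma D_c: "D * c = theta \<cdot> (c * D)"
  by (simp add: c_def mult.assoc b'_D)

lemma D_d: "D * d = d * D"
  by (simp add: d_def mult.assoc D_a')

text \<open>Let \<open>x\<close>, \<open>y\<close> commute with the algebra and satisfy \<open>y x = q x y\<close>, and put \<open>X = x a + y c\<close>,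
  \<open>Y = x b + y d\<close>. A homogeneous polynomial \<open>\<Sum>\<^sub>i x\<^bsup>n - i\<^esup> y\<^sup>i p i\<close> is represented by its coefficients \<open>p\<close>:
  \<open>lmul u v n\<close> is left multiplication by \<open>x u + y v\<close>, \<open>conv n\<close> is the product with a polynomial of
  degree \<open>n\<close>, and \<open>\<lambda>i. tau n i j\<close> is \<open>X\<^bsup>n - j\<^esup> Y\<^sup>j\<close>.\<close>

definition lmul :: "'r \<Rightarrow> 'r \<Rightarrow> nat \<Rightarrow> (nat \<Rightarrow> 'r) \<Rightarrow> nat \<Rightarrow> 'r" where
  "lmul x y n p i = x * p i + (case i of 0 \<Rightarrow> 0 | Suc k \<Rightarrow> q ^ (n - k) \<cdot> (y * p k))"

fun tau :: "nat \<Rightarrow> nat \<Rightarrow> nat \<Rightarrow> 'r" where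
  "tau 0 i j = (if i = 0 \<and> j = 0 then 1 else 0)"
| "tau (Suc n) i j =
     (if j \<le> n then lmul a c n (\<lambda>i. tau n i j) i
      else if j = Suc n then lmul b d n (\<lambda>i. tau n i n) i
      else 0)"

lemma lmul_sc: "lmul x y n (\<lambda>i. z \<cdot> p i) i = z \<cdot> lmul x y n p i"
  by (simp add: lmul_def scale_right_distrib mult.commute split: nat.split)

lemma tau_above: "n < i \<Longrightarrow> tau n i j = 0"
  by (induction n arbitrary: i j) (auto simp: lmul_def split: nat.split)

text \<open>The relation \<open>Y X = q X Y\<close>.\<close>

lemma lmul_commute:
  assumes p: "\<And>i. m < i \<Longrightarrow> p i = 0"
  shows "lmul b d (Suc m) (lmul a c m p) i = q \<cdot> lmul a c (Suc m) (lmul b d m p) i"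
proof -
  consider "i = 0" | "i = 1" | k where "i = Suc (Suc k)"
    by (metis One_nat_def not0_implies_Suc)
  then show ?thesis
  proof cases
    case 1
    then show ?thesis by (simp add: lmul_def mult.assoc[symmetric] ba)
  next
    case 2
    have "lmul b d (Suc m) (lmul a c m p) i = b * a * p 1 + q ^ m \<cdot> ((b * c + q \<cdot> (d * a)) * p 0)"
      by (simp add: 2 lmul_def algebra_simps)
    also have "\<dots> = q \<cdot> lmul a c (Suc m) (lmul b d m p) i"
      unfolding mixed ba by (simp add: 2 lmul_def algebra_simps)
    finally show ?thesis .
  next
    case (3 k)
    show ?thesis
    proof (cases "k < m")
      case True
      define e where "e = m - Suc k"
      have e: "m - k = Suc e" "Suc m - Suc k = Suc e" "m - Suc k = e"
        using True by (auto simp: e_def)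
      have "lmul b d (Suc m) (lmul a c m p) i =
          b * a * p i + q ^ e \<cdot> ((b * c + q \<cdot> (d * a)) * p (Suc k)) + (q ^ e * q * q ^ e * q) \<cdot> (d * c * p k)"
        by (simp add: 3 lmul_def e algebra_simps)
      also have "\<dots> = q \<cdot> lmul a c (Suc m) (lmul b d m p) i"
        unfolding mixed ba dc by (simp add: 3 lmul_def e algebra_simps)
      finally show ?thesis .
    next
      case False
      then have "p (Suc k) = 0" "p i = 0" using p 3 by auto
      then show ?thesis
        using False by (simp add: 3 lmul_def mult.assoc[symmetric] dc)
    qed
  qed
qed

lemma lmul_tau_a: "j \<le> n \<Longrightarrow> lmul a c n (\<lambda>i. tau n i j) i = tau (Suc n) i j"
  by simp

lemma lmul_tau_b: "j \<le> n \<Longrightarrow> lmul b d n (\<lambda>i. tau n i j) i = q ^ (n - j) \<cdot> tau (Suc n) i (Suc j)"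
proof (induction n arbitrary: i)
  case 0
  then show ?case by simp
next
  case (Suc m)
  show ?case
  proof (cases "j = Suc m")
    case True
    then show ?thesis by simp
  next
    case False
    then have j: "j \<le> m" using Suc.prems by simp
    have "lmul b d (Suc m) (\<lambda>i. tau (Suc m) i j) i = lmul b d (Suc m) (lmul a c m (\<lambda>i. tau m i j)) i"
      using j by simp
    also have "\<dots> = q \<cdot> lmul a c (Suc m) (lmul b d m (\<lambda>i. tau m i j)) i"
      by (rule lmul_commute) (rule tau_above)
    also have "lmul b d m (\<lambda>i. tau m i j) = (\<lambda>i. q ^ (m - j) \<cdot> tau (Suc m) i (Suc j))"
      using Suc.IH[OF j] by (intro ext)
    also have "q \<cdot> lmul a c (Suc m) \<dots> i = (q * q ^ (m - j)) \<cdot> tau (Suc (Suc m)) i (Suc j)"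
      using j by (simp add: lmul_sc del: tau.simps) simp
    also have "q * q ^ (m - j) = q ^ (Suc m - j)"
      using j by (simp add: Suc_diff_le)
    finally show ?thesis .
  qed
qed

definition conv :: "nat \<Rightarrow> (nat \<Rightarrow> 'r) \<Rightarrow> (nat \<Rightarrow> 'r) \<Rightarrow> nat \<Rightarrow> 'r" where
  "conv n2 p r s = (\<Sum>i\<le>s. q ^ (i * (n2 - (s - i))) \<cdot> (p i * r (s - i)))"

lemma conv_lmul:
  assumes p: "\<And>i. n1 < i \<Longrightarrow> p i = 0" and r: "\<And>i. n2 < i \<Longrightarrow> r i = 0"
  shows "conv n2 (lmul x y n1 p) r s = lmul x y (n1 + n2) (conv n2 p r) s"
proof (cases s)
  case 0
  then show ?thesis by (simp add: conv_def lmul_def mult.assoc)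
next
  case (Suc s')
  have step: "q ^ (Suc i * (n2 - (s' - i))) \<cdot> (q ^ (n1 - i) \<cdot> (y * p i) * r (s' - i)) =
      q ^ (n1 + n2 - s') \<cdot> (y * (q ^ (i * (n2 - (s' - i))) \<cdot> (p i * r (s' - i))))" if "i \<le> s'" for i
  proof (cases "i \<le> n1 \<and> s' - i \<le> n2")
    case True
    then have "n2 - (s' - i) + (n1 - i) = n1 + n2 - s'"
      using that by linarith
    then have "Suc i * (n2 - (s' - i)) + (n1 - i) = (n1 + n2 - s') + i * (n2 - (s' - i))"
      by simp
    then show ?thesis
      by (simp add: mult.assoc power_add[symmetric] del: mult_Suc)
  next
    case False
    then show ?thesis using p r by auto
  qed
  have "conv n2 (lmul x y n1 p) r s =
      (\<Sum>i\<le>s. x * (q ^ (i * (n2 - (s - i))) \<cdot> (p i * r (s - i)))) +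
      (\<Sum>i\<le>Suc s'. (case i of 0 \<Rightarrow> 0 | Suc k \<Rightarrow> q ^ (i * (n2 - (s - i))) \<cdot> (q ^ (n1 - k) \<cdot> (y * p k) * r (s - i))))"
    unfolding conv_def lmul_def Suc sum.distrib[symmetric]
    by (intro sum.cong) (auto simp: algebra_simps split: nat.split)
  also have "(\<Sum>i\<le>Suc s'. (case i of 0 \<Rightarrow> 0 | Suc k \<Rightarrow> q ^ (i * (n2 - (s - i))) \<cdot> (q ^ (n1 - k) \<cdot> (y * p k) * r (s - i)))) =
      (\<Sum>i\<le>s'. q ^ (n1 + n2 - s') \<cdot> (y * (q ^ (i * (n2 - (s' - i))) \<cdot> (p i * r (s' - i)))))"
    unfolding sum.atMost_Suc_shift Suc nat.case diff_Suc_Suc add_0 by (intro sum.cong refl step) simp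
  finally show ?thesis
    by (simp only: Suc lmul_def conv_def nat.case sum_distrib_left scale_sum_right)
qed

lemma conv_tau:
  assumes "j \<le> n1" "l \<le> n2"
  shows "conv n2 (\<lambda>i. tau n1 i j) (\<lambda>k. tau n2 k l) s = q ^ (j * (n2 - l)) \<cdot> tau (n1 + n2) s (j + l)"
  using assms(1)
proof (induction n1 arbitrary: j s)
  case 0
  have "(\<Sum>i\<le>s. q ^ (i * (n2 - (s - i))) \<cdot> (tau 0 i 0 * tau n2 (s - i) l)) =
      (\<Sum>i\<in>{0}. q ^ (i * (n2 - (s - i))) \<cdot> (tau 0 i 0 * tau n2 (s - i) l))"
    by (rule sum.mono_neutral_right) auto
  then show ?case using 0 by (simp add: conv_def)
next
  case (Suc n1)
  have tn: "\<And>n i j. n < i \<Longrightarrow> tau n i j = 0" by (rule tau_above)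
  show ?case
  proof (cases "j \<le> n1")
    case True
    have "conv n2 (\<lambda>i. tau (Suc n1) i j) (\<lambda>k. tau n2 k l) s =
        conv n2 (lmul a c n1 (\<lambda>i. tau n1 i j)) (\<lambda>k. tau n2 k l) s"
      using True by simp
    also have "\<dots> = lmul a c (n1 + n2) (conv n2 (\<lambda>i. tau n1 i j) (\<lambda>k. tau n2 k l)) s"
      by (rule conv_lmul) (auto intro: tau_above)
    also have "\<dots> = lmul a c (n1 + n2) (\<lambda>s. q ^ (j * (n2 - l)) \<cdot> tau (n1 + n2) s (j + l)) s"
      using Suc.IH[OF True] by (intro arg_cong2[of _ _ _ _ "lmul a c (n1 + n2)"] ext) simp_all
    also have "\<dots> = q ^ (j * (n2 - l)) \<cdot> tau (Suc (n1 + n2)) s (j + l)"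
      unfolding lmul_sc using True assms(2) by simp
    finally show ?thesis by simp
  next
    case False
    then have j: "j = Suc n1" using Suc.prems by simp
    have "conv n2 (\<lambda>i. tau (Suc n1) i j) (\<lambda>k. tau n2 k l) s =
        conv n2 (lmul b d n1 (\<lambda>i. tau n1 i n1)) (\<lambda>k. tau n2 k l) s"
      using j by simp
    also have "\<dots> = lmul b d (n1 + n2) (conv n2 (\<lambda>i. tau n1 i n1) (\<lambda>k. tau n2 k l)) s"
      by (rule conv_lmul) (auto intro: tau_above)
    also have "\<dots> = lmul b d (n1 + n2) (\<lambda>s. q ^ (n1 * (n2 - l)) \<cdot> tau (n1 + n2) s (n1 + l)) s"
      using Suc.IH[of n1] by (intro arg_cong2[of _ _ _ _ "lmul b d (n1 + n2)"] ext) simp_all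
    also have "\<dots> = q ^ (n1 * (n2 - l)) \<cdot> q ^ (n2 - l) \<cdot> tau (Suc (n1 + n2)) s (Suc (n1 + l))"
      unfolding lmul_sc using lmul_tau_b[of "n1 + l" "n1 + n2"] assms(2) by (simp del: tau.simps scale_scale)
    finally show ?thesis by (simp add: j power_add mult.commute del: tau.simps)
  qed
qed

lemma tau_one: "tau 1 i j = (if j = 0 then if i = 0 then a else if i = 1 then c else 0
    else if j = 1 then if i = 0 then b else if i = 1 then d else 0 else 0)"
  by (auto simp: lmul_def split: nat.splits)

lemma rmul_tau:
  assumes "j \<le> n" "l \<le> 1"
  shows "q ^ i \<cdot> (tau n i j * tau 1 0 l) + (case i of 0 \<Rightarrow> 0 | Suc k \<Rightarrow> tau n k j * tau 1 1 l) =
    q ^ (j * (1 - l)) \<cdot> tau (Suc n) i (j + l)"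
proof -
  have "conv 1 (\<lambda>i. tau n i j) (\<lambda>k. tau 1 k l) i =
    q ^ i \<cdot> (tau n i j * tau 1 0 l) + (case i of 0 \<Rightarrow> 0 | Suc k \<Rightarrow> tau n k j * tau 1 1 l)"
  proof (cases i)
    case (Suc k)
    have "(\<Sum>m\<le>k. q ^ (m * (1 - (i - m))) \<cdot> (tau n m j * tau 1 (i - m) l)) =
      (\<Sum>m\<in>{k}. q ^ (m * (1 - (i - m))) \<cdot> (tau n m j * tau 1 (i - m) l))"
      proof (rule sum.mono_neutral_right)
        show "\<forall>m\<in>{..k} - {k}. q ^ (m * (1 - (i - m))) \<cdot> (tau n m j * tau 1 (i - m) l) = 0"
        proof
          fix m assume "m \<in> {..k} - {k}"
          then have "tau 1 (i - m) l = 0" by (intro tau_above) (auto simp: Suc)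
          then show "q ^ (m * (1 - (i - m))) \<cdot> (tau n m j * tau 1 (i - m) l) = 0"
            by (simp del: tau.simps)
        qed
      qed auto
    then show ?thesis by (simp add: conv_def Suc del: tau.simps)
  qed (simp add: conv_def)
  then show ?thesis using conv_tau[OF assms, of i] by (simp del: tau.simps)
qed

lemma D_lmul:
  assumes "\<And>i. D * p i = (z * theta ^ i) \<cdot> (p i * D)"
    and "D * x = w \<cdot> (x * D)" and "D * y = (w * theta) \<cdot> (y * D)"
  shows "D * lmul x y n p i = (w * z * theta ^ i) \<cdot> (lmul x y n p i * D)"
proof -
  have *: "D * (u * p i) = (v * z * theta ^ i) \<cdot> (u * p i * D)" if "D * u = v \<cdot> (u * D)" for u v i
  proof -
    have "D * (u * p i) = v \<cdot> (u * (D * p i))" using that by (simp add: mult.assoc[symmetric])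
    also have "\<dots> = (v * z * theta ^ i) \<cdot> (u * p i * D)" unfolding assms(1) by (simp add: mult.assoc)
    finally show ?thesis .
  qed
  show ?thesis
    unfolding lmul_def distrib_left *[OF assms(2)]
    by (auto simp: distrib_right scale_right_distrib *[OF assms(3)] ac_simps split: nat.split)
qed

lemma D_tau: "D * tau n i j = (theta ^ i / theta ^ j) \<cdot> (tau n i j * D)"
proof (induction n arbitrary: i j)
  case 0
  then show ?case by auto
next
  case (Suc n)
  have IH: "\<And>i. D * tau n i j = (inverse (theta ^ j) * theta ^ i) \<cdot> (tau n i j * D)" for j
    using Suc by (simp add: field_simps)
  have 1: "D * lmul a c n (\<lambda>i. tau n i j) i =
      (1 * inverse (theta ^ j) * theta ^ i) \<cdot> (lmul a c n (\<lambda>i. tau n i j) i * D)"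
    by (rule D_lmul[OF IH]) (simp_all add: aD D_c)
  have 2: "D * lmul b d n (\<lambda>i. tau n i n) i =
      (inverse theta * inverse (theta ^ n) * theta ^ i) \<cdot> (lmul b d n (\<lambda>i. tau n i n) i * D)"
    by (rule D_lmul[OF IH]) (simp_all add: D_b D_d)
  show ?case using 1 2 by (auto simp: field_simps)
qed

end

section \<open>Gaussian binomial coefficients\<close>

lemma q_poch_Suc: "q_poch s s (Suc n) = q_poch s s n * (1 - s ^ Suc n)"
  by (simp add: q_poch_def)

lemma q_poch_pos:
  assumes "0 < s" "s < 1"
  shows "0 < q_poch s s n"
proof (induction n)
  case (Suc n)
  have "s ^ Suc n < 1" using assms by (intro power_Suc_less_one) auto
  then show ?case using Suc unfolding q_poch_Suc by (intro mult_pos_pos) auto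
qed (simp add: q_poch_def)

lemma q_binom_pos: "0 < s \<Longrightarrow> s < 1 \<Longrightarrow> 0 < q_binom s n k"
  by (simp add: q_binom_def q_poch_pos)

lemma q_binom_0: "0 < s \<Longrightarrow> s < 1 \<Longrightarrow> q_binom s n 0 = 1"
  using q_poch_pos[of s n] by (simp add: q_binom_def q_poch_def[of s s 0])

lemma q_binom_self: "0 < s \<Longrightarrow> s < 1 \<Longrightarrow> q_binom s n n = 1"
  using q_poch_pos[of s n] by (simp add: q_binom_def q_poch_def[of s s 0])

lemma q_binom_pascal:
  assumes s: "0 < s" "s < 1" and k: "k < n"
  shows "q_binom s (Suc n) (Suc k) = s ^ Suc k * q_binom s n (Suc k) + q_binom s n k"
proof -
  define e where "e = n - Suc k"
  have n: "n = Suc (k + e)" using k by (simp add: e_def)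
  have nz: "q_poch s s m \<noteq> 0" "1 - s ^ Suc m \<noteq> 0" for m
    using q_poch_pos[OF s, of m] power_Suc_less_one[of s m] s by auto
  have "s ^ Suc k * q_binom s n (Suc k) + q_binom s n k =
      q_poch s s n * (s ^ Suc k * (1 - s ^ Suc e) + (1 - s ^ Suc k)) /
        (q_poch s s (Suc k) * q_poch s s (Suc e))"
  proof -
    have "z * (P / (A * x * B)) + P / (A * (B * y)) = P * (z * y + x) / (A * x * (B * y))"
      if "A \<noteq> 0" "B \<noteq> 0" "x \<noteq> 0" "y \<noteq> 0" for z P A B x y :: real
      using that by (simp add: field_simps)
    from this[OF nz(1)[of k] nz(1)[of e] nz(2)[of k] nz(2)[of e]]
    show ?thesis by (simp add: q_binom_def n q_poch_Suc[of s k] q_poch_Suc[of s e] del: power_Suc)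
  qed
  also have "s ^ Suc k * (1 - s ^ Suc e) + (1 - s ^ Suc k) = 1 - s ^ Suc n"
    by (simp add: n power_add algebra_simps)
  also have "q_poch s s n * (1 - s ^ Suc n) / (q_poch s s (Suc k) * q_poch s s (Suc e)) = q_binom s (Suc n) (Suc k)"
    by (simp add: q_binom_def n q_poch_Suc)
  finally show ?thesis ..
qed

lemma sum_two_deltas:
  fixes A B :: "nat \<Rightarrow> nat \<Rightarrow> 'a::ab_group_add"
  shows "(\<Sum>(j, l)\<in>{..p} \<times> {..r}. (if i = j \<and> k = Suc l then A j l else 0) - (if i = Suc j \<and> k = l then B j l else 0)) =
    (case k of 0 \<Rightarrow> 0 | Suc l \<Rightarrow> if i \<le> p \<and> l \<le> r then A i l else 0) -
    (case i of 0 \<Rightarrow> 0 | Suc j \<Rightarrow> if j \<le> p \<and> k \<le> r then B j k else 0)"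
proof -
  have 1: "(\<Sum>j\<le>p. \<Sum>l\<le>r. if i = j \<and> k = Suc l then A j l else 0) =
    (case k of 0 \<Rightarrow> 0 | Suc l \<Rightarrow> if i \<le> p \<and> l \<le> r then A i l else 0)"
  proof (cases k)
    case (Suc l)
    have "(\<Sum>j\<le>p. \<Sum>l\<le>r. if i = j \<and> k = Suc l then A j l else 0) =
      (\<Sum>j\<le>p. if i = j then \<Sum>l'\<le>r. if l = l' then A j l' else 0 else 0)"
      by (intro sum.cong) (auto simp: Suc)
    then show ?thesis by (simp add: Suc)
  qed simp
  have 2: "(\<Sum>j\<le>p. \<Sum>l\<le>r. if i = Suc j \<and> k = l then B j l else 0) =
    (case i of 0 \<Rightarrow> 0 | Suc j \<Rightarrow> if j \<le> p \<and> k \<le> r then B j k else 0)"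
  proof (cases i)
    case (Suc j)
    have "(\<Sum>j\<le>p. \<Sum>l\<le>r. if i = Suc j \<and> k = l then B j l else 0) =
      (\<Sum>j'\<le>p. if j = j' then \<Sum>l\<le>r. if k = l then B j' l else 0 else 0)"
      by (intro sum.cong) (auto simp: Suc)
    then show ?thesis by (simp add: Suc)
  qed simp
  show ?thesis
    by (simp add: sum.cartesian_product[symmetric] sum_subtractf 1 2)
qed

lemma sum_antidiagonal:
  fixes F :: "nat \<Rightarrow> nat \<Rightarrow> 'a::comm_monoid_add"
  assumes "\<And>i k. n1 < i \<or> n2 < k \<Longrightarrow> F i k = 0"
  shows "(\<Sum>(i, k)\<in>{..n1} \<times> {..n2}. if i + k = s then F i k else 0) = (\<Sum>i\<le>s. F i (s - i))"
proof -
  have "(\<Sum>(i, k)\<in>{..n1} \<times> {..n2}. if i + k = s then F i k else 0) =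
      (\<Sum>(i, k)\<in>({..n1} \<times> {..n2}) \<inter> {(i, k). i + k = s}. F i k)"
    by (intro sum.mono_neutral_cong_right) (auto split: if_splits)
  also have "\<dots> = (\<Sum>(i, k)\<in>(\<lambda>i. (i, s - i)) ` {..s}. F i k)"
  proof (intro sum.mono_neutral_left)
    have "i \<le> n1" "k \<le> n2" if "F i k \<noteq> 0" for i k
      using assms that by (meson not_le)+
    then show "\<forall>x\<in>(\<lambda>i. (i, s - i)) ` {..s} - ({..n1} \<times> {..n2}) \<inter> {(i, k). i + k = s}. (case x of (i, k) \<Rightarrow> F i k) = 0"
      by fastforce
  qed (auto simp: image_iff)
  also have "\<dots> = (\<Sum>i\<le>s. F i (s - i))"
    by (subst sum.reindex) (auto simp: inj_on_def)
  finally show ?thesis .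
qed

section \<open>Equivalence of coefficient matrices\<close>

lemma mprod_inverses:
  assumes "finite B" "meq B B (mprod C y y') mid" "meq A A (mprod B x x') mid"
  shows "meq A A (mprod C (mprod B x y) (mprod B y' x')) mid"
proof -
  have "mprod C (mprod B x y) (mprod B y' x') = mprod B x (mprod B (mprod C y y') x')"
    by (simp add: mprod_assoc)
  also have "meq A A \<dots> (mprod B x (mprod B mid x'))"
    using assms by (intro mprod_cong_right mprod_cong_left)
  also have "meq A A \<dots> (mprod B x x')"
    using assms by (intro mprod_cong_right mprod_mid_left)
  finally show ?thesis using assms(3) meq_trans by blast
qed

definition dsum :: "('i \<Rightarrow> 'j \<Rightarrow> 'b::zero) \<Rightarrow> ('k \<Rightarrow> 'l \<Rightarrow> 'b) \<Rightarrow> 'i + 'k \<Rightarrow> 'j + 'l \<Rightarrow> 'b" where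
  "dsum u v x y = (case x of
     Inl i \<Rightarrow> (case y of Inl j \<Rightarrow> u i j | Inr j \<Rightarrow> 0)
   | Inr i \<Rightarrow> (case y of Inl j \<Rightarrow> 0 | Inr j \<Rightarrow> v i j))"

lemma dsum_simps [simp]:
  "dsum u v (Inl i) (Inl j) = u i j" "dsum u v (Inr k) (Inr l) = v k l"
  "dsum u v (Inl i) (Inr l) = 0" "dsum u v (Inr k) (Inl j) = 0"
  by (simp_all add: dsum_def)

lemma meq_dsum_mid:
  "meq (I <+> A) (I <+> A) (dsum mid mid) mid"
  by (auto simp: meq_def mid_def split: if_splits)

lemma mprod_dsum:
  assumes "finite I" "finite B"
  shows "mprod (I <+> B) (dsum u x) (dsum v y) = dsum (mprod I u v) (mprod B x y)"
  using assms by (auto simp: fun_eq_iff dsum_def mprod_def sum.Plus o_def split: sum.split)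

lemma meq_dsum:
  "meq I J u u' \<Longrightarrow> meq A B v v' \<Longrightarrow> meq (I <+> A) (J <+> B) (dsum u v) (dsum u' v')"
  by (auto simp: meq_def)

context complex_star_algebra
begin

lemma cadj_mprod: "cadj (mprod J M N) = mprod J (cadj N) (cadj M)"
  by (simp add: cadj_def mprod_def fun_eq_iff mult.commute)

lemma cadj_mid: "cadj mid = mid"
  by (auto simp: cadj_def mid_def fun_eq_iff)

lemma meq_cadj: "meq I J M N \<Longrightarrow> meq J I (cadj M) (cadj N)"
  by (simp add: meq_def cadj_def)

lemma unitaryD:
  assumes "unitary I u" "i \<in> I" "j \<in> I"
  shows "(\<Sum>k\<in>I. u i k * st (u j k)) = mid i j" and "(\<Sum>k\<in>I. st (u k i) * u k j) = mid i j"
  using assms by (simp_all add: unitary_def meq_def mprod_def adj_def)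

lemma unitary_mult_unitary_element:
  assumes "unitary I u" and "x * st x = 1" "st x * x = 1"
  shows "unitary I (\<lambda>i j. u i j * x)"
proof -
  have "x * (st x * y) = y" for y by (simp add: mult.assoc[symmetric] assms(2))
  then have 1: "u i j * x * st (u i' j * x) = u i j * st (u i' j)" for i i' j
    by (simp add: mult.assoc)
  have 2: "(\<Sum>i\<in>I. st (u i j * x) * (u i j' * x)) = st x * (\<Sum>i\<in>I. st (u i j) * u i j') * x" for j j'
    by (simp add: sum_distrib_left sum_distrib_right mult.assoc)
  show ?thesis
    unfolding unitary_def meq_def mprod_def adj_def 1 2
    by (auto simp: unitaryD[OF assms(1)]) (simp add: mid_def assms(3))
qed

lemma unitary_tensor:
  assumes u: "unitary I u" and v: "unitary J v"
  shows "unitary (I \<times> J) (\<lambda>(i, k) (j, l). u i j * v k l)"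
  unfolding unitary_def
proof (intro conjI meqI; clarify)
  let ?w = "\<lambda>(i, k) (j, l). u i j * v k l"
  fix i k i' k' assume mem: "i \<in> I" "k \<in> J" "i' \<in> I" "k' \<in> J"
  have "mprod (I \<times> J) ?w (adj ?w) (i, k) (i', k') =
      (\<Sum>j\<in>I. \<Sum>l\<in>J. u i j * (v k l * st (v k' l)) * st (u i' j))"
    by (simp add: mprod_def adj_def sum.cartesian_product case_prod_beta mult.assoc)
  also have "\<dots> = (\<Sum>j\<in>I. u i j * (\<Sum>l\<in>J. v k l * st (v k' l)) * st (u i' j))"
    by (simp add: sum_distrib_left sum_distrib_right)
  also have "\<dots> = mid k k' * (\<Sum>j\<in>I. u i j * st (u i' j))"
    using mem by (simp add: unitaryD(1)[OF v]) (simp add: mid_def)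
  also have "\<dots> = mid (i, k) (i', k')"
    using mem by (simp add: unitaryD(1)[OF u]) (simp add: mid_def)
  finally show "mprod (I \<times> J) ?w (adj ?w) (i, k) (i', k') = mid (i, k) (i', k')" .
  have "mprod (I \<times> J) (adj ?w) ?w (i, k) (i', k') =
      (\<Sum>l\<in>J. \<Sum>j\<in>I. st (v l k) * (st (u j i) * u j i') * v l k')"
    by (subst sum.swap) (simp add: mprod_def adj_def sum.cartesian_product case_prod_beta mult.assoc)
  also have "\<dots> = (\<Sum>l\<in>J. st (v l k) * (\<Sum>j\<in>I. st (u j i) * u j i') * v l k')"
    by (simp add: sum_distrib_left sum_distrib_right)
  also have "\<dots> = mid i i' * (\<Sum>l\<in>J. st (v l k) * v l k')"
    using mem by (simp add: unitaryD(2)[OF u]) (simp add: mid_def)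
  also have "\<dots> = mid (i, k) (i', k')"
    using mem by (simp add: unitaryD(2)[OF v]) (simp add: mid_def)
  finally show "mprod (I \<times> J) (adj ?w) ?w (i, k) (i', k') = mid (i, k) (i', k')" .
qed

definition ceq :: "'i set \<Rightarrow> ('i \<Rightarrow> 'i \<Rightarrow> 'r) \<Rightarrow> 'j set \<Rightarrow> ('j \<Rightarrow> 'j \<Rightarrow> 'r) \<Rightarrow> bool" where
  "ceq I u J v \<longleftrightarrow> finite I \<and> finite J \<and>
     (\<exists>M N. meq I I (mprod J N M) mid \<and> meq J J (mprod I M N) mid \<and> intertwines I J M u v)"

lemma ceqI:
  assumes "finite I" "finite J" "meq I I (mprod J N M) mid" "meq J J (mprod I M N) mid" "intertwines I J M u v"
  shows "ceq I u J v"
  unfolding ceq_def using assms by (intro conjI exI[of _ M] exI[of _ N])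

lemma ceq_sym:
  assumes "ceq I u J v"
  shows "ceq J v I u"
proof -
  from assms obtain M N where fin: "finite I" "finite J"
    and NM: "meq I I (mprod J N M) mid" and MN: "meq J J (mprod I M N) mid"
    and M: "meq J I (mprod I (em M) u) (mprod J v (em M))"
    by (auto simp: ceq_def intertwines_def)
  have "meq I J (mprod J (em N) v) (mprod J (mprod J (em N) v) mid)"
    by (rule meq_sym[OF mprod_mid_right[OF fin(2)]])
  also have "meq I J \<dots> (mprod J (mprod J (em N) v) (mprod I (em M) (em N)))"
    by (intro mprod_cong_right meq_sym[OF meq_em[OF MN, unfolded em_mprod em_mid]])
  also have "\<dots> = mprod I (mprod J (em N) (mprod J v (em M))) (em N)"
    by (simp add: mprod_assoc)
  also have "meq I J \<dots> (mprod I (mprod J (em N) (mprod I (em M) u)) (em N))"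
    by (intro mprod_cong_left mprod_cong_right meq_sym[OF M])
  also have "\<dots> = mprod I (mprod J (em N) (em M)) (mprod I u (em N))"
    by (simp add: mprod_assoc)
  also have "meq I J \<dots> (mprod I mid (mprod I u (em N)))"
    using meq_em[OF NM] unfolding em_mprod em_mid by (intro mprod_cong_left)
  also have "meq I J \<dots> (mprod I u (em N))"
    using fin by (intro mprod_mid_left)
  finally show ?thesis using fin NM MN by (intro ceqI[of J I M N]) (simp_all add: intertwines_def)
qed

lemma ceq_trans:
  assumes "ceq I u J v" and "ceq J v K w"
  shows "ceq I u K w"
proof -
  from assms obtain M N M' N' where fin: "finite I" "finite J" "finite K"
    and NM: "meq I I (mprod J N M) mid" and MN: "meq J J (mprod I M N) mid"
    and M: "meq J I (mprod I (em M) u) (mprod J v (em M))"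
    and NM': "meq J J (mprod K N' M') mid" and MN': "meq K K (mprod J M' N') mid"
    and M': "meq K J (mprod J (em M') v) (mprod K w (em M'))"
    by (auto simp: ceq_def intertwines_def)
  have "mprod I (em (mprod J M' M)) u = mprod J (em M') (mprod I (em M) u)"
    by (simp add: em_mprod mprod_assoc)
  also have "meq K I \<dots> (mprod J (em M') (mprod J v (em M)))"
    by (intro mprod_cong_right M)
  also have "\<dots> = mprod J (mprod J (em M') v) (em M)"
    by (simp add: mprod_assoc)
  also have "meq K I \<dots> (mprod J (mprod K w (em M')) (em M))"
    by (intro mprod_cong_left M')
  also have "\<dots> = mprod K w (em (mprod J M' M))"
    by (simp add: em_mprod mprod_assoc)
  finally have "intertwines I K (mprod J M' M) u w"
    by (simp add: intertwines_def)
  then show ?thesis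
    using fin mprod_inverses[OF fin(2) NM' NM] mprod_inverses[OF fin(2) MN MN'] by (intro ceqI)
qed

lemma ceq_mult_right:
  assumes "ceq I u J v"
  shows "ceq I (\<lambda>i j. u i j * x) J (\<lambda>i j. v i j * x)"
proof -
  have "intertwines I J M (\<lambda>i j. u i j * x) (\<lambda>i j. v i j * x)" if "intertwines I J M u v" for M
  proof -
    have "mprod I (em M) (\<lambda>i j. u i j * x) = (\<lambda>i j. mprod I (em M) u i j * x)"
      by (simp add: fun_eq_iff mprod_def em_def sum_distrib_right)
    moreover have "mprod J (\<lambda>i j. v i j * x) (em M) = (\<lambda>i j. mprod J v (em M) i j * x)"
      by (simp add: fun_eq_iff mprod_def em_def sum_distrib_right)
    ultimately show ?thesis using that by (simp add: intertwines_def meq_def)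
  qed
  then show ?thesis using assms by (auto simp: ceq_def)
qed

lemma ceq_diag:
  assumes "finite I" and nz: "\<And>i. i \<in> I \<Longrightarrow> z i \<noteq> 0"
    and v: "\<And>i j. i \<in> I \<Longrightarrow> j \<in> I \<Longrightarrow> v i j = (z i / z j) \<cdot> u i j"
  shows "ceq I u I v"
proof -
  let ?M = "\<lambda>i j. if i = j then z j else 0" and ?N = "\<lambda>i j. if i = j then inverse (z j) else 0"
  have sum_if: "(\<Sum>j\<in>I. f j * (if j = k then y j else 0)) = f k * y k"
      "(\<Sum>j\<in>I. (if k = j then y j else 0) * f j) = y k * f k" if "k \<in> I" for f y :: "_ \<Rightarrow> complex" and k
    using that assms(1) by (simp_all add: if_zero_mult mult_if_zero)
  have "intertwines I I ?M u v"
    unfolding intertwines_def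
  proof (rule meqI)
    fix i j assume ij: "i \<in> I" "j \<in> I"
    have "mprod I (em ?M) u i j = (\<Sum>k\<in>I. if i = k then z k \<cdot> u k j else 0)"
      by (auto simp: mprod_def em_def intro!: sum.cong)
    moreover have "mprod I v (em ?M) i j = (\<Sum>k\<in>I. if k = j then z j \<cdot> v i k else 0)"
      by (auto simp: mprod_def em_def intro!: sum.cong)
    ultimately show "mprod I (em ?M) u i j = mprod I v (em ?M) i j"
      using assms(1) ij v[OF ij] nz[OF ij(2)] by simp
  qed
  moreover have "meq I I (mprod I ?N ?M) mid" "meq I I (mprod I ?M ?N) mid"
    using nz unfolding meq_def mprod_def by (auto simp: sum_if mid_def)
  ultimately show ?thesis using assms(1) by (intro ceqI)
qed

lemma ceq_reindex:
  assumes f: "bij_betw f I J" and fin: "finite I"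
    and v: "\<And>i j. i \<in> I \<Longrightarrow> j \<in> I \<Longrightarrow> u i j = v (f i) (f j)"
  shows "ceq I u J v"
proof -
  let ?M = "\<lambda>k i. if k = f i then 1 else 0" and ?N = "\<lambda>i k. if k = f i then 1 else 0"
  have J: "J = f ` I" and inj: "inj_on f I" using f by (auto simp: bij_betw_def)
  have finJ: "finite J" using fin J by simp
  have f_eq: "f i = f j \<longleftrightarrow> i = j" if "i \<in> I" "j \<in> I" for i j
    using inj that by (rule inj_on_eq_iff)
  have "intertwines I J ?M u v"
    unfolding intertwines_def J
  proof (rule meqI, clarify)
    fix i j assume ij: "i \<in> I" "j \<in> I"
    have "mprod I (em ?M) u (f i) j = (\<Sum>k\<in>I. if i = k then u k j else 0)"
      unfolding mprod_def em_def using ij by (intro sum.cong refl) (simp add: f_eq)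
    moreover have "mprod (f ` I) v (em ?M) (f i) j = (\<Sum>k\<in>I. if k = j then v (f i) (f k) else 0)"
      unfolding mprod_def em_def sum.reindex[OF inj] o_def using ij by (intro sum.cong refl) (simp add: f_eq)
    ultimately show "mprod I (em ?M) u (f i) j = mprod (f ` I) v (em ?M) (f i) j"
      using fin ij v[OF ij] by simp
  qed
  moreover have "meq I I (mprod J ?N ?M) mid"
  proof (rule meqI)
    fix i j assume ij: "i \<in> I" "j \<in> I"
    then have "f i \<in> J" by (simp add: J)
    then show "mprod J ?N ?M i j = mid i j"
      using finJ ij by (simp add: mprod_def if_zero_mult mid_def f_eq)
  qed
  moreover have "meq J J (mprod I ?M ?N) mid"
    unfolding J
  proof (rule meqI, clarify)
    fix i j assume ij: "i \<in> I" "j \<in> I"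
    have "mprod I ?M ?N (f i) (f j) = (\<Sum>k\<in>I. if i = k then if j = k then 1 else 0 else 0)"
      unfolding mprod_def using ij by (intro sum.cong refl) (simp add: f_eq)
    then show "mprod I ?M ?N (f i) (f j) = mid (f i) (f j)"
      using fin ij by (auto simp: mid_def f_eq)
  qed
  ultimately show ?thesis using fin finJ by (intro ceqI)
qed

lemma em_dsum: "em (dsum M N) = dsum (em M) (em N)"
  by (auto simp: fun_eq_iff em_def dsum_def split: sum.split)

lemma ceq_dsum:
  assumes "finite I" and "ceq J v J' v'"
  shows "ceq (I <+> J) (dsum u v) (I <+> J') (dsum u v')"
proof -
  from assms obtain M N where fin: "finite J" "finite J'"
    and NM: "meq J J (mprod J' N M) mid" and MN: "meq J' J' (mprod J M N) mid"
    and M: "meq J' J (mprod J (em M) v) (mprod J' v' (em M))"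
    by (auto simp: ceq_def intertwines_def)
  have inv: "meq (I <+> A) (I <+> A) (mprod (I <+> B) (dsum mid x) (dsum mid y)) mid"
    if "finite B" "meq A A (mprod B x y) mid" for A B and x y :: "_ \<Rightarrow> _ \<Rightarrow> complex"
  proof -
    have "mprod (I <+> B) (dsum mid x) (dsum mid y) = dsum (mprod I mid mid) (mprod B x y)"
      using assms(1) that(1) by (rule mprod_dsum)
    also have "meq (I <+> A) (I <+> A) \<dots> (dsum mid mid)"
      using assms(1) that(2) by (intro meq_dsum mprod_mid_left)
    finally show ?thesis using meq_dsum_mid meq_trans by blast
  qed
  have "mprod (I <+> J) (em (dsum mid M)) (dsum u v) = dsum (mprod I mid u) (mprod J (em M) v)"
    using assms(1) fin by (simp add: em_dsum em_mid mprod_dsum)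
  also have "meq (I <+> J') (I <+> J) \<dots> (dsum (mprod I u mid) (mprod J' v' (em M)))"
    using assms(1) by (intro meq_dsum M meq_trans[OF mprod_mid_left meq_sym[OF mprod_mid_right]])
  also have "\<dots> = mprod (I <+> J') (dsum u v') (em (dsum mid M))"
    using assms(1) fin by (simp add: em_dsum em_mid mprod_dsum)
  finally have "intertwines (I <+> J) (I <+> J') (dsum mid M) (dsum u v) (dsum u v')"
    by (simp add: intertwines_def)
  then show ?thesis
    using assms(1) fin inv[OF fin(2) NM] inv[OF fin(1) MN]
    by (intro ceqI) simp_all
qed

end

section \<open>Clebsch--Gordan maps\<close>

context uq2_relations
begin

lemma unit_interval: "0 < (cmod q)\<^sup>2" "(cmod q)\<^sup>2 < 1"
  using q0 q1 by (simp_all add: power_less_one_iff)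

definition root_binom :: "nat \<Rightarrow> nat \<Rightarrow> complex" where
  "root_binom n k = of_real (sqrt (q_binom ((cmod q)\<^sup>2) n k))"

lemma root_binom_nz [simp]: "root_binom n k \<noteq> 0"
  using q_binom_pos[OF unit_interval, of n k] by (simp add: root_binom_def)

lemma root_binom_0 [simp]: "root_binom n 0 = 1"
  by (simp add: root_binom_def q_binom_0[OF unit_interval])

lemma root_binom_self [simp]: "root_binom n n = 1"
  by (simp add: root_binom_def q_binom_self[OF unit_interval])

lemma root_binom_1: "k \<le> 1 \<Longrightarrow> root_binom (Suc 0) k = 1"
  by (cases "k = 0") (use root_binom_self[of 1] in \<open>simp_all del: root_binom_self add: le_Suc_eq\<close>)

lemma cnj_root_binom [simp]: "cnj (root_binom n k) = root_binom n k"
  by (simp add: root_binom_def)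

lemma root_binom_square: "root_binom n k * root_binom n k = of_real (q_binom ((cmod q)\<^sup>2) n k)"
proof -
  have "sqrt (q_binom ((cmod q)\<^sup>2) n k) * sqrt (q_binom ((cmod q)\<^sup>2) n k) = q_binom ((cmod q)\<^sup>2) n k"
    using q_binom_pos[OF unit_interval, of n k] by simp
  then show ?thesis unfolding root_binom_def of_real_mult[symmetric] by simp
qed

definition t :: "nat \<Rightarrow> nat \<Rightarrow> nat \<Rightarrow> 'r" where
  "t n i j = (root_binom n j / root_binom n i) \<cdot> tau n i j"

definition TT :: "nat \<Rightarrow> nat \<Rightarrow> nat \<times> nat \<Rightarrow> nat \<times> nat \<Rightarrow> 'r" where
  "TT m n = (\<lambda>(i, k) (j, l). t m i j * t n k l)"

definition TDT :: "nat \<Rightarrow> nat \<Rightarrow> nat \<times> nat \<Rightarrow> nat \<times> nat \<Rightarrow> 'r" where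
  "TDT p r = (\<lambda>(i, k) (j, l). t p i j * D * t r k l)"

abbreviation II :: "nat \<Rightarrow> nat \<Rightarrow> (nat \<times> nat) set" where
  "II m n \<equiv> {..m} \<times> {..n}"

text \<open>Multiplication \<open>V\<^sub>m \<otimes> V\<^sub>n \<rightarrow> V\<^bsub>m + n\<^esub>\<close>, and the insertion \<open>x \<otimes> y \<mapsto> x a \<otimes> b y - q\<^bsup>-1\<^esup> x b \<otimes> a y\<close> of the
  quantum determinant, which is annihilated by it; both in the normalised bases.\<close>

definition mu :: "nat \<Rightarrow> nat \<Rightarrow> nat \<Rightarrow> nat \<times> nat \<Rightarrow> complex" where
  "mu m n s = (\<lambda>(i, k). if i + k = s then root_binom m i * root_binom n k / root_binom (m + n) s * q ^ (i * (n - k)) else 0)"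

definition psi :: "nat \<Rightarrow> nat \<Rightarrow> nat \<times> nat \<Rightarrow> nat \<times> nat \<Rightarrow> complex" where
  "psi p r = (\<lambda>(i, k) (j, l).
     (if i = j \<and> k = Suc l then root_binom p j * root_binom r l / (root_binom (Suc p) i * root_binom (Suc r) k) * q ^ (j + (r - l)) else 0) -
     (if i = Suc j \<and> k = l then root_binom p j * root_binom r l / (root_binom (Suc p) i * root_binom (Suc r) k) * inverse q else 0))"

lemma mu_intertwines: "intertwines (II m n) {..m + n} (mu m n) (TT m n) (t (m + n))"
  unfolding intertwines_def
proof (rule meqI, clarify)
  fix s j l assume jl: "j \<le> m" "l \<le> n" and s: "s \<le> m + n"
  define C where "C = root_binom m j * root_binom n l / root_binom (m + n) s"
  have "mprod (II m n) (em (mu m n)) (TT m n) s (j, l) =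
      (\<Sum>(i, k)\<in>II m n. if i + k = s then C \<cdot> (q ^ (i * (n - k)) \<cdot> (tau m i j * tau n k l)) else 0)"
    unfolding mprod_def
    by (intro sum.cong) (auto simp: em_def mu_def TT_def t_def C_def field_simps)
  also have "\<dots> = (\<Sum>i\<le>s. C \<cdot> (q ^ (i * (n - (s - i))) \<cdot> (tau m i j * tau n (s - i) l)))"
    by (rule sum_antidiagonal) (auto simp: tau_above)
  also have "\<dots> = C \<cdot> conv n (\<lambda>i. tau m i j) (\<lambda>k. tau n k l) s"
    by (simp add: conv_def scale_sum_right)
  also have "\<dots> = (C * q ^ (j * (n - l))) \<cdot> tau (m + n) s (j + l)"
    using conv_tau[of j m l n] jl by simp
  also have "\<dots> = (\<Sum>s'\<le>m + n. if j + l = s' then t (m + n) s s' * (mu m n s' (j, l) \<cdot> 1) else 0)"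
    using jl by (simp add: t_def mu_def C_def)
  also have "\<dots> = mprod {..m + n} (t (m + n)) (em (mu m n)) s (j, l)"
    unfolding mprod_def by (intro sum.cong) (auto simp: em_def mu_def)
  finally show "mprod (II m n) (em (mu m n)) (TT m n) s (j, l) =
    mprod {..m + n} (t (m + n)) (em (mu m n)) s (j, l)" .
qed

lemma tau_1_entries: "tau 1 0 0 = a" "tau 1 0 1 = b" "tau 1 1 0 = c" "tau 1 1 1 = d"
  unfolding tau_one by simp_all

lemma psi_tau:
  assumes "j \<le> p" "l \<le> r"
  shows "q ^ (j + (r - l)) \<cdot> (tau (Suc p) i j * tau (Suc r) k (Suc l)) -
      inverse q \<cdot> (tau (Suc p) i (Suc j) * tau (Suc r) k l) =
    (case k of 0 \<Rightarrow> 0 | Suc k' \<Rightarrow> q ^ (i + (r - k')) \<cdot> (tau p i j * D * tau r k' l)) -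
    (case i of 0 \<Rightarrow> 0 | Suc i' \<Rightarrow> inverse q \<cdot> (tau p i' j * D * tau r k l))"
proof -
  define X where "X = tau p i j"
  define X' where "X' = (case i of 0 \<Rightarrow> 0 | Suc i' \<Rightarrow> tau p i' j)"
  define Y where "Y = tau r k l"
  define Y' where "Y' = (case k of 0 \<Rightarrow> 0 | Suc k' \<Rightarrow> q ^ (r - k') \<cdot> tau r k' l)"
  have 1: "q ^ j \<cdot> tau (Suc p) i j = q ^ i \<cdot> (X * a) + X' * c"
    using rmul_tau[OF assms(1), of 0 i] unfolding X_def X'_def tau_1_entries by (cases i) (simp_all del: tau.simps)
  have 2: "tau (Suc p) i (Suc j) = q ^ i \<cdot> (X * b) + X' * d"
    using rmul_tau[OF assms(1), of 1 i] unfolding X_def X'_def tau_1_entries by (cases i) (simp_all del: tau.simps)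
  have 3: "tau (Suc r) k l = a * Y + c * Y'"
    using lmul_tau_a[OF assms(2), of k, symmetric] unfolding Y_def Y'_def lmul_def by (cases k) (simp_all del: tau.simps)
  have 4: "q ^ (r - l) \<cdot> tau (Suc r) k (Suc l) = b * Y + d * Y'"
    using lmul_tau_b[OF assms(2), of k, symmetric] unfolding Y_def Y'_def lmul_def by (cases k) (simp_all del: tau.simps)
  have "q ^ (j + (r - l)) \<cdot> (tau (Suc p) i j * tau (Suc r) k (Suc l)) =
      (q ^ j \<cdot> tau (Suc p) i j) * (q ^ (r - l) \<cdot> tau (Suc r) k (Suc l))"
    by (simp add: power_add del: tau.simps)
  then have "q ^ (j + (r - l)) \<cdot> (tau (Suc p) i j * tau (Suc r) k (Suc l)) -
      inverse q \<cdot> (tau (Suc p) i (Suc j) * tau (Suc r) k l) =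
      (q ^ i \<cdot> (X * a) + X' * c) * (b * Y + d * Y') - inverse q \<cdot> ((q ^ i \<cdot> (X * b) + X' * d) * (a * Y + c * Y'))"
    unfolding 1 2 3 4 by simp
  also have "\<dots> = q ^ i \<cdot> (X * (a * b - inverse q \<cdot> (b * a)) * Y) + q ^ i \<cdot> (X * (a * d - inverse q \<cdot> (b * c)) * Y') +
      X' * (c * b - inverse q \<cdot> (d * a)) * Y + X' * (c * d - inverse q \<cdot> (d * c)) * Y'"
    by (simp add: algebra_simps)
  also have "\<dots> = q ^ i \<cdot> (X * D * Y') - inverse q \<cdot> (X' * D * Y)"
    unfolding ab_zero det_right det_left cd_zero by simp
  also have "\<dots> = (case k of 0 \<Rightarrow> 0 | Suc k' \<Rightarrow> q ^ (i + (r - k')) \<cdot> (tau p i j * D * tau r k' l)) -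
      (case i of 0 \<Rightarrow> 0 | Suc i' \<Rightarrow> inverse q \<cdot> (tau p i' j * D * tau r k l))"
    by (simp add: X_def X'_def Y_def Y'_def power_add del: tau.simps split: nat.split)
  finally show ?thesis .
qed

lemma psi_intertwines:
  "intertwines (II p r) (II (Suc p) (Suc r)) (psi p r) (TDT p r) (TT (Suc p) (Suc r))"
  unfolding intertwines_def
proof (rule meqI, clarify)
  fix i k j l assume mem: "i \<le> Suc p" "k \<le> Suc r" "j \<le> p" "l \<le> r"
  define C where "C = root_binom p j * root_binom r l / (root_binom (Suc p) i * root_binom (Suc r) k)"
  have "mprod (II p r) (em (psi p r)) (TDT p r) (i, k) (j, l) =
      (\<Sum>(i', k')\<in>II p r.
        (if i = i' \<and> k = Suc k' then C \<cdot> (q ^ (i' + (r - k')) \<cdot> (tau p i' j * D * tau r k' l)) else 0) -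
        (if i = Suc i' \<and> k = k' then C \<cdot> (inverse q \<cdot> (tau p i' j * D * tau r k' l)) else 0))"
    unfolding mprod_def
    by (intro sum.cong) (auto simp: em_def psi_def TDT_def t_def C_def field_simps scale_left_diff_distrib)
  also have "\<dots> = (case k of 0 \<Rightarrow> 0 | Suc k' \<Rightarrow> C \<cdot> (q ^ (i + (r - k')) \<cdot> (tau p i j * D * tau r k' l))) -
      (case i of 0 \<Rightarrow> 0 | Suc i' \<Rightarrow> C \<cdot> (inverse q \<cdot> (tau p i' j * D * tau r k l)))"
    unfolding sum_two_deltas using mem by (auto simp: tau_above not_le split: nat.split)
  also have "\<dots> = C \<cdot> (q ^ (j + (r - l)) \<cdot> (tau (Suc p) i j * tau (Suc r) k (Suc l)) -
      inverse q \<cdot> (tau (Suc p) i (Suc j) * tau (Suc r) k l))"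
    using mem by (subst psi_tau) (simp_all add: scale_right_diff_distrib split: nat.split)
  also have "\<dots> = TT (Suc p) (Suc r) (i, k) (j, Suc l) * (psi p r (j, Suc l) (j, l) \<cdot> 1) +
      TT (Suc p) (Suc r) (i, k) (Suc j, l) * (psi p r (Suc j, l) (j, l) \<cdot> 1)"
    by (simp add: TT_def t_def psi_def C_def scale_right_diff_distrib field_simps del: tau.simps)
  also have "\<dots> = (\<Sum>x\<in>{(j, Suc l), (Suc j, l)}. TT (Suc p) (Suc r) (i, k) x * (psi p r x (j, l) \<cdot> 1))"
    by simp
  also have "\<dots> = mprod (II (Suc p) (Suc r)) (TT (Suc p) (Suc r)) (em (psi p r)) (i, k) (j, l)"
    unfolding mprod_def em_def using mem by (intro sum.mono_neutral_left) (auto simp: psi_def split: if_splits)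
  finally show "mprod (II p r) (em (psi p r)) (TDT p r) (i, k) (j, l) =
    mprod (II (Suc p) (Suc r)) (TT (Suc p) (Suc r)) (em (psi p r)) (i, k) (j, l)" .
qed

lemma mu_psi:
  assumes "x \<in> II p r"
  shows "mprod (II (Suc p) (Suc r)) (mu (Suc p) (Suc r)) (psi p r) s x = 0"
proof -
  obtain j l where x: "x = (j, l)" "j \<le> p" "l \<le> r" using assms by auto
  have "mprod (II (Suc p) (Suc r)) (mu (Suc p) (Suc r)) (psi p r) s x =
      (\<Sum>y\<in>{(j, Suc l), (Suc j, l)}. mu (Suc p) (Suc r) s y * psi p r y x)"
    unfolding mprod_def using x by (intro sum.mono_neutral_right) (auto simp: psi_def split: if_splits)
  also have "\<dots> = 0"
  proof (cases "s = Suc (j + l)")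
    case True
    have "q ^ (Suc j * (Suc r - l)) = q ^ (j * (r - l)) * q ^ (j + (r - l)) * q"
    proof -
      obtain e where "r = l + e" using x le_Suc_ex by blast
      then show ?thesis by (simp add: power_add algebra_simps)
    qed
    then show ?thesis using x True by (simp add: mu_def psi_def field_simps)
  qed (simp add: mu_def psi_def)
  finally show ?thesis .
qed

definition cg_map :: "nat \<Rightarrow> nat \<Rightarrow> nat \<times> nat \<Rightarrow> nat + nat \<times> nat \<Rightarrow> complex" where
  "cg_map p r x y = (case y of Inl s \<Rightarrow> cadj (mu (Suc p) (Suc r)) x s | Inr z \<Rightarrow> psi p r x z)"

lemma psi_injective:
  assumes 0: "\<And>y. y \<in> II (Suc p) (Suc r) \<Longrightarrow> (\<Sum>x\<in>II p r. psi p r y x * f x) = 0"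
    and "i \<le> p" "k \<le> r"
  shows "f (i, k) = 0"
  using assms(2,3)
proof (induction i arbitrary: k)
  case 0
  have "(\<Sum>x\<in>II p r. psi p r (0, Suc k) x * f x) =
    (\<Sum>(j, l)\<in>II p r.
      (if 0 = j \<and> Suc k = Suc l then root_binom p j * root_binom r l / (root_binom (Suc p) 0 * root_binom (Suc r) (Suc k)) * q ^ (j + (r - l)) * f (j, l) else 0) -
      (if 0 = Suc j \<and> Suc k = l then 0 else 0))"
    by (intro sum.cong) (auto simp: psi_def)
  then have "0 = root_binom p 0 * root_binom r k / (root_binom (Suc p) 0 * root_binom (Suc r) (Suc k)) * q ^ (0 + (r - k)) * f (0, k)"
    unfolding sum_two_deltas using 0 assms(1)[of "(0, Suc k)"] by simp
  then show ?case by simp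
next
  case (Suc i)
  have IH: "f (i, k') = 0" if "k' \<le> r" for k' using Suc that by simp
  have "(\<Sum>x\<in>II p r. psi p r (Suc i, Suc k) x * f x) =
    (\<Sum>(j, l)\<in>II p r. 
      (if Suc i = j \<and> Suc k = Suc l then root_binom p j * root_binom r l / (root_binom (Suc p) (Suc i) * root_binom (Suc r) (Suc k)) * q ^ (j + (r - l)) * f (j, l) else 0) -
      (if Suc i = Suc j \<and> Suc k = l then root_binom p j * root_binom r l / (root_binom (Suc p) (Suc i) * root_binom (Suc r) (Suc k)) * inverse q * f (j, l) else 0))"
    by (intro sum.cong) (auto simp: psi_def)
  then have "0 = root_binom p (Suc i) * root_binom r k / (root_binom (Suc p) (Suc i) * root_binom (Suc r) (Suc k)) * q ^ (Suc i + (r - k)) * f (Suc i, k)"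
    unfolding sum_two_deltas using Suc.prems assms(1)[of "(Suc i, Suc k)"] IH by simp
  then show ?case by simp
qed

lemma cg_map_invertible:
  obtains N where "meq (II (Suc p) (Suc r)) (II (Suc p) (Suc r)) (mprod ({..Suc p + Suc r} <+> II p r) (cg_map p r) N) mid"
    and "meq ({..Suc p + Suc r} <+> II p r) ({..Suc p + Suc r} <+> II p r) (mprod (II (Suc p) (Suc r)) N (cg_map p r)) mid"
proof (rule square_injective_imp_invertible[of "{..Suc p + Suc r} <+> II p r" "II (Suc p) (Suc r)" "cg_map p r"])
  let ?n = "Suc p" and ?m = "Suc r"
  let ?I = "II ?n ?m"
  show "card ({..?n + ?m} <+> II p r) = card ?I"
    by (simp add: card_Plus)
  fix f y assume 0: "\<And>x. x \<in> ?I \<Longrightarrow> (\<Sum>y\<in>{..?n + ?m} <+> II p r. cg_map p r x y * f y) = 0"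
    and y: "y \<in> {..?n + ?m} <+> II p r"
  define \<alpha> where "\<alpha> x = (\<Sum>s\<le>?n + ?m. cnj (mu ?n ?m s x) * f (Inl s))" for x
  define \<beta> where "\<beta> x = (\<Sum>z\<in>II p r. psi p r x z * f (Inr z))" for x
  have ab: "\<alpha> x = - \<beta> x" if "x \<in> ?I" for x
  proof -
    have "\<alpha> x + \<beta> x = 0"
      using 0[OF that] by (simp add: sum.Plus o_def \<alpha>_def \<beta>_def cg_map_def cadj_def)
    then show ?thesis by (simp add: eq_neg_iff_add_eq_0)
  qed
  have mb: "(\<Sum>x\<in>?I. mu ?n ?m s x * \<alpha> x) = 0" for s
  proof -
    have "(\<Sum>x\<in>?I. mu ?n ?m s x * \<alpha> x) = - (\<Sum>x\<in>?I. \<Sum>z\<in>II p r. mu ?n ?m s x * (psi p r x z * f (Inr z)))"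
      by (simp add: ab \<beta>_def sum_distrib_left sum_negf cong: sum.cong)
    also have "\<dots> = - (\<Sum>z\<in>II p r. (\<Sum>x\<in>?I. mu ?n ?m s x * psi p r x z) * f (Inr z))"
      by (subst sum.swap) (simp add: sum_distrib_right mult.assoc)
    also have "\<dots> = 0"
      using mu_psi[of _ p r s] by (simp add: mprod_def)
    finally show ?thesis .
  qed
  have "(\<Sum>x\<in>?I. cnj (\<alpha> x) * \<alpha> x) = (\<Sum>x\<in>?I. \<Sum>s\<le>?n + ?m. mu ?n ?m s x * cnj (f (Inl s)) * \<alpha> x)"
    unfolding \<alpha>_def by (simp add: sum_distrib_right del: sum.atMost_Suc)
  also have "\<dots> = (\<Sum>s\<le>?n + ?m. cnj (f (Inl s)) * (\<Sum>x\<in>?I. mu ?n ?m s x * \<alpha> x))"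
    by (subst sum.swap) (simp add: sum_distrib_left algebra_simps)
  also have "\<dots> = 0" by (simp add: mb)
  finally have "(\<Sum>x\<in>?I. of_real ((cmod (\<alpha> x))\<^sup>2) :: complex) = 0"
    unfolding complex_norm_square by (simp only: mult.commute)
  then have "(\<Sum>x\<in>?I. (cmod (\<alpha> x))\<^sup>2) = 0"
    by (simp only: of_real_sum[symmetric] of_real_eq_0_iff)
  then have \<alpha>0: "\<alpha> x = 0" if "x \<in> ?I" for x
    using that by (subst (asm) sum_nonneg_eq_0_iff) auto
  show "f y = 0"
  proof (cases y)
    case (Inl s)
    then have s: "s \<le> ?n + ?m" using y by auto
    define i where "i = min s ?n"
    define k where "k = s - i"
    have ik: "(i, k) \<in> ?I" "i + k = s" using s by (auto simp: i_def k_def)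
    have "\<alpha> (i, k) = (\<Sum>s'\<le>?n + ?m. if s = s' then cnj (mu ?n ?m s (i, k)) * f (Inl s) else 0)"
      unfolding \<alpha>_def using ik(2) by (intro sum.cong) (auto simp: mu_def)
    then have "cnj (mu ?n ?m s (i, k)) * f (Inl s) = 0" using \<alpha>0[OF ik(1)] s by (simp del: sum.atMost_Suc)
    then show ?thesis using ik(2) Inl by (simp add: mu_def)
  next
    case (Inr z)
    obtain i k where z: "z = (i, k)" by fastforce
    have "\<beta> x = 0" if "x \<in> ?I" for x using ab[OF that] \<alpha>0[OF that] by simp
    then have "f (Inr (i, k)) = 0"
      using psi_injective[of p r "\<lambda>z. f (Inr z)" i k] y Inr z unfolding \<beta>_def by auto
    then show ?thesis by (simp add: Inr z)
  qed
qed (auto intro: that)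

lemma cg_map_cancel:
  assumes mu: "meq {..Suc p + Suc r} J (mprod (II (Suc p) (Suc r)) (em (mu (Suc p) (Suc r))) X)
      (mprod (II (Suc p) (Suc r)) (em (mu (Suc p) (Suc r))) Y)"
    and psi: "meq (II p r) J (mprod (II (Suc p) (Suc r)) (em (cadj (psi p r))) X)
      (mprod (II (Suc p) (Suc r)) (em (cadj (psi p r))) Y)"
  shows "meq (II (Suc p) (Suc r)) J X Y"
proof -
  let ?I = "II (Suc p) (Suc r)" and ?J = "{..Suc p + Suc r} <+> II p r" and ?K = "em (cadj (cg_map p r))"
  obtain N where "meq ?I ?I (mprod ?J (cg_map p r) N) mid"
    using cg_map_invertible by blast
  then have "meq ?I ?I (cadj (mprod ?J (cg_map p r) N)) (cadj mid)" by (rule meq_cadj)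
  then have "meq ?I ?I (mprod ?J (cadj N) (cadj (cg_map p r))) mid"
    unfolding cadj_mprod cadj_mid .
  from meq_em[OF this] have N: "meq ?I ?I (mprod ?J (em (cadj N)) ?K) mid"
    by (simp add: em_mprod em_mid)
  have red: "meq ?I J Z (mprod ?J (em (cadj N)) (mprod ?I ?K Z))" for Z
  proof -
    have "meq ?I J Z (mprod ?I mid Z)"
      by (intro meq_sym[OF mprod_mid_left]) simp
    also have "meq ?I J \<dots> (mprod ?I (mprod ?J (em (cadj N)) ?K) Z)"
      by (intro mprod_cong_left meq_sym[OF N])
    also have "\<dots> = mprod ?J (em (cadj N)) (mprod ?I ?K Z)"
      by (simp add: mprod_assoc)
    finally show ?thesis .
  qed
  have "meq ?J J (mprod ?I ?K X) (mprod ?I ?K Y)"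
  proof (rule meqI)
    fix y j assume y: "y \<in> ?J" and j: "j \<in> J"
    have "mprod ?I ?K Z (Inl s) j = mprod ?I (em (mu (Suc p) (Suc r))) Z s j"
      "mprod ?I ?K Z (Inr z) j = mprod ?I (em (cadj (psi p r))) Z z j" for Z s z
      by (simp_all add: mprod_def em_def cadj_def cg_map_def)
    then show "mprod ?I ?K X y j = mprod ?I ?K Y y j"
      using y j meqD[OF mu] meqD[OF psi] by auto
  qed
  then have "meq ?I J (mprod ?J (em (cadj N)) (mprod ?I ?K X))
      (mprod ?J (em (cadj N)) (mprod ?I ?K Y))"
    by (rule mprod_cong_right)
  from meq_trans[OF meq_trans[OF red this] meq_sym[OF red]] show ?thesis .
qed

lemma mu_one_coisometric:
  "meq {..Suc n} {..Suc n} (mprod (II n 1) (mu n 1) (cadj (mu n 1))) mid"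
proof (rule meqI)
  fix s s' assume s: "s \<in> {..Suc n}" "s' \<in> {..Suc n}"
  let ?x = "(cmod q)\<^sup>2"
  show "mprod (II n 1) (mu n 1) (cadj (mu n 1)) s s' = mid s s'"
  proof (cases "s = s'")
    case False
    then show ?thesis by (auto simp: mprod_def cadj_def mu_def mid_def intro!: sum.neutral)
  next
    case True
    have q: "q ^ i * cnj q ^ i = of_real (?x ^ i)" for i
      by (simp add: complex_norm_square[of q, symmetric] power_mult_distrib[symmetric] del: of_real_power)
        (simp add: power_mult[symmetric] mult.commute)
    define G where "G i k = (if i \<le> n \<and> k \<le> 1 then
      of_real (q_binom ?x n i / q_binom ?x (Suc n) s * ?x ^ (i * (1 - k))) else (0::complex))" for i k
    have "mprod (II n 1) (mu n 1) (cadj (mu n 1)) s s' = (\<Sum>(i, k)\<in>II n 1. if i + k = s then G i k else 0)"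
      unfolding mprod_def
    proof (intro sum.cong refl; clarify)
      fix i k assume ik: "i \<le> n" "k \<le> (1::nat)"
      have "mu n 1 s (i, k) * cadj (mu n 1) (i, k) s' =
        (if i + k = s then (root_binom n i * root_binom n i) / (root_binom (Suc n) s * root_binom (Suc n) s) * (q ^ (i * (1 - k)) * cnj q ^ (i * (1 - k))) else 0)"
        using ik by (auto simp: mu_def cadj_def True root_binom_1)
      then show "mu n 1 s (i, k) * cadj (mu n 1) (i, k) s' = (if i + k = s then G i k else 0)"
        unfolding root_binom_square q using ik by (simp add: G_def)
    qed
    also have "\<dots> = (\<Sum>i\<le>s. G i (s - i))"
      by (rule sum_antidiagonal) (auto simp: G_def)
    also have "\<dots> = 1"
    proof (cases s)
      case 0
      then show ?thesis by (simp add: G_def q_binom_0[OF unit_interval])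
    next
      case (Suc k)
      have "(\<Sum>i\<le>s. G i (s - i)) = (\<Sum>i\<in>{k, Suc k}. G i (s - i))"
        by (rule sum.mono_neutral_right) (auto simp: Suc G_def)
      also have "\<dots> = G k 1 + G (Suc k) 0" by (simp add: Suc)
      also have "\<dots> = 1"
      proof (cases "k < n")
        case True
        have "q_binom ?x (Suc n) (Suc k) \<noteq> 0" using q_binom_pos[OF unit_interval, of "Suc n" "Suc k"] by simp
        then have "(q_binom ?x n k + ?x ^ Suc k * q_binom ?x n (Suc k)) / q_binom ?x (Suc n) (Suc k) = 1"
          using q_binom_pascal[OF unit_interval True] by (simp add: add.commute)
        moreover have "G k 1 + G (Suc k) 0 =
            of_real ((q_binom ?x n k + ?x ^ Suc k * q_binom ?x n (Suc k)) / q_binom ?x (Suc n) (Suc k))"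
          using True unfolding G_def Suc by (simp add: add_divide_distrib mult.commute)
        ultimately show ?thesis by (simp only: of_real_1)
      next
        case False
        then have "k = n" using Suc s by simp
        then show ?thesis unfolding G_def Suc by (simp add: q_binom_self[OF unit_interval])
      qed
      finally show ?thesis .
    qed
    finally show ?thesis by (simp add: mid_def True)
  qed
qed

lemma unitary_t_0: "unitary {..0} (t 0)"
  by (simp add: unitary_def meq_def mprod_def adj_def t_def mid_def)

lemma unitary_t_1: "unitary {..1} (t 1)"
proof -
  have t1: "t 1 0 0 = a" "t 1 0 1 = b" "t 1 1 0 = c" "t 1 1 1 = d"
    unfolding t_def tau_1_entries using root_binom_0[of 1] root_binom_self[of 1] by simp_all
  have st_c: "st c = (- q) \<cdot> (b * st D)" and st_d: "st d = a * st D"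
    by (simp_all add: c_def d_def)
  have Db: "st D * b = theta \<cdot> (b * st D)" by (rule move_D(2)[OF bD_theta]) simp
  have 1: "a * st c + b * st d = 0"
    by (simp add: st_c st_d mult.assoc[symmetric] ba)
  have 2: "c * st c + d * st d = 1"
  proof -
    have "c * st c + d * st d = D * (st a * a + of_real ((cmod q)\<^sup>2) \<cdot> (st b * b)) * st D"
      unfolding cmod2 by (simp add: st_c st_d, simp add: c_def d_def algebra_simps)
    then show ?thesis unfolding a'a by (simp add: DD')
  qed
  have 3: "st a * a + st c * c = 1"
  proof -
    have "st c * c = (q * cnj q) \<cdot> (b * st b)"
      by (simp add: st_c, simp add: c_def mult.assoc)
    then show ?thesis using a'a unfolding cmod2 bb' by simp
  qed
  have 4: "st a * b + st c * d = 0"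
    by (simp add: st_c, simp add: d_def mult.assoc a'b)
  have 5: "st b * b + st d * d = 1"
    using aa' by (simp add: st_d, simp add: d_def mult.assoc bb' add.commute)
  have 6: "c * st a + d * st b = 0"
    using arg_cong[OF 1, of st] by simp
  have 7: "st b * a + st d * c = 0"
    using arg_cong[OF 4, of st] by simp
  have "{..1} = {0, 1::nat}" by auto
  then show ?thesis
    using 1 2 3 4 5 6 7 aa' by (simp add: unitary_def meq_def mprod_def adj_def t1[simplified] mid_def)
qed

text \<open>Unitarity of the tensor product turns \<open>psi\<^sup>*\<close> into an intertwiner. The defect of \<open>mu\<^sup>*\<close> being one is
  killed by both \<open>mu\<close> and \<open>psi\<^sup>*\<close>, hence vanishes; then \<open>t (n + 1)\<close> is the compression of a unitary
  matrix to an invariant complement.\<close>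

lemma unitary_t_step:
  assumes n: "unitary {..Suc p} (t (Suc p))" and p: "unitary {..p} (t p)"
  shows "unitary {..Suc (Suc p)} (t (Suc (Suc p)))"
proof -
  let ?I = "II (Suc p) (Suc 0)" and ?J = "{..Suc (Suc p)}"
  let ?u = "TT (Suc p) (Suc 0)" and ?v = "t (Suc (Suc p))" and ?mu = "mu (Suc p) (Suc 0)" and ?psi = "psi p 0"
  let ?M = "em ?mu" and ?M' = "em (cadj ?mu)" and ?P = "em (cadj ?psi)" and ?w = "TDT p 0" and ?K = "II p 0"
  have u: "unitary ?I ?u"
    unfolding TT_def by (rule unitary_tensor[OF n unitary_t_1[unfolded One_nat_def]])
  have w: "unitary ?K ?w"
    unfolding TDT_def by (intro unitary_tensor[OF unitary_mult_unitary_element unitary_t_0] p DD')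
  have mu: "meq ?J ?I (mprod ?I ?M ?u) (mprod ?J ?v ?M)"
    using mu_intertwines[of "Suc p" "Suc 0"] by (simp add: intertwines_def)
  have psi: "intertwines ?K ?I ?psi ?w ?u"
    using psi_intertwines[of p 0] by simp
  have psi': "meq ?K ?I (mprod ?I ?P ?u) (mprod ?K ?w ?P)"
    using intertwines_adj[OF _ _ psi] u w by (simp add: intertwines_def unitary_def)
  have iso: "meq ?J ?J (mprod ?I ?M ?M') mid"
    using meq_em[OF mu_one_coisometric[of "Suc p", unfolded One_nat_def]] by (simp add: em_mprod em_mid)
  have mp: "meq ?J ?K (mprod ?I ?mu ?psi) (\<lambda>_ _. 0)"
    using mu_psi[of _ p 0] by (simp add: meq_def)
  from meq_em[OF meq_cadj[OF this]]
  have pm: "meq ?K ?J (mprod ?I ?P ?M') (\<lambda>_ _. 0)"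
    unfolding cadj_mprod em_mprod by (simp add: em_def cadj_def meq_def)
  have vI: "meq ?J ?J (mprod ?J ?v mid) ?v" "meq ?J ?J (mprod ?J mid ?v) ?v"
    by (simp_all add: mprod_mid_left mprod_mid_right)
  have mu': "meq ?I ?J (mprod ?I ?u ?M') (mprod ?J ?M' ?v)"
  proof (rule cg_map_cancel[of p 0 ?J, unfolded add_Suc_right add_0_right])
    have "mprod ?I ?M (mprod ?I ?u ?M') = mprod ?I (mprod ?I ?M ?u) ?M'"
      by (simp add: mprod_assoc)
    also have "meq ?J ?J \<dots> (mprod ?I (mprod ?J ?v ?M) ?M')"
      by (intro mprod_cong_left mu)
    also have "\<dots> = mprod ?J ?v (mprod ?I ?M ?M')"
      by (simp add: mprod_assoc)
    also have "meq ?J ?J \<dots> (mprod ?J ?v mid)"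
      by (intro mprod_cong_right iso)
    also have "meq ?J ?J \<dots> ?v" by (rule vI)
    also have "meq ?J ?J \<dots> (mprod ?J mid ?v)" by (rule meq_sym[OF vI(2)])
    also have "meq ?J ?J \<dots> (mprod ?J (mprod ?I ?M ?M') ?v)"
      by (intro mprod_cong_left meq_sym[OF iso])
    also have "\<dots> = mprod ?I ?M (mprod ?J ?M' ?v)"
      by (simp add: mprod_assoc)
    finally show "meq ?J ?J (mprod ?I ?M (mprod ?I ?u ?M'))
        (mprod ?I ?M (mprod ?J ?M' ?v))" .
    have "mprod ?I ?P (mprod ?I ?u ?M') = mprod ?I (mprod ?I ?P ?u) ?M'"
      by (simp add: mprod_assoc)
    also have "meq ?K ?J \<dots> (mprod ?I (mprod ?K ?w ?P) ?M')"
      by (intro mprod_cong_left psi')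
    also have "\<dots> = mprod ?K ?w (mprod ?I ?P ?M')"
      by (simp add: mprod_assoc)
    also have "meq ?K ?J \<dots> (mprod ?K ?w (\<lambda>_ _. 0))"
      by (intro mprod_cong_right pm)
    also have "\<dots> = mprod ?J (\<lambda>_ _. 0) ?v"
      by (simp add: mprod_def fun_eq_iff)
    also have "meq ?K ?J \<dots> (mprod ?J (mprod ?I ?P ?M') ?v)"
      by (intro mprod_cong_left meq_sym[OF pm])
    also have "\<dots> = mprod ?I ?P (mprod ?J ?M' ?v)"
      by (simp add: mprod_assoc)
    finally show "meq ?K ?J (mprod ?I ?P (mprod ?I ?u ?M'))
        (mprod ?I ?P (mprod ?J ?M' ?v))" .
  qed
  have "meq ?J ?J ?v (mprod ?J mid ?v)" by (rule meq_sym[OF vI(2)])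
  also have "meq ?J ?J \<dots> (mprod ?J (mprod ?I ?M ?M') ?v)"
    by (intro mprod_cong_left meq_sym[OF iso])
  also have "\<dots> = mprod ?I ?M (mprod ?J ?M' ?v)"
    by (simp add: mprod_assoc)
  also have "meq ?J ?J \<dots> (mprod ?I ?M (mprod ?I ?u ?M'))"
    by (intro mprod_cong_right meq_sym[OF mu'])
  finally have v: "meq ?J ?J ?v (mprod ?I ?M (mprod ?I ?u ?M'))" .
  from meq_adj[OF this] have adj_v: "meq ?J ?J (adj ?v) (mprod ?I ?M (mprod ?I (adj ?u) ?M'))"
    by (simp add: adj_mprod adj_em mprod_assoc)
  have sandwich: "meq ?J ?J (mprod ?I ?M (mprod ?I w ?M')) mid" if "meq ?I ?I w mid" for w
  proof -
    have "meq ?J ?J (mprod ?I ?M (mprod ?I w ?M')) (mprod ?I ?M (mprod ?I mid ?M'))"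
      by (intro mprod_cong_right mprod_cong_left that)
    also have "meq ?J ?J \<dots> (mprod ?I ?M ?M')"
      by (intro mprod_cong_right mprod_mid_left) simp
    also have "meq ?J ?J \<dots> mid" by (rule iso)
    finally show ?thesis .
  qed
  have "meq ?J ?J (mprod ?J ?v (adj ?v)) (mprod ?J ?v (mprod ?I ?M (mprod ?I (adj ?u) ?M')))"
    by (intro mprod_cong_right adj_v)
  also have "\<dots> = mprod ?I (mprod ?J ?v ?M) (mprod ?I (adj ?u) ?M')"
    by (simp add: mprod_assoc)
  also have "meq ?J ?J \<dots> (mprod ?I (mprod ?I ?M ?u) (mprod ?I (adj ?u) ?M'))"
    by (intro mprod_cong_left meq_sym[OF mu])
  also have "\<dots> = mprod ?I ?M (mprod ?I (mprod ?I ?u (adj ?u)) ?M')"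
    by (simp add: mprod_assoc)
  also have "meq ?J ?J \<dots> mid"
    using u by (intro sandwich) (simp add: unitary_def)
  finally have 1: "meq ?J ?J (mprod ?J ?v (adj ?v)) mid" .
  have "meq ?J ?J (mprod ?J (adj ?v) ?v) (mprod ?J (mprod ?I ?M (mprod ?I (adj ?u) ?M')) ?v)"
    by (intro mprod_cong_left adj_v)
  also have "\<dots> = mprod ?I ?M (mprod ?I (adj ?u) (mprod ?J ?M' ?v))"
    by (simp add: mprod_assoc)
  also have "meq ?J ?J \<dots> (mprod ?I ?M (mprod ?I (adj ?u) (mprod ?I ?u ?M')))"
    by (intro mprod_cong_right meq_sym[OF mu'])
  also have "\<dots> = mprod ?I ?M (mprod ?I (mprod ?I (adj ?u) ?u) ?M')"
    by (simp add: mprod_assoc)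
  also have "meq ?J ?J \<dots> mid"
    using u by (intro sandwich) (simp add: unitary_def)
  finally show ?thesis using 1 by (simp add: unitary_def)
qed

lemma unitary_t: "unitary {..n} (t n)"
proof (induction n rule: less_induct)
  case (less n)
  consider "n = 0" | "n = 1" | p where "n = Suc (Suc p)"
    by (metis One_nat_def not0_implies_Suc)
  then show ?case
  proof cases
    case 1 then show ?thesis using unitary_t_0 by simp
  next
    case 2 then show ?thesis using unitary_t_1 by simp
  next
    case (3 p) then show ?thesis using unitary_t_step[of p] less by simp
  qed
qed

lemma TT_decomposition_step:
  "ceq (II (Suc p) (Suc r)) (TT (Suc p) (Suc r))
     ({..Suc p + Suc r} <+> II p r) (dsum (t (Suc p + Suc r)) (TDT p r))"
proof (rule ceq_sym)
  let ?I = "II (Suc p) (Suc r)" and ?J = "{..Suc p + Suc r} <+> II p r"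
  let ?u = "TT (Suc p) (Suc r)" and ?v = "t (Suc p + Suc r)" and ?M = "em (cadj (mu (Suc p) (Suc r)))" and ?P = "em (psi p r)"
    and ?w = "dsum (t (Suc p + Suc r)) (TDT p r)" and ?K = "em (cg_map p r)"
  have u: "unitary ?I ?u"
    unfolding TT_def by (rule unitary_tensor[OF unitary_t unitary_t])
  obtain N where N: "meq ?I ?I (mprod ?J (cg_map p r) N) mid" "meq ?J ?J (mprod ?I N (cg_map p r)) mid"
    using cg_map_invertible by blast
  have "intertwines {..Suc p + Suc r} ?I (cadj (mu (Suc p) (Suc r))) ?v ?u"
    using u unitary_t[of "Suc p + Suc r"] by (intro intertwines_adj mu_intertwines) (simp_all add: unitary_def)
  then have mu: "meq ?I {..Suc p + Suc r} (mprod {..Suc p + Suc r} ?M ?v)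
      (mprod ?I ?u ?M)"
    by (simp add: intertwines_def)
  have psi: "meq ?I (II p r) (mprod (II p r) ?P (TDT p r)) (mprod ?I ?u ?P)"
    using psi_intertwines by (simp add: intertwines_def)
  have cg_map: "intertwines ?J ?I (cg_map p r) ?w ?u"
    unfolding intertwines_def
  proof (rule meqI)
    fix x y assume x: "x \<in> ?I" and y: "y \<in> ?J"
    have "mprod ?J ?K ?w x (Inl s) = mprod {..Suc p + Suc r} ?M ?v x s"
      "mprod ?J ?K ?w x (Inr z) = mprod (II p r) ?P (TDT p r) x z"
      "mprod ?I ?u ?K x (Inl s) = mprod ?I ?u ?M x s"
      "mprod ?I ?u ?K x (Inr z) = mprod ?I ?u ?P x z" for s z
      by (simp_all add: mprod_def em_def cg_map_def sum.Plus o_def)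
    then show "mprod ?J ?K ?w x y = mprod ?I ?u ?K x y"
      using x y meqD[OF mu] meqD[OF psi] by auto
  qed
  show "ceq ?J ?w ?I ?u"
    by (rule ceqI[OF _ _ N(2) N(1) cg_map]) simp_all
qed

end

context uq2_relations
begin

definition Dz :: "int \<Rightarrow> 'r" where
  "Dz m = (if m < 0 then st D ^ nat (- m) else D ^ nat m)"

lemma Dz_0 [simp]: "Dz 0 = 1"
  by (simp add: Dz_def)

lemma D_Dz: "D * Dz m = Dz (m + 1)"
proof (cases "m < 0")
  case True
  then have "nat (- m) = Suc (nat (- (m + 1)))" by simp
  then show ?thesis using True by (auto simp: Dz_def)
next
  case False
  then have "nat (m + 1) = Suc (nat m)" by simp
  then show ?thesis using False by (simp add: Dz_def)
qed

lemma D'_Dz: "st D * Dz m = Dz (m - 1)"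
  using arg_cong[OF D_Dz[of "m - 1"], of "\<lambda>x. st D * x"] by simp

lemma Dz_add: "Dz m * Dz n = Dz (m + n)"
proof (induction m rule: int_induct[where k = 0])
  case base
  then show ?case by simp
next
  case (step1 i)
  have "Dz (i + 1) * Dz n = D * (Dz i * Dz n)" by (simp add: D_Dz[symmetric] mult.assoc)
  also have "\<dots> = Dz (i + n + 1)" unfolding step1 by (rule D_Dz)
  finally show ?case by (simp add: add_ac)
next
  case (step2 i)
  have "Dz (i - 1) * Dz n = st D * (Dz i * Dz n)" by (simp add: D'_Dz[symmetric] mult.assoc)
  also have "\<dots> = Dz (i + n - 1)" unfolding step2 by (rule D'_Dz)
  finally show ?case by (simp add: algebra_simps)
qed

lemma D_t: "D * t n i j = (theta ^ i / theta ^ j) \<cdot> (t n i j * D)"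
  using D_tau[of n i j] by (simp add: t_def mult.commute)

lemma D'_t: "st D * t n i j = (theta ^ j / theta ^ i) \<cdot> (t n i j * st D)"
proof -
  have "t n i j * D = (theta ^ j / theta ^ i) \<cdot> (D * t n i j)"
    by (simp add: D_t)
  then show ?thesis by (rule move_D(2)) simp
qed

lemma Dz_t: "Dz m * t n i j = (theta powi m) ^ i \<cdot> inverse (theta powi m) ^ j \<cdot> (t n i j * Dz m)"
proof (induction m rule: int_induct[where k = 0])
  case base
  then show ?case by simp
next
  case (step1 m)
  have "Dz (m + 1) * t n i j = D * (Dz m * t n i j)"
    by (simp add: D_Dz[symmetric] mult.assoc)
  also have "\<dots> = (theta powi m) ^ i \<cdot> inverse (theta powi m) ^ j \<cdot> (D * t n i j * Dz m)"
    unfolding step1 by (simp add: mult.assoc)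
  also have "\<dots> = (theta powi (m + 1)) ^ i \<cdot> inverse (theta powi (m + 1)) ^ j \<cdot> (t n i j * Dz (m + 1))"
  proof -
    have "theta powi (m + 1) = theta powi m * theta" by (simp add: power_int_add_1)
    then show ?thesis
      unfolding D_t by (simp only:) (simp add: D_Dz mult.assoc power_mult_distrib field_simps)
  qed
  finally show ?case .
next
  case (step2 m)
  have "Dz (m - 1) * t n i j = st D * (Dz m * t n i j)"
    by (simp add: D'_Dz[symmetric] mult.assoc)
  also have "\<dots> = (theta powi m) ^ i \<cdot> inverse (theta powi m) ^ j \<cdot> (st D * t n i j * Dz m)"
    unfolding step2 by (simp add: mult.assoc)
  also have "\<dots> = (theta powi (m - 1)) ^ i \<cdot> inverse (theta powi (m - 1)) ^ j \<cdot> (t n i j * Dz (m - 1))"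
    unfolding D'_t by (simp add: D'_Dz mult.assoc power_int_diff power_divide field_simps)
  finally show ?case .
qed

definition TTD :: "nat \<Rightarrow> nat \<Rightarrow> int \<Rightarrow> nat \<times> nat \<Rightarrow> nat \<times> nat \<Rightarrow> 'r" where
  "TTD m n e x y = TT m n x y * Dz e"

lemma ceq_move_D:
  "ceq (II m n) (\<lambda>(i, k) (j, l). t m i j * Dz e * (t n k l * Dz e')) (II m n) (TTD m n (e + e'))"
proof (rule ceq_diag)
  let ?z = "\<lambda>(i, k). inverse (theta powi e) ^ k"
  show "?z x \<noteq> 0" for x :: "nat \<times> nat" by (cases x) simp
  fix x y :: "nat \<times> nat"
  obtain i k j l where xy: "x = (i, k)" "y = (j, l)" by (cases x; cases y) auto
  have "t m i j * Dz e * (t n k l * Dz e') = t m i j * (Dz e * t n k l) * Dz e'"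
    by (simp add: mult.assoc)
  also have "\<dots> = (theta powi e) ^ k \<cdot> inverse (theta powi e) ^ l \<cdot> (t m i j * t n k l * Dz (e + e'))"
    by (simp add: Dz_t mult.assoc Dz_add)
  finally show "TTD m n (e + e') x y = (?z x / ?z y) \<cdot>
      (case x of (i, k) \<Rightarrow> \<lambda>(j, l). t m i j * Dz e * (t n k l * Dz e')) y"
    by (simp add: xy TTD_def TT_def power_inverse)
qed simp

lemma TTD_decomposition_step:
  "ceq (II (Suc p) (Suc r)) (TTD (Suc p) (Suc r) e)
     ({..Suc p + Suc r} <+> II p r) (dsum (\<lambda>i j. t (Suc p + Suc r) i j * Dz e) (TTD p r (e + 1)))"
proof -
  let ?J = "{..Suc p + Suc r} <+> II p r"
  have "ceq (II (Suc p) (Suc r)) (TTD (Suc p) (Suc r) e) ?J (\<lambda>x y. dsum (t (Suc p + Suc r)) (TDT p r) x y * Dz e)"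
    using ceq_mult_right[OF TT_decomposition_step] by (simp add: TTD_def[abs_def])
  also have "(\<lambda>x y. dsum (t (Suc p + Suc r)) (TDT p r) x y * Dz e) =
      dsum (\<lambda>i j. t (Suc p + Suc r) i j * Dz e) (\<lambda>x y. TDT p r x y * Dz e)"
    by (auto simp: fun_eq_iff dsum_def split: sum.split)
  also have "(\<lambda>x y. TDT p r x y * Dz e) = (\<lambda>(i, k) (j, l). t p i j * Dz 1 * (t r k l * Dz e))"
    using D_Dz[of 0] by (auto simp: fun_eq_iff TDT_def mult.assoc)
  finally have "ceq (II (Suc p) (Suc r)) (TTD (Suc p) (Suc r) e) ?J
      (dsum (\<lambda>i j. t (Suc p + Suc r) i j * Dz e) (\<lambda>(i, k) (j, l). t p i j * Dz 1 * (t r k l * Dz e)))" .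
  moreover have "ceq ?J (dsum (\<lambda>i j. t (Suc p + Suc r) i j * Dz e) (\<lambda>(i, k) (j, l). t p i j * Dz 1 * (t r k l * Dz e)))
      ?J (dsum (\<lambda>i j. t (Suc p + Suc r) i j * Dz e) (TTD p r (e + 1)))"
    using ceq_move_D[of p r 1 e] by (intro ceq_dsum) (simp_all add: add.commute)
  ultimately show ?thesis by (rule ceq_trans)
qed

definition summands :: "nat \<Rightarrow> nat \<Rightarrow> (nat \<times> nat) set" where
  "summands m n = (SIGMA r:{0..min m n}. {..m + n - 2 * r})"

definition summand_coeff :: "nat \<Rightarrow> nat \<Rightarrow> int \<Rightarrow> nat \<times> nat \<Rightarrow> nat \<times> nat \<Rightarrow> 'r" where
  "summand_coeff m n e = (\<lambda>(r, i) (r', j). if r = r' then t (m + n - 2 * r) i j * Dz (e + int r) else 0)"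

lemma TTD_decomposition: "ceq (II m n) (TTD m n e) (summands m n) (summand_coeff m n e)"
proof (induction m arbitrary: n e)
  case 0
  show ?case
  proof (rule ceq_reindex)
    show "bij_betw (\<lambda>(i, k). (0, k)) (II 0 n) (summands 0 n)"
      by (auto simp: bij_betw_def inj_on_def summands_def)
  qed (auto simp: TTD_def TT_def summand_coeff_def t_def)
next
  case (Suc p)
  show ?case
  proof (cases n)
    case 0
    show ?thesis unfolding 0
    proof (rule ceq_reindex)
      show "bij_betw (\<lambda>(i, k). (0, i)) (II (Suc p) 0) (summands (Suc p) 0)"
        by (auto simp: bij_betw_def inj_on_def summands_def)
    qed (auto simp: TTD_def TT_def summand_coeff_def t_def)
  next
    case (Suc r)
    let ?J = "{..Suc p + Suc r}" and ?v = "\<lambda>i j. t (Suc p + Suc r) i j * Dz e"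
    have "ceq (II (Suc p) n) (TTD (Suc p) n e) (?J <+> summands p r) (dsum ?v (summand_coeff p r (e + 1)))"
      unfolding Suc by (rule ceq_trans[OF TTD_decomposition_step ceq_dsum[OF _ Suc.IH]]) simp
    moreover have "ceq (?J <+> summands p r) (dsum ?v (summand_coeff p r (e + 1)))
        (summands (Suc p) n) (summand_coeff (Suc p) n e)"
    proof (rule ceq_reindex)
      let ?f = "case_sum (\<lambda>i. (0, i)) (\<lambda>(s, i). (Suc s, i)) :: nat + nat \<times> nat \<Rightarrow> nat \<times> nat"
      show "bij_betw ?f (?J <+> summands p r) (summands (Suc p) n)"
      proof (rule bij_betw_imageI)
        show "inj_on ?f (?J <+> summands p r)"
          by (auto simp: inj_on_def)
        have "(s, i) \<in> ?f ` (?J <+> summands p r)" if "(s, i) \<in> summands (Suc p) n" for s i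
        proof (cases s)
          case 0
          then show ?thesis using that by (auto simp: summands_def Suc intro!: image_eqI[of _ _ "Inl i"])
        next
          case (Suc s')
          then show ?thesis using that \<open>n = Suc r\<close>
            by (auto simp: summands_def intro!: image_eqI[of _ _ "Inr (s', i)"])
        qed
        then show "?f ` (?J <+> summands p r) = summands (Suc p) n"
          by (auto simp: summands_def Suc)
      qed
      show "finite (?J <+> summands p r)" by (simp add: summands_def)
      show "dsum ?v (summand_coeff p r (e + 1)) x y = summand_coeff (Suc p) n e (?f x) (?f y)" for x y
        by (cases x; cases y) (auto simp: summand_coeff_def Suc add_ac)
    qed
    ultimately show ?thesis by (rule ceq_trans)
  qed
qed

lemma tensor_decomposition:
  "ceq (II m n) (\<lambda>(i, k) (j, l). t m i j * Dz e * (t n k l * Dz e'))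
     (summands m n) (summand_coeff m n (e + e'))"
  by (rule ceq_trans[OF ceq_move_D TTD_decomposition])

end

section \<open>The free algebra as a complex star-algebra\<close>

lemma lookup_pm_scale [simp]: "Poly_Mapping.lookup (pm_scale c x) k = c * Poly_Mapping.lookup x k"
  by (simp add: pm_scale_def Poly_Mapping.map.rep_eq when_def)

lemma pm_scale_single [simp]: "pm_scale c (Poly_Mapping.single k d) = Poly_Mapping.single k (c * d)"
  by (intro poly_mapping_eqI) (simp add: lookup_single when_def)

interpretation pm: vector_space pm_scale
  by standard (auto intro!: poly_mapping_eqI simp: lookup_add algebra_simps)

lemma pm_decompose: "x = (\<Sum>k\<in>Poly_Mapping.keys x. Poly_Mapping.single k (Poly_Mapping.lookup x k))"
  by (intro poly_mapping_eqI) (simp add: lookup_sum lookup_single when_def in_keys_iff)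

lemma pm_induct [case_names zero single add]:
  fixes x :: "'k \<Rightarrow>\<^sub>0 complex"
  assumes "P 0" and "\<And>k c. P (Poly_Mapping.single k c)" and "\<And>x y. P x \<Longrightarrow> P y \<Longrightarrow> P (x + y)"
  shows "P x"
proof -
  have "P (\<Sum>k\<in>A. Poly_Mapping.single k (Poly_Mapping.lookup x k))" if "finite A" for A
    using that by (induction A) (auto intro: assms)
  then show ?thesis by (subst pm_decompose) simp
qed

lemma pm_sum_additive:
  fixes F :: "'k \<Rightarrow> complex \<Rightarrow> 'v::comm_monoid_add"
  assumes 0: "\<And>k. F k 0 = 0" and add: "\<And>k c d. F k (c + d) = F k c + F k d"
  shows "(\<Sum>k\<in>Poly_Mapping.keys (x + y). F k (Poly_Mapping.lookup (x + y) k)) =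
    (\<Sum>k\<in>Poly_Mapping.keys x. F k (Poly_Mapping.lookup x k)) + (\<Sum>k\<in>Poly_Mapping.keys y. F k (Poly_Mapping.lookup y k))"
proof -
  let ?K = "Poly_Mapping.keys x \<union> Poly_Mapping.keys y"
  have ext: "(\<Sum>k\<in>Poly_Mapping.keys z. F k (Poly_Mapping.lookup z k)) = (\<Sum>k\<in>?K. F k (Poly_Mapping.lookup z k))"
    if "Poly_Mapping.keys z \<subseteq> ?K" for z
    using that by (intro sum.mono_neutral_left) (auto simp: in_keys_iff 0)
  show ?thesis
    using Poly_Mapping.keys_add[of x y] by (subst (1 2 3) ext) (auto simp: lookup_add add sum.distrib)
qed

lemma free_star_add: "free_star (x + y) = free_star x + free_star y"
  unfolding free_star_def by (rule pm_sum_additive) (simp_all add: single_add)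

lemma free_star_single [simp]: "free_star (Poly_Mapping.single w c) = Poly_Mapping.single (word_star w) (cnj c)"
  by (cases "c = 0") (simp_all add: free_star_def)

lemma free_star_0 [simp]: "free_star 0 = 0"
  by (simp add: free_star_def)

lemma word_star_add: "word_star (u + v) = word_star v + word_star u"
  by (cases u; cases v) simp

lemma word_star_star [simp]: "word_star (word_star w) = w"
  by (cases w) (simp add: rev_map comp_def case_prod_beta)

lemma word_star_0 [simp]: "word_star 0 = 0"
  by (simp add: zero_word_def)

lemma free_star_star [simp]: "free_star (free_star x) = x"
  by (induction x rule: pm_induct) (simp_all add: free_star_add)

lemma free_star_scale: "free_star (pm_scale c x) = pm_scale (cnj c) (free_star x)"
  by (induction x rule: pm_induct) (simp_all add: free_star_add pm.scale_right_distrib)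

lemma pm_scale_mult_left: "pm_scale c (x::free_alg) * y = pm_scale c (x * y)"
proof (induction x rule: pm_induct)
  case (single k d)
  show ?case
    by (induction y rule: pm_induct) (simp_all add: mult_single pm.scale_right_distrib distrib_left mult.assoc)
qed (simp_all add: pm.scale_right_distrib distrib_right)

lemma pm_scale_mult_right: "(x::free_alg) * pm_scale c y = pm_scale c (x * y)"
proof (induction x rule: pm_induct)
  case (single k d)
  show ?case
    by (induction y rule: pm_induct) (simp_all add: mult_single pm.scale_right_distrib distrib_left mult.left_commute)
qed (simp_all add: pm.scale_right_distrib distrib_right)

lemma free_star_mult: "free_star (x * y) = free_star y * free_star x"
proof (induction x rule: pm_induct)
  case (single k d)
  show ?case
    by (induction y rule: pm_induct)
      (simp_all add: mult_single free_star_add distrib_left distrib_right word_star_add mult.commute)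
qed (simp_all add: free_star_add distrib_left distrib_right)

lemma free_star_1 [simp]: "free_star 1 = 1"
  by (simp add: single_one[symmetric] del: single_one)

lemma free_star_minus: "free_star (x - y) = free_star x - free_star y"
  using free_star_add[of "x - y" y] by simp

section \<open>The universal seminorm\<close>

context
  fixes p assumes p: "cstar_seminorm p"
begin

lemma cstar_triangle: "p (x + y) \<le> p x + p y"
  and cstar_scale: "p (pm_scale c x) = cmod c * p x"
  and cstar_mult: "p (x * y) \<le> p x * p y"
  and cstar_eq: "p (free_star x * x) = (p x)\<^sup>2"
  using p by (auto simp: cstar_seminorm_def)

lemma cstar_0: "p 0 = 0"
  using cstar_scale[of 0 0] by simp

lemma cstar_minus: "p (- x) = p x"
  using cstar_scale[of "-1" x] by simp

lemma cstar_nonneg: "0 \<le> p x"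
  using cstar_triangle[of x "- x"] by (simp add: cstar_0 cstar_minus)

lemma cstar_star: "p (free_star x) = p x"
proof -
  have le: "p y \<le> p (free_star y)" for y
  proof (cases "p y = 0")
    case False
    then have "0 < p y" using cstar_nonneg[of y] by linarith
    moreover have "p y * p y \<le> p (free_star y) * p y"
      using cstar_eq[of y] cstar_mult[of "free_star y" y] by (simp add: power2_eq_square)
    ultimately show ?thesis by simp
  qed (simp add: cstar_nonneg)
  show ?thesis using le[of x] le[of "free_star x"] by simp
qed

lemma cstar_one: "p 1 \<le> 1"
proof (rule ccontr)
  assume "\<not> p 1 \<le> 1"
  moreover have "p 1 = p 1 * p 1" using cstar_eq[of 1] by (simp add: power2_eq_square)
  ultimately show False by simp
qed

lemma cstar_eq_if_diff_0:
  assumes "p (x - y) = 0"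
  shows "p x = p y"
  using cstar_triangle[of "x - y" y] cstar_triangle[of "y - x" x] cstar_minus[of "x - y"] assms by simp

end

definition admissible :: "complex \<Rightarrow> (free_alg \<Rightarrow> real) set" where
  "admissible q = {p. cstar_seminorm p \<and> (\<forall>r\<in>relators q. p r = 0)}"

lemma univ_norm_SUP: "univ_norm q x = (SUP p\<in>admissible q. p x)"
  by (simp add: univ_norm_def admissible_def)

lemma zero_admissible: "(\<lambda>_. 0) \<in> admissible q"
  by (simp add: admissible_def cstar_seminorm_def)

definition gen_bound :: "complex \<Rightarrow> real" where
  "gen_bound q = 2 + 2 / (1 - (cmod q)\<^sup>2)"

lemma admissible_gen_bound:
  assumes q: "0 < cmod q" "cmod q < 1" and p: "p \<in> admissible q"
  shows "p (free_gen g) \<le> gen_bound q"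
proof -
  let ?a = "free_gen Gen_a" and ?b = "free_gen Gen_b" and ?D = "free_gen Gen_D"
  have cs: "cstar_seminorm p" using p by (simp add: admissible_def)
  note cs_facts = cstar_triangle[OF cs] cstar_eq[OF cs] cstar_star[OF cs] cstar_minus[OF cs] cstar_scale[OF cs]
  have sq: "p (free_star x * x) = (p x)\<^sup>2" "p (x * free_star x) = (p x)\<^sup>2" for x
    using cstar_eq[OF cs, of x] cstar_eq[OF cs, of "free_star x"] cstar_star[OF cs] by simp_all
  have q2: "(cmod q)\<^sup>2 < 1" using q by (simp add: power_less_one_iff)
  have r1: "p (?a * free_star ?a + ?b * free_star ?b - 1) = 0"
    and r2: "p (free_star ?a * ?a + pm_scale (of_real ((cmod q)\<^sup>2)) (free_star ?b * ?b) - 1) = 0"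
    and r3: "p (free_star ?D * ?D - 1) = 0"
    using p unfolding admissible_def relators_def Let_def by blast+
  have "(p ?b)\<^sup>2 \<le> p (?a * free_star ?a + ?b * free_star ?b) + p (- (?a * free_star ?a))"
    using cstar_triangle[OF cs, of "?a * free_star ?a + ?b * free_star ?b" "- (?a * free_star ?a)"] sq(2)[of ?b] by simp
  also have "\<dots> \<le> 1 + (p ?a)\<^sup>2"
    using cstar_eq_if_diff_0[OF cs r1] cstar_one[OF cs] sq(2)[of ?a] cstar_minus[OF cs] by simp
  finally have 1: "(p ?b)\<^sup>2 \<le> 1 + (p ?a)\<^sup>2" .
  have "(p ?a)\<^sup>2 \<le> p (free_star ?a * ?a + pm_scale (of_real ((cmod q)\<^sup>2)) (free_star ?b * ?b)) +
      p (- pm_scale (of_real ((cmod q)\<^sup>2)) (free_star ?b * ?b))"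
    using cstar_triangle[OF cs, of "free_star ?a * ?a + pm_scale (of_real ((cmod q)\<^sup>2)) (free_star ?b * ?b)"
      "- pm_scale (of_real ((cmod q)\<^sup>2)) (free_star ?b * ?b)"] sq(1)[of ?a] by simp
  also have "\<dots> \<le> 1 + (cmod q)\<^sup>2 * (p ?b)\<^sup>2"
    using cstar_eq_if_diff_0[OF cs r2] cstar_one[OF cs] sq(1)[of ?b]
    by (simp add: cstar_minus[OF cs] cstar_scale[OF cs] norm_power del: of_real_power)
  finally have 2: "(p ?a)\<^sup>2 \<le> 1 + (cmod q)\<^sup>2 * (p ?b)\<^sup>2" .
  have "(1 - (cmod q)\<^sup>2) * (p ?b)\<^sup>2 \<le> 2" using 1 2 by (simp add: algebra_simps)
  then have b: "(p ?b)\<^sup>2 \<le> 2 / (1 - (cmod q)\<^sup>2)" using q2 by (simp add: field_simps)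
  have "(cmod q)\<^sup>2 * (p ?b)\<^sup>2 \<le> (p ?b)\<^sup>2" using q2 by (simp add: mult_left_le_one_le)
  then have a: "(p ?a)\<^sup>2 \<le> 1 + 2 / (1 - (cmod q)\<^sup>2)" using 2 b by linarith
  have d: "(p ?D)\<^sup>2 \<le> 1" using cstar_eq_if_diff_0[OF cs r3] cstar_one[OF cs] sq(1)[of ?D] by simp
  have pos: "0 \<le> 2 / (1 - (cmod q)\<^sup>2)" using q2 by simp
  have "(p (free_gen g))\<^sup>2 \<le> 1 + 2 / (1 - (cmod q)\<^sup>2)"
  proof (cases g)
    case Gen_a with a show ?thesis by simp
  next
    case Gen_b with b show ?thesis by simp
  next
    case Gen_D show ?thesis unfolding Gen_D using d pos by linarith
  qed
  moreover have "p (free_gen g) \<le> 1 + (p (free_gen g))\<^sup>2"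
  proof -
    have "2 * p (free_gen g) \<le> (p (free_gen g))\<^sup>2 + 1"
      using zero_le_power2[of "p (free_gen g) - 1"] by (simp add: power2_diff)
    then show ?thesis using zero_le_power2[of "p (free_gen g)"] cstar_nonneg[OF cs, of "free_gen g"] by linarith
  qed
  ultimately show ?thesis by (simp add: gen_bound_def)
qed

lemma single_Word_Cons:
  "Poly_Mapping.single (Word ((g, s) # u)) (1::complex) =
     (if s then free_star (free_gen g) else free_gen g) * Poly_Mapping.single (Word u) 1"
  by (simp add: free_gen_def mult_single)

lemma admissible_word_bound:
  assumes q: "0 < cmod q" "cmod q < 1" and p: "p \<in> admissible q"
  shows "p (Poly_Mapping.single (Word u) 1) \<le> gen_bound q ^ length u"
proof -
  have cs: "cstar_seminorm p" using p by (simp add: admissible_def)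
  have "(cmod q)\<^sup>2 < 1" using q by (simp add: power_less_one_iff)
  then have K: "0 \<le> gen_bound q" by (simp add: gen_bound_def)
  show ?thesis
  proof (induction u)
    case Nil
    then show ?case using cstar_one[OF cs] by (simp add: zero_word_def[symmetric])
  next
    case (Cons x u)
    obtain g s where x: "x = (g, s)" by fastforce
    let ?y = "if s then free_star (free_gen g) else free_gen g"
    have "p (Poly_Mapping.single (Word (x # u)) 1) \<le> p ?y * p (Poly_Mapping.single (Word u) 1)"
      unfolding x single_Word_Cons by (rule cstar_mult[OF cs])
    also have "\<dots> \<le> gen_bound q * gen_bound q ^ length u"
      using Cons K admissible_gen_bound[OF q p, of g] cstar_star[OF cs] cstar_nonneg[OF cs]
      by (intro mult_mono) auto
    finally show ?case by simp
  qed
qed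

lemma admissible_bdd:
  assumes q: "0 < cmod q" "cmod q < 1"
  shows "bdd_above ((\<lambda>p. p x) ` admissible q)"
proof -
  have "\<exists>B. \<forall>p\<in>admissible q. p x \<le> B"
  proof (induction x rule: pm_induct)
    case zero
    show ?case by (intro exI[of _ 0] ballI) (simp add: admissible_def cstar_0)
  next
    case (single w c)
    obtain u where w: "w = Word u" by (cases w)
    have "p (Poly_Mapping.single w c) \<le> cmod c * gen_bound q ^ length u" if p: "p \<in> admissible q" for p
    proof -
      have cs: "cstar_seminorm p" using p by (simp add: admissible_def)
      have "p (Poly_Mapping.single w c) = cmod c * p (Poly_Mapping.single (Word u) 1)"
        using cstar_scale[OF cs, of c "Poly_Mapping.single w 1"] by (simp add: w)
      then show ?thesis using admissible_word_bound[OF q p, of u] by (simp add: mult_left_mono)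
    qed
    then show ?case by blast
  next
    case (add x y)
    then obtain B C where B: "\<forall>p\<in>admissible q. p x \<le> B" and C: "\<forall>p\<in>admissible q. p y \<le> C" by blast
    have "p (x + y) \<le> B + C" if "p \<in> admissible q" for p
      using cstar_triangle[of p x y] B C that by (fastforce simp: admissible_def)
    then show ?case by blast
  qed
  then show ?thesis by (auto simp: bdd_above_def)
qed

locale deformation_parameter =
  fixes q :: complex
  assumes q: "0 < cmod q" "cmod q < 1"
begin

lemma univ_norm_upper: "p \<in> admissible q \<Longrightarrow> p x \<le> univ_norm q x"
  unfolding univ_norm_SUP by (rule cSUP_upper[OF _ admissible_bdd[OF q]])

lemma univ_norm_least: "(\<And>p. p \<in> admissible q \<Longrightarrow> p x \<le> B) \<Longrightarrow> univ_norm q x \<le> B"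
  unfolding univ_norm_SUP by (rule cSUP_least) (use zero_admissible in blast)+

lemma univ_norm_nonneg: "0 \<le> univ_norm q x"
  using univ_norm_upper[OF zero_admissible] by simp

lemma univ_norm_triangle: "univ_norm q (x + y) \<le> univ_norm q x + univ_norm q y"
proof (rule univ_norm_least)
  fix p assume p: "p \<in> admissible q"
  then have "p (x + y) \<le> p x + p y" by (simp add: admissible_def cstar_triangle)
  also have "\<dots> \<le> univ_norm q x + univ_norm q y" by (intro add_mono univ_norm_upper p)
  finally show "p (x + y) \<le> univ_norm q x + univ_norm q y" .
qed

lemma univ_norm_mult: "univ_norm q (x * y) \<le> univ_norm q x * univ_norm q y"
proof (rule univ_norm_least)
  fix p assume p: "p \<in> admissible q"
  then have "p (x * y) \<le> p x * p y" by (simp add: admissible_def cstar_mult)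
  also have "\<dots> \<le> univ_norm q x * univ_norm q y"
    using p by (intro mult_mono univ_norm_upper univ_norm_nonneg) (simp_all add: admissible_def cstar_nonneg)
  finally show "p (x * y) \<le> univ_norm q x * univ_norm q y" .
qed

lemma univ_norm_scale_le: "univ_norm q (pm_scale c x) \<le> cmod c * univ_norm q x"
proof (rule univ_norm_least)
  fix p assume p: "p \<in> admissible q"
  then have "p (pm_scale c x) = cmod c * p x" by (simp add: admissible_def cstar_scale)
  also have "\<dots> \<le> cmod c * univ_norm q x" by (intro mult_left_mono univ_norm_upper p) simp
  finally show "p (pm_scale c x) \<le> cmod c * univ_norm q x" .
qed

lemma univ_norm_star: "univ_norm q (free_star x) = univ_norm q x"
  unfolding univ_norm_SUP by (intro SUP_cong refl) (simp add: admissible_def cstar_star)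

lemma univ_norm_relator: "r \<in> relators q \<Longrightarrow> univ_norm q r = 0"
  using univ_norm_nonneg[of r] by (intro antisym univ_norm_least) (auto simp: admissible_def)

lemma univ_norm_0 [simp]: "univ_norm q 0 = 0"
  using univ_norm_nonneg[of 0] by (intro antisym univ_norm_least) (auto simp: admissible_def cstar_0)

lemma univ_norm_minus: "univ_norm q (- x) = univ_norm q x"
  unfolding univ_norm_SUP by (intro SUP_cong refl) (simp add: admissible_def cstar_minus)

lemma univ_norm_minus_commute: "univ_norm q (x - y) = univ_norm q (y - x)"
  using univ_norm_minus[of "x - y"] by simp

section \<open>Classes of constant sequences\<close>

abbreviation tends :: "(nat \<Rightarrow> free_alg) \<Rightarrow> free_alg \<Rightarrow> bool" where
  "tends s x \<equiv> (\<lambda>n. univ_norm q (s n - x)) \<longlonglongrightarrow> 0"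

lemma tends_cauchy:
  assumes "tends s x"
  shows "s \<in> carrier (cauchy_alg q)"
proof -
  have "\<exists>N. \<forall>m\<ge>N. \<forall>n\<ge>N. univ_norm q (s m - s n) < e" if "e > 0" for e
  proof -
    have "eventually (\<lambda>n. univ_norm q (s n - x) < e / 2) sequentially"
      using assms that by (intro order_tendstoD(2)[of _ 0]) auto
    then obtain N where N: "\<And>n. n \<ge> N \<Longrightarrow> univ_norm q (s n - x) < e / 2"
      by (auto simp: eventually_sequentially)
    have "univ_norm q (s m - s n) < e" if "m \<ge> N" "n \<ge> N" for m n
      using univ_norm_triangle[of "s m - x" "x - s n"] N[OF that(1)] N[OF that(2)]
        univ_norm_minus_commute[of x "s n"] by simp
    then show ?thesis by blast
  qed
  then show ?thesis by (simp add: cauchy_alg_def)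
qed

lemma univ_norm_squeeze:
  assumes "\<And>n. univ_norm q (s n) \<le> f n" and "f \<longlonglongrightarrow> 0"
  shows "(\<lambda>n. univ_norm q (s n)) \<longlonglongrightarrow> 0"
  by (rule tendsto_sandwich[OF _ _ tendsto_const assms(2)])
    (simp_all add: univ_norm_nonneg assms(1))

lemma equiv_null_rel: "equiv (carrier (cauchy_alg q)) (null_rel q)"
proof (rule equivI)
  show "null_rel q \<subseteq> carrier (cauchy_alg q) \<times> carrier (cauchy_alg q)"
    by (auto simp: null_rel_def)
  show "refl_on (carrier (cauchy_alg q)) (null_rel q)"
    by (auto simp: refl_on_def null_rel_def)
  show "sym (null_rel q)"
    by (auto simp: sym_def null_rel_def univ_norm_minus_commute)
  show "trans (null_rel q)"
  proof (rule transI)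
    fix s t u assume st: "(s, t) \<in> null_rel q" and tu: "(t, u) \<in> null_rel q"
    have "(\<lambda>n. univ_norm q (s n - u n)) \<longlonglongrightarrow> 0"
    proof (rule univ_norm_squeeze)
      show "univ_norm q (s n - u n) \<le> univ_norm q (s n - t n) + univ_norm q (t n - u n)" for n
        using univ_norm_triangle[of "s n - t n" "t n - u n"] by simp
      show "(\<lambda>n. univ_norm q (s n - t n) + univ_norm q (t n - u n)) \<longlonglongrightarrow> 0"
        using tendsto_add[of _ 0 _ _ 0] st tu by (fastforce simp: null_rel_def)
    qed
    then show "(s, u) \<in> null_rel q" using st tu by (simp add: null_rel_def)
  qed
qed

definition cls :: "free_alg \<Rightarrow> uq2" where
  "cls x = null_rel q `` {\<lambda>_. x}"

lemma mem_cls: "s \<in> cls x \<longleftrightarrow> tends s x"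
  using tends_cauchy[of s x] tends_cauchy[of "\<lambda>_. x" x]
  by (auto simp: cls_def null_rel_def univ_norm_minus_commute[of x])

lemma cls_self: "(\<lambda>_. x) \<in> cls x"
  by (simp add: mem_cls)

lemma class_eq_cls: "tends s x \<Longrightarrow> null_rel q `` {s} = cls x"
  using equiv_class_eq[OF equiv_null_rel] mem_cls[of s x] by (auto simp: cls_def)

lemma cls_eq_iff: "cls x = cls y \<longleftrightarrow> univ_norm q (x - y) = 0"
proof
  assume "cls x = cls y"
  then have "(\<lambda>_. x) \<in> cls y" using cls_self[of x] by simp
  then show "univ_norm q (x - y) = 0" by (simp add: mem_cls LIMSEQ_const_iff)
next
  assume "univ_norm q (x - y) = 0"
  then have "tends (\<lambda>_. x) y" by simp
  then show "cls x = cls y" using class_eq_cls by (simp add: cls_def)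
qed

lemma UN_cls: "(\<And>s. s \<in> cls x \<Longrightarrow> F s = Y) \<Longrightarrow> (\<Union>s\<in>cls x. F s) = Y"
  using cls_self by blast

lemma tends_add:
  assumes "tends s x" "tends t y"
  shows "tends (\<lambda>n. s n + t n) (x + y)"
proof (rule univ_norm_squeeze)
  show "univ_norm q (s n + t n - (x + y)) \<le> univ_norm q (s n - x) + univ_norm q (t n - y)" for n
    using univ_norm_triangle[of "s n - x" "t n - y"] by (simp add: algebra_simps)
  show "(\<lambda>n. univ_norm q (s n - x) + univ_norm q (t n - y)) \<longlonglongrightarrow> 0"
    using tendsto_add[OF assms] by simp
qed

lemma tends_mult:
  assumes "tends s x" "tends t y"
  shows "tends (\<lambda>n. s n * t n) (x * y)"
proof (rule univ_norm_squeeze)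
  fix n
  have "s n * t n - x * y = (s n - x) * (t n - y) + ((s n - x) * y + x * (t n - y))"
    by (simp add: algebra_simps)
  then have "univ_norm q (s n * t n - x * y) \<le>
      univ_norm q ((s n - x) * (t n - y)) + (univ_norm q ((s n - x) * y) + univ_norm q (x * (t n - y)))"
    using univ_norm_triangle add_left_mono order_trans by metis
  also have "\<dots> \<le> univ_norm q (s n - x) * univ_norm q (t n - y) +
      (univ_norm q (s n - x) * univ_norm q y + univ_norm q x * univ_norm q (t n - y))"
    by (intro add_mono univ_norm_mult)
  finally show "univ_norm q (s n * t n - x * y) \<le> univ_norm q (s n - x) * univ_norm q (t n - y) +
      (univ_norm q (s n - x) * univ_norm q y + univ_norm q x * univ_norm q (t n - y))" .
next
  have "(\<lambda>n. univ_norm q (s n - x) * univ_norm q (t n - y) +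
      (univ_norm q (s n - x) * univ_norm q y + univ_norm q x * univ_norm q (t n - y))) \<longlonglongrightarrow>
      0 * 0 + (0 * univ_norm q y + univ_norm q x * 0)"
    by (intro tendsto_intros assms)
  then show "(\<lambda>n. univ_norm q (s n - x) * univ_norm q (t n - y) +
      (univ_norm q (s n - x) * univ_norm q y + univ_norm q x * univ_norm q (t n - y))) \<longlonglongrightarrow> 0"
    by simp
qed

lemma tends_scale:
  assumes "tends s x"
  shows "tends (\<lambda>n. pm_scale c (s n)) (pm_scale c x)"
proof (rule univ_norm_squeeze)
  show "univ_norm q (pm_scale c (s n) - pm_scale c x) \<le> cmod c * univ_norm q (s n - x)" for n
    using univ_norm_scale_le[of c "s n - x"] by (simp add: pm.scale_right_diff_distrib)
  show "(\<lambda>n. cmod c * univ_norm q (s n - x)) \<longlonglongrightarrow> 0"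
    using tendsto_mult_left[OF assms, of "cmod c"] by simp
qed

lemma tends_star: "tends s x \<Longrightarrow> tends (\<lambda>n. free_star (s n)) (free_star x)"
  by (simp add: free_star_minus[symmetric] univ_norm_star)

lemma C_ops:
  "monoid.mult (C_Uq2 q) (cls x) (cls y) = cls (x * y)"
  "add (C_Uq2 q) (cls x) (cls y) = cls (x + y)"
  "scale (C_Uq2 q) c (cls x) = cls (pm_scale c x)"
  "star (C_Uq2 q) (cls x) = cls (free_star x)"
  "one (C_Uq2 q) = cls 1"
  "zero (C_Uq2 q) = cls 0"
  unfolding C_Uq2_def quot_alg_def cauchy_alg_def
  by (simp_all add: cls_def[symmetric])
    (intro UN_cls class_eq_cls tends_mult tends_add tends_scale tends_star; simp add: mem_cls)+

abbreviation "OA \<equiv> O_Uq2 q"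

lemma O_ops [simp]:
  "cls x \<otimes>\<^bsub>OA\<^esub> cls y = cls (x * y)"
  "cls x \<oplus>\<^bsub>OA\<^esub> cls y = cls (x + y)"
  "scale OA c (cls x) = cls (pm_scale c x)"
  "star OA (cls x) = cls (free_star x)"
  "\<one>\<^bsub>OA\<^esub> = cls 1"
  "\<zero>\<^bsub>OA\<^esub> = cls 0"
  by (simp_all add: O_Uq2_def star_subalgebra_def C_ops)

lemma uq2_gen_cls: "uq2_gen q g = cls (free_gen g)"
  by (simp add: uq2_gen_def cls_def)

lemma carrier_O: "carrier OA = range cls"
proof -
  let ?G = "{uq2_gen q Gen_a, uq2_gen q Gen_b, uq2_gen q Gen_D}"
  let ?S = "star_generated (C_Uq2 q) ?G"
  have "x \<in> range cls" if "x \<in> ?S" for x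
    using that
  proof induction
    case (gen x) then show ?case by (auto simp: uq2_gen_cls)
  qed (auto simp: C_ops)
  moreover have "cls x \<in> ?S" for x
  proof (induction x rule: pm_induct)
    case zero
    show ?case using star_generated.scale[OF star_generated.one[of "C_Uq2 q" ?G], where c = 0] by (simp add: C_ops)
  next
    case (single w c)
    obtain u where w: "w = Word u" by (cases w)
    have gen: "cls (free_gen g) \<in> ?S" for g
      by (cases g) (auto simp: uq2_gen_cls intro: star_generated.gen)
    have "cls (Poly_Mapping.single (Word u) 1) \<in> ?S"
    proof (induction u)
      case Nil
      then show ?case using star_generated.one[of "C_Uq2 q" ?G] by (simp add: C_ops zero_word_def[symmetric])
    next
      case (Cons x u)
      obtain g s where x: "x = (g, s)" by fastforce
      have "cls (if s then free_star (free_gen g) else free_gen g) \<in> ?S"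
        using gen[of g] star_generated.star[OF gen[of g]] by (simp add: C_ops)
      from star_generated.mult[OF this Cons] show ?case
        unfolding x single_Word_Cons by (simp add: C_ops)
    qed
    from star_generated.scale[OF this, where c = c] show ?case by (simp add: C_ops w)
  next
    case (add x y)
    from star_generated.add[OF this] show ?case by (simp add: C_ops)
  qed
  ultimately show ?thesis by (auto simp: O_Uq2_def star_subalgebra_def)
qed

lemma cls_carrier [simp]: "cls x \<in> carrier OA"
  by (simp add: carrier_O)

lemma ring_O: "ring OA"
proof (rule ringI)
  show "abelian_group OA"
  proof (rule abelian_groupI)
    fix x assume "x \<in> carrier OA"
    then obtain y where "x = cls y" by (auto simp: carrier_O)
    then have "cls (- y) \<oplus>\<^bsub>OA\<^esub> x = \<zero>\<^bsub>OA\<^esub>" by simp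
    then show "\<exists>y\<in>carrier OA. y \<oplus>\<^bsub>OA\<^esub> x = \<zero>\<^bsub>OA\<^esub>" using cls_carrier by blast
  qed (auto simp: carrier_O add_ac)
  show "monoid OA"
    by (rule monoidI) (auto simp: carrier_O mult.assoc)
qed (auto simp: carrier_O algebra_simps)

sublocale O: ring OA
  by (rule ring_O)

lemma O_pow: "cls x [^]\<^bsub>OA\<^esub> (n::nat) = cls (x ^ n)"
  by (induction n) (simp_all add: power_commutes)

end

section \<open>Finitely supported functions\<close>

definition finsupp :: "('i \<Rightarrow> complex) \<Rightarrow> bool" where
  "finsupp v \<longleftrightarrow> finite {i. v i \<noteq> 0}"

definition ip :: "('i \<Rightarrow> complex) \<Rightarrow> ('i \<Rightarrow> complex) \<Rightarrow> complex" where
  "ip v w = (\<Sum>i\<in>{i. v i \<noteq> 0}. v i * cnj (w i))"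

definition vnorm :: "('i \<Rightarrow> complex) \<Rightarrow> real" where
  "vnorm v = L2_set (\<lambda>i. cmod (v i)) {i. v i \<noteq> 0}"

lemma ip_superset: "finite S \<Longrightarrow> {i. v i \<noteq> 0} \<subseteq> S \<Longrightarrow> ip v w = (\<Sum>i\<in>S. v i * cnj (w i))"
  unfolding ip_def by (rule sum.mono_neutral_left) auto

lemma ip_superset_right:
  assumes "finsupp v" "finite S" "{i. w i \<noteq> 0} \<subseteq> S"
  shows "ip v w = (\<Sum>i\<in>S. v i * cnj (w i))"
proof -
  have "ip v w = (\<Sum>i\<in>S \<union> {i. v i \<noteq> 0}. v i * cnj (w i))"
    using assms by (intro ip_superset) (auto simp: finsupp_def)
  also have "\<dots> = (\<Sum>i\<in>S. v i * cnj (w i))"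
    using assms by (intro sum.mono_neutral_right) (auto simp: finsupp_def)
  finally show ?thesis .
qed

lemma vnorm_superset: "finite S \<Longrightarrow> {i. v i \<noteq> 0} \<subseteq> S \<Longrightarrow> vnorm v = L2_set (\<lambda>i. cmod (v i)) S"
  unfolding vnorm_def L2_set_def by (intro arg_cong[of _ _ sqrt] sum.mono_neutral_left) auto

lemma finsupp_0 [simp]: "finsupp (\<lambda>_. 0)"
  by (simp add: finsupp_def)

lemma finsupp_add [simp]: "finsupp v \<Longrightarrow> finsupp w \<Longrightarrow> finsupp (\<lambda>i. v i + w i)"
  unfolding finsupp_def by (rule finite_subset[of _ "{i. v i \<noteq> 0} \<union> {i. w i \<noteq> 0}"]) auto

lemma finsupp_scale [simp]: "finsupp v \<Longrightarrow> finsupp (\<lambda>i. c * v i)"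
  unfolding finsupp_def by (rule finite_subset[of _ "{i. v i \<noteq> 0}"]) auto

lemma ip_add_left:
  assumes "finsupp v" "finsupp w"
  shows "ip (\<lambda>i. v i + w i) u = ip v u + ip w u"
proof -
  let ?S = "{i. v i \<noteq> 0} \<union> {i. w i \<noteq> 0}"
  have "finite ?S" using assms by (simp add: finsupp_def)
  then have "ip v u = (\<Sum>i\<in>?S. v i * cnj (u i))" "ip w u = (\<Sum>i\<in>?S. w i * cnj (u i))"
    "ip (\<lambda>i. v i + w i) u = (\<Sum>i\<in>?S. (v i + w i) * cnj (u i))"
    by (intro ip_superset; auto)+
  then show ?thesis by (simp only: distrib_right sum.distrib)
qed

lemma ip_scale_left: "ip (\<lambda>i. c * v i) w = c * ip v w"
  by (cases "c = 0") (simp_all add: ip_def sum_distrib_left mult.assoc)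

lemma ip_commute:
  assumes "finsupp v" "finsupp w"
  shows "ip w v = cnj (ip v w)"
  using ip_superset_right[OF assms(1), of "{i. w i \<noteq> 0}" w] assms(2)
  by (simp add: finsupp_def ip_def mult.commute)

lemma ip_add_right: "ip u (\<lambda>i. v i + w i) = ip u v + ip u w"
  by (simp add: ip_def sum.distrib algebra_simps)

lemma ip_scale_right: "ip v (\<lambda>i. c * w i) = cnj c * ip v w"
  by (simp add: ip_def sum_distrib_left algebra_simps)

lemma ip_self: "ip v v = of_real ((vnorm v)\<^sup>2)"
  by (simp add: ip_def vnorm_def L2_set_def sum_nonneg complex_norm_square[symmetric] del: of_real_power)

lemma vnorm_nonneg [simp]: "0 \<le> vnorm v"
  by (simp add: vnorm_def)

lemma vnorm_0 [simp]: "vnorm (\<lambda>_. 0) = 0"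
  by (simp add: vnorm_def)

lemma vnorm_eq_0: "finsupp v \<Longrightarrow> vnorm v = 0 \<Longrightarrow> v = (\<lambda>_. 0)"
  by (auto simp: vnorm_def L2_set_eq_0_iff finsupp_def fun_eq_iff)

lemma vnorm_triangle:
  assumes "finsupp v" "finsupp w"
  shows "vnorm (\<lambda>i. v i + w i) \<le> vnorm v + vnorm w"
proof -
  let ?S = "{i. v i \<noteq> 0} \<union> {i. w i \<noteq> 0}"
  have S: "finite ?S" using assms by (simp add: finsupp_def)
  have "vnorm (\<lambda>i. v i + w i) = L2_set (\<lambda>i. cmod (v i + w i)) ?S"
    using S by (intro vnorm_superset) auto
  also have "\<dots> \<le> L2_set (\<lambda>i. cmod (v i) + cmod (w i)) ?S"
    by (intro L2_set_mono norm_triangle_ineq) auto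
  also have "\<dots> \<le> L2_set (\<lambda>i. cmod (v i)) ?S + L2_set (\<lambda>i. cmod (w i)) ?S"
    by (rule L2_set_triangle_ineq)
  also have "\<dots> = vnorm v + vnorm w"
    using S vnorm_superset[of ?S v] vnorm_superset[of ?S w] by simp
  finally show ?thesis .
qed

lemma vnorm_scale: "vnorm (\<lambda>i. c * v i) = cmod c * vnorm v"
proof (cases "c = 0")
  case False
  then show ?thesis
    by (simp add: vnorm_def L2_set_def norm_mult power_mult_distrib sum_distrib_left[symmetric] real_sqrt_mult)
qed simp

lemma cauchy_schwarz:
  assumes "finsupp v" "finsupp w"
  shows "cmod (ip v w) \<le> vnorm v * vnorm w"
proof -
  let ?S = "{i. v i \<noteq> 0} \<union> {i. w i \<noteq> 0}"
  have S: "finite ?S" using assms by (simp add: finsupp_def)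
  have "cmod (ip v w) \<le> (\<Sum>i\<in>?S. \<bar>cmod (v i)\<bar> * \<bar>cmod (w i)\<bar>)"
    using S ip_superset[of ?S v w] norm_sum[of "\<lambda>i. v i * cnj (w i)" ?S] by (simp add: norm_mult)
  also have "\<dots> \<le> vnorm v * vnorm w"
    using S vnorm_superset[of ?S v] vnorm_superset[of ?S w] L2_set_mult_ineq[of "\<lambda>i. cmod (v i)" "\<lambda>i. cmod (w i)" ?S]
    by auto
  finally show ?thesis .
qed

lemma norm_le_vnorm:
  assumes "finsupp v"
  shows "cmod (v i) \<le> vnorm v"
proof (cases "v i = 0")
  case False
  then show ?thesis
    unfolding vnorm_def using assms by (intro member_le_L2_set) (auto simp: finsupp_def)
qed simp

section \<open>A representation of the relations\<close>

context deformation_parameter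
begin

definition phase :: complex where "phase = q\<^sup>2 / of_real ((cmod q)\<^sup>2)"

definition weight_a :: "nat \<Rightarrow> complex" where
  "weight_a k = of_real (sqrt (1 - ((cmod q)\<^sup>2) ^ Suc k))"

definition weight_b :: "nat \<Rightarrow> int \<Rightarrow> complex" where
  "weight_b k m = q ^ k * phase powi m"

lemma cmod_phase: "cmod phase = 1"
  using q by (simp add: phase_def norm_divide norm_power)

lemma phase_nonzero: "phase \<noteq> 0"
  using cmod_phase by auto

lemma weight_a_square: "weight_a k * weight_a k = 1 - of_real (((cmod q)\<^sup>2) ^ Suc k)"
proof -
  have "((cmod q)\<^sup>2) ^ Suc k < 1"
    using q by (intro power_Suc_less_one) (simp_all add: power_less_one_iff)
  then have "sqrt (1 - ((cmod q)\<^sup>2) ^ Suc k) * sqrt (1 - ((cmod q)\<^sup>2) ^ Suc k) = 1 - ((cmod q)\<^sup>2) ^ Suc k"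
    by simp
  then show ?thesis unfolding weight_a_def of_real_mult[symmetric] by simp
qed

lemma weight_a_nonzero: "weight_a k \<noteq> 0"
proof -
  have "((cmod q)\<^sup>2) ^ Suc k < 1"
    using q by (intro power_Suc_less_one) (simp_all add: power_less_one_iff)
  then show ?thesis by (simp add: weight_a_def)
qed

lemma cnj_weight_a: "cnj (weight_a k) = weight_a k"
  by (simp add: weight_a_def)

lemma weight_b_square: "weight_b k m * cnj (weight_b k m) = of_real (((cmod q)\<^sup>2) ^ k)"
proof -
  have "cmod (weight_b k m) = cmod q ^ k"
    by (simp add: weight_b_def norm_mult norm_power norm_power_int cmod_phase)
  then show ?thesis
    by (simp add: complex_norm_square[symmetric] power_mult[symmetric] mult.commute del: of_real_power)
qed

type_synonym vec = "nat \<times> int \<Rightarrow> complex"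

text \<open>\<open>a\<close> is a weighted shift of the first index, \<open>b\<close> is diagonal and \<open>D\<close> shifts the second index, with
  the phase in \<open>weight_b\<close> accounting for \<open>b D = q\<^sup>2 \<bar>q\<bar>\<^bsup>-2\<^esup> D b\<close>.\<close>

fun letter_op :: "generator \<times> bool \<Rightarrow> vec \<Rightarrow> vec" where
  "letter_op (Gen_a, False) v = (\<lambda>(k, m). case k of 0 \<Rightarrow> 0 | Suc l \<Rightarrow> weight_a l * v (l, m))"
| "letter_op (Gen_a, True) v = (\<lambda>(k, m). weight_a k * v (Suc k, m))"
| "letter_op (Gen_b, False) v = (\<lambda>(k, m). weight_b k m * v (k, m))"
| "letter_op (Gen_b, True) v = (\<lambda>(k, m). cnj (weight_b k m) * v (k, m))"
| "letter_op (Gen_D, False) v = (\<lambda>(k, m). v (k, m - 1))"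
| "letter_op (Gen_D, True) v = (\<lambda>(k, m). v (k, m + 1))"

lemma letter_cases [case_names a a' b b' D D']:
  fixes x :: "generator \<times> bool"
  obtains "x = (Gen_a, False)" | "x = (Gen_a, True)" | "x = (Gen_b, False)" | "x = (Gen_b, True)"
    | "x = (Gen_D, False)" | "x = (Gen_D, True)"
  by (cases x; cases "fst x"; cases "snd x") auto

lemma letter_op_add: "letter_op x (\<lambda>i. v i + w i) = (\<lambda>i. letter_op x v i + letter_op x w i)"
  by (cases x rule: letter_cases) (auto simp: fun_eq_iff algebra_simps split: nat.split)

lemma letter_op_scale: "letter_op x (\<lambda>i. c * v i) = (\<lambda>i. c * letter_op x v i)"
  by (cases x rule: letter_cases) (auto simp: fun_eq_iff split: nat.split)

lemma letter_op_finsupp: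
  assumes "finsupp v"
  shows "finsupp (letter_op x v)"
proof -
  have "{i. letter_op x v i \<noteq> 0} \<subseteq>
    (\<Union>(k, m)\<in>{i. v i \<noteq> 0}. {(k, m), (Suc k, m), (k - 1, m), (k, m + 1), (k, m - 1)})"
  proof
    fix i assume i: "i \<in> {i. letter_op x v i \<noteq> 0}"
    obtain k m where km: "i = (k, m)" by fastforce
    have "v (k, m) \<noteq> 0 \<or> v (Suc k, m) \<noteq> 0 \<or> (0 < k \<and> v (k - 1, m) \<noteq> 0) \<or> v (k, m + 1) \<noteq> 0 \<or> v (k, m - 1) \<noteq> 0"
      using i unfolding km by (cases x rule: letter_cases) (auto split: nat.splits)
    then show "i \<in> (\<Union>(k, m)\<in>{i. v i \<noteq> 0}. {(k, m), (Suc k, m), (k - 1, m), (k, m + 1), (k, m - 1)})"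
      unfolding km by (elim disjE) force+
  qed
  moreover have "finite (\<Union>(k, m)\<in>{i. v i \<noteq> 0}. {(k, m), (Suc k, m), (k - 1, m), (k, m + 1), (k, m - 1)})"
    using assms by (auto simp: finsupp_def)
  ultimately show ?thesis unfolding finsupp_def by (rule finite_subset)
qed

lemma letter_op_adjoint_False:
  assumes "finsupp v" "finsupp w"
  shows "ip (letter_op (g, False) v) w = ip v (letter_op (g, True) w)"
proof (cases g)
  case Gen_a
  let ?S = "{i. v i \<noteq> 0}" and ?f = "\<lambda>(k, m). (Suc k, m::int)"
  have "{i. letter_op (g, False) v i \<noteq> 0} \<subseteq> ?f ` ?S"
    by (auto simp: Gen_a image_iff split: nat.splits)
  then have "ip (letter_op (g, False) v) w = (\<Sum>i\<in>?f ` ?S. letter_op (g, False) v i * cnj (w i))"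
    using assms(1) by (intro ip_superset) (auto simp: finsupp_def)
  also have "\<dots> = (\<Sum>i\<in>?S. letter_op (g, False) v (?f i) * cnj (w (?f i)))"
    by (subst sum.reindex) (auto simp: inj_on_def)
  also have "\<dots> = ip v (letter_op (g, True) w)"
    unfolding ip_def by (intro sum.cong) (auto simp: Gen_a cnj_weight_a)
  finally show ?thesis .
next
  case Gen_b
  have "ip (letter_op (g, False) v) w = (\<Sum>i\<in>{i. v i \<noteq> 0}. letter_op (g, False) v i * cnj (w i))"
    using assms(1) by (intro ip_superset) (auto simp: finsupp_def Gen_b)
  also have "\<dots> = ip v (letter_op (g, True) w)"
    unfolding ip_def by (intro sum.cong) (auto simp: Gen_b)
  finally show ?thesis .
next
  case Gen_D
  let ?S = "{i. v i \<noteq> 0}" and ?f = "\<lambda>(k, m). (k::nat, m + 1::int)"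
  have "i \<in> ?f ` ?S" if "letter_op (g, False) v i \<noteq> 0" for i
    using that by (cases i) (auto simp: Gen_D intro!: image_eqI[of _ _ "(fst i, snd i - 1)"])
  then have "ip (letter_op (g, False) v) w = (\<Sum>i\<in>?f ` ?S. letter_op (g, False) v i * cnj (w i))"
    using assms(1) by (intro ip_superset) (auto simp: finsupp_def)
  also have "\<dots> = (\<Sum>i\<in>?S. letter_op (g, False) v (?f i) * cnj (w (?f i)))"
    by (subst sum.reindex) (auto simp: inj_on_def)
  also have "\<dots> = ip v (letter_op (g, True) w)"
    unfolding ip_def by (intro sum.cong) (auto simp: Gen_D)
  finally show ?thesis .
qed

lemma letter_op_adjoint:
  assumes "finsupp v" "finsupp w"
  shows "ip (letter_op (g, s) v) w = ip v (letter_op (g, \<not> s) w)"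
proof (cases s)
  case True
  have "ip (letter_op (g, True) v) w = cnj (ip w (letter_op (g, True) v))"
    by (intro ip_commute assms letter_op_finsupp)
  also have "\<dots> = cnj (ip (letter_op (g, False) w) v)"
    by (simp add: letter_op_adjoint_False assms)
  also have "\<dots> = ip v (letter_op (g, False) w)"
    by (intro ip_commute[symmetric] assms letter_op_finsupp)
  finally show ?thesis using True by simp
qed (simp add: letter_op_adjoint_False assms)

fun word_op :: "(generator \<times> bool) list \<Rightarrow> vec \<Rightarrow> vec" where
  "word_op [] v = v"
| "word_op (x # u) v = letter_op x (word_op u v)"

lemma word_op_append: "word_op (u @ w) v = word_op u (word_op w v)"
  by (induction u) simp_all

lemma word_op_add: "word_op u (\<lambda>i. v i + w i) = (\<lambda>i. word_op u v i + word_op u w i)"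
  by (induction u) (simp_all add: letter_op_add)

lemma word_op_scale: "word_op u (\<lambda>i. c * v i) = (\<lambda>i. c * word_op u v i)"
  by (induction u) (simp_all add: letter_op_scale)

lemma word_op_finsupp: "finsupp v \<Longrightarrow> finsupp (word_op u v)"
  by (induction u) (simp_all add: letter_op_finsupp)

lemma word_op_adjoint:
  assumes "finsupp v" "finsupp w"
  shows "ip (word_op u v) w = ip v (word_op (rev (map (\<lambda>(g, s). (g, \<not> s)) u)) w)"
  using assms(2)
proof (induction u arbitrary: w)
  case (Cons x u)
  obtain g s where x: "x = (g, s)" by fastforce
  show ?case
    using letter_op_adjoint[OF word_op_finsupp[OF assms(1), of u] Cons.prems, of g s]
      Cons.IH[OF letter_op_finsupp[OF Cons.prems, of "(g, \<not> s)"]]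
    by (simp add: x word_op_append)
qed simp

fun un_word :: "word \<Rightarrow> (generator \<times> bool) list" where
  "un_word (Word u) = u"

definition rep :: "free_alg \<Rightarrow> vec \<Rightarrow> vec" where
  "rep x v i = (\<Sum>w\<in>Poly_Mapping.keys x. Poly_Mapping.lookup x w * word_op (un_word w) v i)"

lemma rep_add: "rep (x + y) v = (\<lambda>i. rep x v i + rep y v i)"
  unfolding rep_def by (intro ext pm_sum_additive) (simp_all add: distrib_right)

lemma rep_0 [simp]: "rep 0 v = (\<lambda>_. 0)"
  by (simp add: rep_def fun_eq_iff)

lemma rep_single [simp]: "rep (Poly_Mapping.single (Word u) c) v = (\<lambda>i. c * word_op u v i)"
  by (cases "c = 0") (simp_all add: rep_def fun_eq_iff)

lemma word_cases_induct [case_names zero single add]: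
  fixes x :: free_alg
  assumes "P 0" and "\<And>u c. P (Poly_Mapping.single (Word u) c)" and "\<And>x y. P x \<Longrightarrow> P y \<Longrightarrow> P (x + y)"
  shows "P x"
proof (induction x rule: pm_induct)
  case (single w c)
  then show ?case using assms(2) by (cases w) simp
qed (auto intro: assms)

lemma rep_scale: "rep (pm_scale c x) v = (\<lambda>i. c * rep x v i)"
  by (induction x rule: word_cases_induct) (simp_all add: rep_add pm.scale_right_distrib algebra_simps)

lemma rep_diff: "rep (x - y) v = (\<lambda>i. rep x v i - rep y v i)"
  using rep_add[of "x - y" y v] by (simp add: fun_eq_iff)

lemma rep_vec_scale: "rep x (\<lambda>i. c * v i) = (\<lambda>i. c * rep x v i)"
  by (induction x rule: word_cases_induct) (simp_all add: rep_add word_op_scale algebra_simps)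

lemma rep_finsupp: "finsupp v \<Longrightarrow> finsupp (rep x v)"
  by (induction x rule: word_cases_induct) (simp_all add: rep_add word_op_finsupp)

lemma rep_mult: "rep (x * y) v = rep x (rep y v)"
proof (induction x rule: word_cases_induct)
  case (single u c)
  show ?case
    by (induction y rule: word_cases_induct)
      (simp_all add: mult_single distrib_left rep_add word_op_append word_op_scale word_op_add
        fun_eq_iff algebra_simps word_op_scale[of _ 0, simplified])
qed (simp_all add: distrib_right rep_add)

lemma rep_one: "rep 1 v = v"
  using rep_single[of "[]" 1 v] by (simp add: zero_word_def[symmetric])

lemma rep_adjoint:
  assumes "finsupp v" "finsupp w"
  shows "ip (rep x v) w = ip v (rep (free_star x) w)"
proof (induction x rule: word_cases_induct)
  case zero
  show ?case by (simp add: ip_def)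
next
  case (single u c)
  show ?case by (simp add: ip_scale_left ip_scale_right word_op_adjoint[OF assms])
next
  case (add x y)
  then show ?case
    using assms by (simp add: rep_add free_star_add ip_add_left ip_add_right rep_finsupp)
qed

lemma rep_relator:
  assumes "r \<in> relators q"
  shows "rep r v = (\<lambda>_. 0)"
proof -
  let ?a = "free_gen Gen_a" and ?b = "free_gen Gen_b" and ?D = "free_gen Gen_D"
  have gens: "rep (free_gen g) v = letter_op (g, False) v"
    "rep (free_star (free_gen g)) v = letter_op (g, True) v" for g v
    by (simp_all add: free_gen_def)
  have theta: "phase * (weight_b k (m - 1) * z) = weight_b k m * z" for k m z
    using phase_nonzero by (simp add: weight_b_def power_int_diff)
  have q2: "of_real ((cmod q)\<^sup>2) = q * cnj q"
    using complex_norm_square[of q] by simp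
  show ?thesis
    using assms unfolding relators_def Let_def phase_def[symmetric]
  proof (elim insertE emptyE; hypsubst)
    show "rep (?b * ?D - pm_scale phase (?D * ?b)) v = (\<lambda>_. 0)"
      by (auto simp: rep_diff rep_add rep_scale rep_mult gens fun_eq_iff theta)
    show "rep (?a * free_star ?a + ?b * free_star ?b - 1) v = (\<lambda>_. 0)"
    proof
      fix i show "rep (?a * free_star ?a + ?b * free_star ?b - 1) v i = 0"
      proof (cases i)
        case (Pair k m)
        have "rep (?a * free_star ?a + ?b * free_star ?b - 1) v i =
            ((case k of 0 \<Rightarrow> 0 | Suc l \<Rightarrow> weight_a l * weight_a l) + weight_b k m * cnj (weight_b k m) - 1) * v i"
          by (simp add: rep_diff rep_add rep_mult rep_one gens Pair algebra_simps split: nat.split)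
        then show ?thesis unfolding weight_b_square by (simp add: weight_a_square split: nat.split)
      qed
    qed
    show "rep (free_star ?a * ?a +
        pm_scale (of_real ((cmod q)\<^sup>2)) (free_star ?b * ?b) - 1) v = (\<lambda>_. 0)"
    proof
      fix i show "rep (free_star ?a * ?a +
        pm_scale (of_real ((cmod q)\<^sup>2)) (free_star ?b * ?b) - 1) v i = 0"
      proof (cases i)
        case (Pair k m)
        have "rep (free_star ?a * ?a +
            pm_scale (of_real ((cmod q)\<^sup>2)) (free_star ?b * ?b) - 1) v i =
            (weight_a k * weight_a k + of_real ((cmod q)\<^sup>2) * (weight_b k m * cnj (weight_b k m)) - 1) * v i"
          by (simp add: rep_diff rep_add rep_scale rep_mult rep_one gens Pair algebra_simps)
        then show ?thesis unfolding weight_b_square weight_a_square by simp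
      qed
    qed
  qed (auto simp: rep_diff rep_add rep_scale rep_mult rep_one gens fun_eq_iff weight_b_def split: nat.split)
qed

lemma rep_gen:
  "rep (free_gen g) v = letter_op (g, False) v"
  "rep (free_star (free_gen g)) v = letter_op (g, True) v"
  by (simp_all add: free_gen_def)

lemma vnorm_rep_square:
  assumes "finsupp v"
  shows "of_real ((vnorm (rep y v))\<^sup>2) = ip v (rep (free_star y * y) v)"
  using rep_adjoint[OF assms rep_finsupp[OF assms, of y], of y]
  by (simp add: ip_self[symmetric] rep_mult del: of_real_power)

lemma vnorm_rep_square':
  assumes "finsupp v"
  shows "(vnorm (rep y v))\<^sup>2 = cmod (ip v (rep (free_star y * y) v))"
  unfolding vnorm_rep_square[OF assms, symmetric] norm_of_real by simp

lemma rep_relation: "x - y \<in> relators q \<Longrightarrow> rep x v = rep y v"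
  using rep_relator[of "x - y" v] by (simp add: rep_diff fun_eq_iff)

lemma letter_op_contractive:
  assumes v: "finsupp v"
  shows "vnorm (letter_op x v) \<le> vnorm v"
proof -
  let ?a = "free_gen Gen_a" and ?b = "free_gen Gen_b" and ?D = "free_gen Gen_D"
  note relations = relators_def Let_def
  have "ip v (rep (?a * free_star ?a + ?b * free_star ?b) v) = ip v v"
    by (subst rep_relation[of _ 1]) (simp_all add: relations rep_one)
  then have "of_real ((vnorm (rep (free_star ?a) v))\<^sup>2 + (vnorm (rep (free_star ?b) v))\<^sup>2) = (of_real ((vnorm v)\<^sup>2) :: complex)"
    using vnorm_rep_square[OF v, of "free_star ?a"] vnorm_rep_square[OF v, of "free_star ?b"]
    by (simp add: rep_add ip_add_right ip_self del: of_real_power)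
  then have 1: "(vnorm (rep (free_star ?a) v))\<^sup>2 + (vnorm (rep (free_star ?b) v))\<^sup>2 = (vnorm v)\<^sup>2"
    by (simp only: of_real_eq_iff)
  have "ip v (rep (free_star ?a * ?a + pm_scale (of_real ((cmod q)\<^sup>2)) (free_star ?b * ?b)) v) = ip v v"
    by (subst rep_relation[of _ 1]) (simp_all add: relations rep_one)
  then have "of_real ((vnorm (rep ?a v))\<^sup>2 + (cmod q)\<^sup>2 * (vnorm (rep ?b v))\<^sup>2) = (of_real ((vnorm v)\<^sup>2) :: complex)"
    using vnorm_rep_square[OF v, of ?a] vnorm_rep_square[OF v, of ?b]
    by (simp add: rep_add rep_scale ip_add_right ip_scale_right ip_self del: of_real_power)
  then have 2: "(vnorm (rep ?a v))\<^sup>2 + (cmod q)\<^sup>2 * (vnorm (rep ?b v))\<^sup>2 = (vnorm v)\<^sup>2"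
    by (simp only: of_real_eq_iff)
  have "ip v (rep (?b * free_star ?b) v) = ip v (rep (free_star ?b * ?b) v)"
    by (subst rep_relation[of _ "free_star ?b * ?b"]) (simp_all add: relations)
  then have "of_real ((vnorm (rep ?b v))\<^sup>2) = (of_real ((vnorm (rep (free_star ?b) v))\<^sup>2) :: complex)"
    using vnorm_rep_square[OF v, of "free_star ?b"] vnorm_rep_square[OF v, of ?b] by simp
  then have 3: "(vnorm (rep ?b v))\<^sup>2 = (vnorm (rep (free_star ?b) v))\<^sup>2"
    by (simp only: of_real_eq_iff)
  have "ip v (rep (free_star ?D * ?D) v) = ip v v" "ip v (rep (?D * free_star ?D) v) = ip v v"
    by (subst rep_relation[of _ 1]; simp add: relations rep_one)+
  then have "of_real ((vnorm (rep ?D v))\<^sup>2) = (of_real ((vnorm v)\<^sup>2) :: complex)"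
    "of_real ((vnorm (rep (free_star ?D) v))\<^sup>2) = (of_real ((vnorm v)\<^sup>2) :: complex)"
    using vnorm_rep_square[OF v, of "free_star ?D"] vnorm_rep_square[OF v, of ?D] by (simp_all add: ip_self)
  then have 4: "(vnorm (rep ?D v))\<^sup>2 = (vnorm v)\<^sup>2" "(vnorm (rep (free_star ?D) v))\<^sup>2 = (vnorm v)\<^sup>2"
    by (simp_all only: of_real_eq_iff)
  obtain g s where x: "x = (g, s)" by fastforce
  have eq: "letter_op x v = rep (if s then free_star (free_gen g) else free_gen g) v"
    by (simp add: x rep_gen)
  have "(vnorm (letter_op x v))\<^sup>2 \<le> (vnorm v)\<^sup>2"
  proof (cases g)
    case Gen_a
    have "0 \<le> (cmod q)\<^sup>2 * (vnorm (rep ?b v))\<^sup>2" by simp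
    then show ?thesis
      using 1 2 zero_le_power2[of "vnorm (rep (free_star ?b) v)"] unfolding eq Gen_a by (cases s; simp only: if_True if_False simp_thms; linarith)
  next
    case Gen_b
    show ?thesis
      using 1 3 zero_le_power2[of "vnorm (rep (free_star ?a) v)"] unfolding eq Gen_b by (cases s; simp only: if_True if_False simp_thms; linarith)
  next
    case Gen_D
    show ?thesis using 4 unfolding eq Gen_D by (cases s; simp only: if_True if_False simp_thms; linarith)
  qed
  then show ?thesis by (rule power2_le_imp_le) simp
qed

lemma word_op_contractive: "finsupp v \<Longrightarrow> vnorm (word_op u v) \<le> vnorm v"
  by (induction u) (auto intro: order_trans letter_op_contractive word_op_finsupp)

lemma rep_bounded: "\<exists>C\<ge>0. \<forall>v. finsupp v \<longrightarrow> vnorm (rep x v) \<le> C * vnorm v"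
proof (induction x rule: word_cases_induct)
  case zero
  show ?case by (intro exI[of _ 0]) simp
next
  case (single u c)
  show ?case
    by (intro exI[of _ "cmod c"]) (simp add: vnorm_scale word_op_contractive mult_left_mono)
next
  case (add x y)
  then obtain B C where "B \<ge> 0" "C \<ge> 0"
    and B: "\<And>v. finsupp v \<Longrightarrow> vnorm (rep x v) \<le> B * vnorm v"
    and C: "\<And>v. finsupp v \<Longrightarrow> vnorm (rep y v) \<le> C * vnorm v" by blast
  have "vnorm (rep (x + y) v) \<le> (B + C) * vnorm v" if v: "finsupp v" for v :: vec
    using vnorm_triangle[OF rep_finsupp[OF v] rep_finsupp[OF v], of x y] B[OF v] C[OF v]
    by (simp add: rep_add distrib_right)
  then show ?case using \<open>B \<ge> 0\<close> \<open>C \<ge> 0\<close> by (intro exI[of _ "B + C"]) simp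
qed

definition opnorm :: "free_alg \<Rightarrow> real" where
  "opnorm x = (SUP v\<in>{v. finsupp v \<and> vnorm v \<le> 1}. vnorm (rep x v))"

lemma opnorm_least:
  assumes "\<And>v. finsupp v \<Longrightarrow> vnorm (rep x v) \<le> B * vnorm v" and "0 \<le> B"
  shows "opnorm x \<le> B"
  unfolding opnorm_def
proof (rule cSUP_least)
  have "(\<lambda>_. 0) \<in> {v :: vec. finsupp v \<and> vnorm v \<le> 1}" by simp
  then show "{v :: vec. finsupp v \<and> vnorm v \<le> 1} \<noteq> {}" by blast
  fix v :: vec assume "v \<in> {v. finsupp v \<and> vnorm v \<le> 1}"
  then show "vnorm (rep x v) \<le> B"
    using assms(1)[of v] mult_left_le[OF _ assms(2), of "vnorm v"] by simp
qed

lemma opnorm_bdd: "bdd_above ((\<lambda>v. vnorm (rep x v)) ` {v. finsupp v \<and> vnorm v \<le> 1})"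
proof -
  obtain C where C: "C \<ge> 0" "\<And>v :: vec. finsupp v \<Longrightarrow> vnorm (rep x v) \<le> C * vnorm v" using rep_bounded by blast
  have "vnorm (rep x v) \<le> C" if "finsupp v" "vnorm v \<le> 1" for v :: vec
    using C(2)[OF that(1)] mult_left_le[OF that(2) C(1)] by simp
  then show ?thesis by (intro bdd_aboveI2[of _ _ C]) simp
qed

lemma opnorm_bound:
  assumes v: "finsupp v"
  shows "vnorm (rep x v) \<le> opnorm x * vnorm v"
proof (cases "vnorm v = 0")
  case True
  then show ?thesis using vnorm_eq_0[OF v] rep_vec_scale[of x 0 v] by simp
next
  case False
  define c where "c = (1 / of_real (vnorm v) :: complex)"
  have c: "cmod c = 1 / vnorm v" by (simp add: c_def norm_divide)
  have "vnorm (rep x (\<lambda>i. c * v i)) \<le> opnorm x"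
    unfolding opnorm_def using v False by (intro cSUP_upper opnorm_bdd) (simp add: vnorm_scale c)
  then have "vnorm (rep x v) / vnorm v \<le> opnorm x"
    by (simp add: rep_vec_scale vnorm_scale c)
  moreover have "0 < vnorm v" using False vnorm_nonneg[of v] by linarith
  ultimately show ?thesis by (simp add: divide_le_eq)
qed

lemma opnorm_nonneg: "0 \<le> opnorm x"
proof -
  have "vnorm (rep x (\<lambda>_. 0)) \<le> opnorm x"
    unfolding opnorm_def by (intro cSUP_upper opnorm_bdd) simp
  then show ?thesis using vnorm_nonneg order_trans by blast
qed

lemma opnorm_star_le: "opnorm (free_star x) \<le> opnorm x"
proof (rule opnorm_least[OF _ opnorm_nonneg])
  fix v :: vec assume v: "finsupp v"
  let ?w = "rep (free_star x) v"
  have w: "finsupp ?w" using v by (rule rep_finsupp)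
  have "(vnorm ?w)\<^sup>2 = cmod (ip v (rep x ?w))"
    using vnorm_rep_square'[OF v, of "free_star x"] by (simp add: rep_mult)
  also have "\<dots> \<le> vnorm v * vnorm (rep x ?w)"
    by (intro cauchy_schwarz v rep_finsupp w)
  also have "\<dots> \<le> vnorm v * (opnorm x * vnorm ?w)"
    by (intro mult_left_mono opnorm_bound w) simp
  finally have "vnorm ?w * vnorm ?w \<le> (opnorm x * vnorm v) * vnorm ?w"
    by (simp add: power2_eq_square algebra_simps)
  then show "vnorm ?w \<le> opnorm x * vnorm v"
    using opnorm_nonneg[of x] vnorm_nonneg[of v] vnorm_nonneg[of ?w]
    by (cases "vnorm ?w = 0") (auto simp: mult_nonneg_nonneg)
qed

lemma opnorm_mult: "opnorm (x * y) \<le> opnorm x * opnorm y"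
proof (rule opnorm_least)
  fix v :: vec assume v: "finsupp v"
  have "vnorm (rep (x * y) v) \<le> opnorm x * vnorm (rep y v)"
    unfolding rep_mult by (intro opnorm_bound rep_finsupp v)
  also have "\<dots> \<le> opnorm x * (opnorm y * vnorm v)"
    by (intro mult_left_mono opnorm_bound v opnorm_nonneg)
  finally show "vnorm (rep (x * y) v) \<le> opnorm x * opnorm y * vnorm v" by (simp add: mult.assoc)
qed (simp add: opnorm_nonneg)

lemma opnorm_scale_le: "opnorm (pm_scale c x) \<le> cmod c * opnorm x"
  using opnorm_bound opnorm_nonneg by (intro opnorm_least) (simp_all add: rep_scale vnorm_scale mult.assoc mult_left_mono)

lemma opnorm_square: "(opnorm x)\<^sup>2 \<le> opnorm (free_star x * x)"
proof -
  have "opnorm x \<le> sqrt (opnorm (free_star x * x))"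
  proof (rule opnorm_least)
    fix v :: vec assume v: "finsupp v"
    have "(vnorm (rep x v))\<^sup>2 = cmod (ip v (rep (free_star x * x) v))"
      by (rule vnorm_rep_square'[OF v])
    also have "\<dots> \<le> vnorm v * (opnorm (free_star x * x) * vnorm v)"
      using cauchy_schwarz[OF v rep_finsupp[OF v]] mult_left_mono[OF opnorm_bound[OF v]] vnorm_nonneg order_trans by blast
    also have "\<dots> = (sqrt (opnorm (free_star x * x)) * vnorm v)\<^sup>2"
      by (simp add: power_mult_distrib opnorm_nonneg) (simp add: power2_eq_square)
    finally show "vnorm (rep x v) \<le> sqrt (opnorm (free_star x * x)) * vnorm v"
      by (rule power2_le_imp_le) (simp add: opnorm_nonneg)
  qed (simp add: opnorm_nonneg)
  then show ?thesis using opnorm_nonneg by (metis power_mono real_sqrt_pow2)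
qed

lemma opnorm_admissible: "opnorm \<in> admissible q"
proof -
  have "opnorm (x + y) \<le> opnorm x + opnorm y" for x y
  proof (rule opnorm_least)
    fix v :: vec assume v: "finsupp v"
    show "vnorm (rep (x + y) v) \<le> (opnorm x + opnorm y) * vnorm v"
      using vnorm_triangle[OF rep_finsupp[OF v] rep_finsupp[OF v], of x y] opnorm_bound[OF v, of x] opnorm_bound[OF v, of y]
      by (simp add: rep_add distrib_right)
  qed (simp add: opnorm_nonneg)
  moreover have "opnorm (pm_scale c x) = cmod c * opnorm x" for c x
  proof (cases "c = 0")
    case True
    then show ?thesis using opnorm_scale_le[of c x] opnorm_nonneg[of "pm_scale c x"] by simp
  next
    case False
    then have "opnorm x \<le> inverse (cmod c) * opnorm (pm_scale c x)"
      using opnorm_scale_le[of "inverse c" "pm_scale c x"] by (simp add: norm_inverse)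
    then have "cmod c * opnorm x \<le> opnorm (pm_scale c x)"
      using False by (simp add: field_simps)
    then show ?thesis using opnorm_scale_le[of c x] by simp
  qed
  moreover have "opnorm (free_star x * x) = (opnorm x)\<^sup>2" for x
    using opnorm_square[of x] order_trans[OF opnorm_mult[of "free_star x" x] mult_right_mono[OF opnorm_star_le opnorm_nonneg]]
    by (simp add: power2_eq_square)
  moreover have "opnorm r = 0" if "r \<in> relators q" for r
    using opnorm_least[of r 0] opnorm_nonneg[of r] rep_relator[OF that] by simp
  ultimately show ?thesis by (simp add: admissible_def cstar_seminorm_def opnorm_mult)
qed

text \<open>Matrix coefficients at the vacuum vector: these functionals separate the monomials
  \<open>a\<^sup>i b\<^sup>j\<close> of a fixed degree.\<close>

definition vacuum :: vec where
  "vacuum i = (if i = (0, 0) then 1 else 0)"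

definition coefficient :: "nat \<Rightarrow> free_alg \<Rightarrow> complex" where
  "coefficient k x = rep x vacuum (k, 0)"

lemma finsupp_vacuum: "finsupp vacuum"
  by (simp add: finsupp_def vacuum_def)

lemma coefficient_null:
  assumes "univ_norm q x = 0"
  shows "coefficient k x = 0"
proof -
  have "cmod (coefficient k x) \<le> opnorm x * vnorm vacuum"
    unfolding coefficient_def
    using norm_le_vnorm[OF rep_finsupp[OF finsupp_vacuum]] opnorm_bound[OF finsupp_vacuum] order_trans by blast
  moreover have "opnorm x = 0"
    using univ_norm_upper[OF opnorm_admissible, of x] opnorm_nonneg[of x] assms by simp
  ultimately show ?thesis by simp
qed

lemma coefficient_add: "coefficient k (x + y) = coefficient k x + coefficient k y"
  by (simp add: coefficient_def rep_add)

lemma coefficient_scale: "coefficient k (pm_scale c x) = c * coefficient k x"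
  by (simp add: coefficient_def rep_scale)

lemma rep_b_vacuum: "rep (free_gen Gen_b ^ n) vacuum = vacuum"
proof (induction n)
  case (Suc n)
  then show ?case
    by (auto simp: rep_mult rep_gen fun_eq_iff vacuum_def weight_b_def)
qed (simp add: rep_one)

lemma rep_a_vacuum:
  "rep (free_gen Gen_a ^ n) vacuum = (\<lambda>i. if i = (n, 0) then \<Prod>k<n. weight_a k else 0)"
proof (induction n)
  case 0
  then show ?case by (auto simp: rep_one fun_eq_iff vacuum_def)
next
  case (Suc n)
  then show ?case
    by (auto simp: rep_mult rep_gen fun_eq_iff split: nat.split)
qed

lemma coefficient_monomial:
  "coefficient k (free_gen Gen_a ^ i * free_gen Gen_b ^ j) = (if k = i then \<Prod>l<i. weight_a l else 0)"
  by (simp add: coefficient_def rep_mult rep_a_vacuum rep_b_vacuum)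

lemma univ_norm_one: "univ_norm q 1 \<noteq> 0"
  using coefficient_null[of 1 0] coefficient_monomial[of 0 0 0] by auto

end

lemma deformation_parameter_half: "deformation_parameter (1 / 2)"
  by standard (simp_all add: norm_divide)

section \<open>Sections over the parameter disc\<close>

text \<open>The algebras \<open>O_Uq2 q\<close> live on carriers inside one fixed type. To calculate in a type of
  class \<open>ring_1\<close>, they are collected into the product of all of them over \<open>0 < \<bar>q\<bar> < 1\<close>, and
  identities are evaluated at a single parameter.\<close>

definition section_eq :: "(complex \<Rightarrow> free_alg) \<Rightarrow> (complex \<Rightarrow> free_alg) \<Rightarrow> bool" where
  "section_eq f g \<longleftrightarrow> (\<forall>q. deformation_parameter q \<longrightarrow> univ_norm q (f q - g q) = 0)"

lemma (in deformation_parameter) null_add: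
  assumes "univ_norm q x = 0" "univ_norm q y = 0"
  shows "univ_norm q (x + y) = 0"
  using univ_norm_triangle[of x y] univ_norm_nonneg[of "x + y"] assms by simp

lemma (in deformation_parameter) null_mult:
  assumes "univ_norm q x = 0 \<or> univ_norm q y = 0"
  shows "univ_norm q (x * y) = 0"
  using univ_norm_mult[of x y] univ_norm_nonneg[of "x * y"] assms by auto

lemma (in deformation_parameter) null_scale:
  assumes "univ_norm q x = 0"
  shows "univ_norm q (pm_scale c x) = 0"
  using univ_norm_scale_le[of c x] univ_norm_nonneg[of "pm_scale c x"] assms by simp

lemma equivp_section_eq: "equivp section_eq"
proof (rule equivpI)
  show "reflp section_eq"
    by (rule reflpI) (simp add: section_eq_def deformation_parameter.univ_norm_0)
  show "symp section_eq"
    by (rule sympI) (simp add: section_eq_def deformation_parameter.univ_norm_minus_commute)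
  show "transp section_eq"
  proof (rule transpI)
    fix f g h assume fg: "section_eq f g" and gh: "section_eq g h"
    have "univ_norm q (f q - h q) = 0" if q: "deformation_parameter q" for q
      using deformation_parameter.null_add[OF q, of "f q - g q" "g q - h q"] fg gh q
      by (simp add: section_eq_def)
    then show "section_eq f h" by (simp add: section_eq_def)
  qed
qed

lifting_forget poly_mapping.lifting

quotient_type uq2_section = "complex \<Rightarrow> free_alg" / section_eq
  by (rule equivp_section_eq)

instantiation uq2_section :: ring_1
begin

lift_definition zero_uq2_section :: uq2_section is "\<lambda>_. 0" .
lift_definition one_uq2_section :: uq2_section is "\<lambda>_. 1" .

lift_definition plus_uq2_section :: "uq2_section \<Rightarrow> uq2_section \<Rightarrow> uq2_section" is "\<lambda>f g q. f q + g q"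
  unfolding section_eq_def add_diff_add by (simp add: deformation_parameter.null_add)

lift_definition uminus_uq2_section :: "uq2_section \<Rightarrow> uq2_section" is "\<lambda>f q. - f q"
  unfolding section_eq_def by (simp add: deformation_parameter.univ_norm_minus_commute)

lift_definition minus_uq2_section :: "uq2_section \<Rightarrow> uq2_section \<Rightarrow> uq2_section" is "\<lambda>f g q. f q - g q"
proof -
  fix f f' g g' assume f: "section_eq f f'" and g: "section_eq g g'"
  have "univ_norm q (f q - g q - (f' q - g' q)) = 0" if q: "deformation_parameter q" for q
  proof -
    have "univ_norm q (g' q - g q) = 0"
      using g q by (simp add: section_eq_def deformation_parameter.univ_norm_minus_commute[OF q, of "g' q"])
    moreover have "univ_norm q (f q - f' q) = 0"
      using f q by (simp add: section_eq_def)
    ultimately have "univ_norm q ((f q - f' q) + (g' q - g q)) = 0"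
      by (rule deformation_parameter.null_add[OF q, rotated])
    then show ?thesis by (simp add: algebra_simps)
  qed
  then show "section_eq (\<lambda>q. f q - g q) (\<lambda>q. f' q - g' q)" by (simp add: section_eq_def)
qed

lift_definition times_uq2_section :: "uq2_section \<Rightarrow> uq2_section \<Rightarrow> uq2_section" is "\<lambda>f g q. f q * g q"
proof -
  fix f f' g g' assume f: "section_eq f f'" and g: "section_eq g g'"
  have "univ_norm q (f q * g q - f' q * g' q) = 0" if q: "deformation_parameter q" for q
  proof -
    have "f q * g q - f' q * g' q = (f q - f' q) * g q + f' q * (g q - g' q)"
      by (simp add: algebra_simps)
    then show ?thesis
      using f g q by (simp add: section_eq_def deformation_parameter.null_add deformation_parameter.null_mult)
  qed
  then show "section_eq (\<lambda>q. f q * g q) (\<lambda>q. f' q * g' q)" by (simp add: section_eq_def)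
qed

lemma section_eq_refl: "section_eq f f"
  using equivp_section_eq by (rule equivp_reflp)

instance
proof
  show "(0::uq2_section) \<noteq> 1"
  proof transfer
    show "\<not> section_eq (\<lambda>_. 0) (\<lambda>_. 1)"
      using deformation_parameter_half deformation_parameter.univ_norm_one[OF deformation_parameter_half]
        deformation_parameter.univ_norm_minus[OF deformation_parameter_half, of 1]
      by (auto simp: section_eq_def)
  qed
qed (transfer; simp add: section_eq_refl algebra_simps)+

end

lift_definition sec_scale :: "complex \<Rightarrow> uq2_section \<Rightarrow> uq2_section" is "\<lambda>c f q. pm_scale c (f q)"
  unfolding section_eq_def
  by (simp add: pm.scale_right_diff_distrib[symmetric] deformation_parameter.null_scale)

lift_definition sec_star :: "uq2_section \<Rightarrow> uq2_section" is "\<lambda>f q. free_star (f q)"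
  unfolding section_eq_def
  by (simp add: free_star_minus[symmetric] deformation_parameter.univ_norm_star)

interpretation sec: complex_star_algebra sec_scale sec_star
  by standard (transfer; simp add: section_eq_refl pm.scale_right_distrib pm.scale_left_distrib
      pm_scale_mult_left pm_scale_mult_right free_star_add free_star_mult free_star_scale)+

definition sec_at :: "complex \<Rightarrow> free_alg \<Rightarrow> free_alg \<Rightarrow> uq2_section" where
  "sec_at q x y = abs_uq2_section (\<lambda>p. if p = q then x else y)"

text \<open>Away from \<open>q\<close> the generators are given the values of the trivial character, where the relations
  hold with any parameter.\<close>

definition sec_gen :: "complex \<Rightarrow> generator \<Rightarrow> uq2_section" where
  "sec_gen q g = sec_at q (free_gen g) (if g = Gen_b then 0 else 1)"

context deformation_parameter
begin

lemma sec_at_ops: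
  "sec_at q x y * sec_at q x' y' = sec_at q (x * x') (y * y')"
  "sec_at q x y + sec_at q x' y' = sec_at q (x + x') (y + y')"
  "sec_scale c (sec_at q x y) = sec_at q (pm_scale c x) (pm_scale c y)"
  "sec_star (sec_at q x y) = sec_at q (free_star x) (free_star y)"
  "1 = sec_at q 1 1"
  unfolding sec_at_def one_uq2_section_def times_uq2_section.abs_eq plus_uq2_section.abs_eq
    sec_scale.abs_eq sec_star.abs_eq
  by (rule arg_cong[of _ _ abs_uq2_section]; simp add: fun_eq_iff)+

lemma sec_at_eqI:
  assumes "x - x' \<in> relators q" and "y = y'"
  shows "sec_at q x y = sec_at q x' y'"
proof -
  have "univ_norm p ((if p = q then x else y) - (if p = q then x' else y')) = 0" if "deformation_parameter p" for p
    using that univ_norm_relator[OF assms(1)] by (cases "p = q") (simp_all add: assms(2) deformation_parameter.univ_norm_0)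
  then show ?thesis
    unfolding sec_at_def uq2_section.abs_eq_iff section_eq_def by blast
qed

lemma sec_relations: "uq2_relations sec_scale sec_star q (sec_gen q Gen_a) (sec_gen q Gen_b) (sec_gen q Gen_D)"
  by (intro uq2_relations.intro sec.complex_star_algebra_axioms uq2_relations_axioms.intro q;
      unfold sec_gen_def sec_at_ops; rule sec_at_eqI; simp add: relators_def Let_def)

lift_definition sec_eval :: "uq2_section \<Rightarrow> uq2" is "\<lambda>f. cls (f q)"
  using deformation_parameter_axioms by (simp add: section_eq_def cls_eq_iff)

lemma sec_eval_at [simp]: "sec_eval (sec_at q x y) = cls x"
  by (simp add: sec_at_def sec_eval.abs_eq)

lemma sec_eval_carrier [simp]: "sec_eval x \<in> carrier OA"
  by transfer simp

lemma sec_eval_mult: "sec_eval (x * y) = sec_eval x \<otimes>\<^bsub>OA\<^esub> sec_eval y"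
  by transfer simp

lemma sec_eval_add: "sec_eval (x + y) = sec_eval x \<oplus>\<^bsub>OA\<^esub> sec_eval y"
  by transfer simp

lemma sec_eval_scale: "sec_eval (sec_scale c x) = scale OA c (sec_eval x)"
  by transfer simp

lemma sec_eval_star: "sec_eval (sec_star x) = star OA (sec_eval x)"
  by transfer simp

lemma sec_eval_one: "sec_eval 1 = \<one>\<^bsub>OA\<^esub>"
  by transfer simp

lemma sec_eval_zero: "sec_eval 0 = \<zero>\<^bsub>OA\<^esub>"
  by transfer simp

lemma sec_eval_power: "sec_eval (x ^ n) = sec_eval x [^]\<^bsub>OA\<^esub> n"
  by (induction n) (simp_all add: sec_eval_one sec_eval_mult power_Suc2 del: power_Suc O_ops)

lemma sec_eval_sum:
  "finite I \<Longrightarrow> sec_eval (\<Sum>i\<in>I. f i) = (\<Oplus>\<^bsub>OA\<^esub>i\<in>I. sec_eval (f i))"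
  by (induction I rule: finite_induct) (simp_all add: sec_eval_zero sec_eval_add O.finsum_insert del: O_ops)

lemma sec_eval_gen: "sec_eval (sec_gen q g) = uq2_gen q g"
  by (simp add: sec_gen_def uq2_gen_cls)

end

section \<open>The tensor square\<close>

context deformation_parameter
begin

abbreviation "AA \<equiv> tensor_alg OA OA"
abbreviation "formal \<equiv> formal_tensor OA OA"
abbreviation "relspan \<equiv> module.span pm_scale (bilinearity_relators OA OA)"

type_synonym formal = "uq2 \<times> uq2 \<Rightarrow>\<^sub>0 complex"

definition tcong :: "formal \<Rightarrow> formal \<Rightarrow> bool" (infix "\<approx>" 50) where
  "s \<approx> t \<longleftrightarrow> s - t \<in> relspan"

definition simple :: "uq2 \<Rightarrow> uq2 \<Rightarrow> formal" where
  "simple x y = Poly_Mapping.single (x, y) 1"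

lemma tcong_refl [simp]: "s \<approx> s"
  by (simp add: tcong_def pm.span_zero)

lemma tcong_sym: "s \<approx> t \<Longrightarrow> t \<approx> s"
  unfolding tcong_def using pm.span_neg by fastforce

lemma tcong_trans [trans]: "s \<approx> t \<Longrightarrow> t \<approx> u \<Longrightarrow> s \<approx> u"
  unfolding tcong_def using pm.span_add by fastforce

lemma tcong_add: "s \<approx> s' \<Longrightarrow> t \<approx> t' \<Longrightarrow> s + t \<approx> s' + t'"
  unfolding tcong_def add_diff_add by (rule pm.span_add)

lemma tcong_scale: "s \<approx> s' \<Longrightarrow> pm_scale c s \<approx> pm_scale c s'"
  unfolding tcong_def pm.scale_right_diff_distrib[symmetric] by (rule pm.span_scale)

lemma tcong_sum: "(\<And>i. i \<in> I \<Longrightarrow> f i \<approx> g i) \<Longrightarrow> sum f I \<approx> sum g I"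
  unfolding tcong_def sum_subtractf[symmetric] by (rule pm.span_sum)

lemma simple_bilinear:
  "simple (cls (x + x')) (cls y) \<approx> simple (cls x) (cls y) + simple (cls x') (cls y)"
  "simple (cls x) (cls (y + y')) \<approx> simple (cls x) (cls y) + simple (cls x) (cls y')"
  "simple (cls (pm_scale c x)) (cls y) \<approx> pm_scale c (simple (cls x) (cls y))"
  "simple (cls x) (cls (pm_scale c y)) \<approx> pm_scale c (simple (cls x) (cls y))"
proof -
  note O_ops(1-3) [simp del]
  show "simple (cls (x + x')) (cls y) \<approx> simple (cls x) (cls y) + simple (cls x') (cls y)"
    unfolding tcong_def simple_def O_ops(2)[symmetric] diff_diff_add[symmetric]
    by (intro pm.span_base) (use cls_carrier in \<open>unfold bilinearity_relators_def, blast\<close>)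
  show "simple (cls x) (cls (y + y')) \<approx> simple (cls x) (cls y) + simple (cls x) (cls y')"
    unfolding tcong_def simple_def O_ops(2)[symmetric] diff_diff_add[symmetric]
    by (intro pm.span_base) (use cls_carrier in \<open>unfold bilinearity_relators_def, blast\<close>)
  show "simple (cls (pm_scale c x)) (cls y) \<approx> pm_scale c (simple (cls x) (cls y))"
    unfolding tcong_def simple_def O_ops(3)[symmetric] pm_scale_single mult_1_right
    by (intro pm.span_base) (use cls_carrier in \<open>unfold bilinearity_relators_def, blast\<close>)
  show "simple (cls x) (cls (pm_scale c y)) \<approx> pm_scale c (simple (cls x) (cls y))"
    unfolding tcong_def simple_def O_ops(3)[symmetric] pm_scale_single mult_1_right
    by (intro pm.span_base) (use cls_carrier in \<open>unfold bilinearity_relators_def, blast\<close>)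
qed

lemma bilinearity_relators_cases:
  assumes "r \<in> bilinearity_relators OA OA"
  obtains x x' y where "r = simple (cls (x + x')) (cls y) - simple (cls x) (cls y) - simple (cls x') (cls y)"
  | x y y' where "r = simple (cls x) (cls (y + y')) - simple (cls x) (cls y) - simple (cls x) (cls y')"
  | c x y where "r = simple (cls (pm_scale c x)) (cls y) - pm_scale c (simple (cls x) (cls y))"
  | c x y where "r = simple (cls x) (cls (pm_scale c y)) - pm_scale c (simple (cls x) (cls y))"
  using assms unfolding bilinearity_relators_def carrier_O simple_def
  by (elim UnE) (fastforce simp: O_ops)+

definition fmul :: "formal \<Rightarrow> formal \<Rightarrow> formal" where
  "fmul s t = s \<otimes>\<^bsub>formal\<^esub> t"

lemma fmul_unfold: "fmul s t = (\<Sum>k\<in>Poly_Mapping.keys s. \<Sum>k'\<in>Poly_Mapping.keys t.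
    Poly_Mapping.single (fst k \<otimes>\<^bsub>OA\<^esub> fst k', snd k \<otimes>\<^bsub>OA\<^esub> snd k')
      (Poly_Mapping.lookup s k * Poly_Mapping.lookup t k'))"
  by (simp add: fmul_def formal_tensor_def case_prod_beta)

lemma fmul_add_left: "fmul (s + s') t = fmul s t + fmul s' t"
  unfolding fmul_unfold
  by (rule pm_sum_additive) (simp_all add: distrib_right single_add sum.distrib)

lemma fmul_add_right: "fmul s (t + t') = fmul s t + fmul s t'"
  unfolding fmul_unfold sum.distrib[symmetric]
  by (intro sum.cong refl pm_sum_additive) (simp_all add: distrib_left single_add)

lemma fmul_single: "fmul (Poly_Mapping.single (x, y) c) (Poly_Mapping.single (x', y') c') =
    Poly_Mapping.single (x \<otimes>\<^bsub>OA\<^esub> x', y \<otimes>\<^bsub>OA\<^esub> y') (c * c')"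
  by (cases "c = 0"; cases "c' = 0") (simp_all add: fmul_unfold)

lemma fmul_zero [simp]: "fmul 0 t = 0" "fmul s 0 = 0"
  by (simp_all add: fmul_unfold)

lemma fmul_diff_left: "fmul (s - s') t = fmul s t - fmul s' t"
  using fmul_add_left[of "s - s'" s' t] by simp

lemma fmul_diff_right: "fmul s (t - t') = fmul s t - fmul s t'"
  using fmul_add_right[of s "t - t'" t'] by simp

lemma fmul_scale: "fmul (pm_scale c s) t = pm_scale c (fmul s t)" "fmul s (pm_scale c t) = pm_scale c (fmul s t)"
proof -
  have 1: "fmul (pm_scale c (Poly_Mapping.single k z)) t = pm_scale c (fmul (Poly_Mapping.single k z) t)" for k z
    by (induction t rule: pm_induct; cases k)
      (auto simp: fmul_single fmul_add_right pm.scale_right_distrib mult.assoc)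
  show "fmul (pm_scale c s) t = pm_scale c (fmul s t)"
    by (induction s rule: pm_induct) (simp_all add: 1 fmul_add_left pm.scale_right_distrib del: pm_scale_single)
  have 2: "fmul (Poly_Mapping.single k z) (pm_scale c t) = pm_scale c (fmul (Poly_Mapping.single k z) t)" for k z
    by (induction t rule: pm_induct; cases k)
      (auto simp: fmul_single fmul_add_right pm.scale_right_distrib mult.left_commute)
  show "fmul s (pm_scale c t) = pm_scale c (fmul s t)"
    by (induction s rule: pm_induct) (simp_all add: 2 fmul_add_left pm.scale_right_distrib)
qed

lemma fmul_sum_right: "fmul s (\<Sum>i\<in>I. f i) = (\<Sum>i\<in>I. fmul s (f i))"
  by (induction I rule: infinite_finite_induct) (simp_all add: fmul_add_right)

lemma fmul_simple [simp]: "fmul (simple (cls x) (cls y)) (simple (cls x') (cls y')) = simple (cls (x * x')) (cls (y * y'))"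
  by (simp add: simple_def fmul_single)

lemma formal_carrier_iff: "s \<in> carrier formal \<longleftrightarrow> Poly_Mapping.keys s \<subseteq> range cls \<times> range cls"
  by (simp add: formal_tensor_def carrier_O)

lemma formal_carrier_induct [consumes 1, case_names zero simple add scale]:
  assumes s: "s \<in> carrier formal"
    and "P 0" and simple: "\<And>x y. P (simple (cls x) (cls y))" and add: "\<And>s t. P s \<Longrightarrow> P t \<Longrightarrow> P (s + t)"
    and scale: "\<And>c s. P s \<Longrightarrow> P (pm_scale c s)"
  shows "P s"
proof -
  have "P (\<Sum>k\<in>A. Poly_Mapping.single k (Poly_Mapping.lookup s k))" if "finite A" "A \<subseteq> range cls \<times> range cls" for A
    using that
  proof (induction A rule: finite_induct)
    case (insert k A)
    then obtain x y where k: "k = (cls x, cls y)" by auto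
    have "P (Poly_Mapping.single k (Poly_Mapping.lookup s k))"
      using scale[OF simple[of x y], of "Poly_Mapping.lookup s k"] by (simp add: k simple_def)
    then show ?case using insert by (simp add: add)
  qed (simp add: \<open>P 0\<close>)
  then show ?thesis using s by (subst pm_decompose) (simp add: formal_carrier_iff)
qed

lemma simple_carrier [simp]: "simple (cls x) (cls y) \<in> carrier formal"
  by (simp add: simple_def formal_carrier_iff)

lemma formal_carrier_add: "s \<in> carrier formal \<Longrightarrow> t \<in> carrier formal \<Longrightarrow> s + t \<in> carrier formal"
  unfolding formal_carrier_iff using Poly_Mapping.keys_add[of s t] by blast

lemma formal_carrier_scale: "s \<in> carrier formal \<Longrightarrow> pm_scale c s \<in> carrier formal"
  unfolding formal_carrier_iff by (auto simp: in_keys_iff subset_iff)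

lemma formal_carrier_0: "0 \<in> carrier formal"
  by (simp add: formal_carrier_iff)

lemma formal_carrier_sum: "(\<And>i. i \<in> I \<Longrightarrow> f i \<in> carrier formal) \<Longrightarrow> sum f I \<in> carrier formal"
  by (induction I rule: infinite_finite_induct) (simp_all add: formal_carrier_0 formal_carrier_add)

lemma formal_carrier_fmul: "s \<in> carrier formal \<Longrightarrow> t \<in> carrier formal \<Longrightarrow> fmul s t \<in> carrier formal"
proof (induction s rule: formal_carrier_induct)
  case (simple x y)
  show ?case using simple
    by (induction t rule: formal_carrier_induct)
      (simp_all add: fmul_add_right fmul_scale formal_carrier_0 formal_carrier_add formal_carrier_scale)
qed (simp_all add: fmul_add_left fmul_scale formal_carrier_0 formal_carrier_add formal_carrier_scale)

lemma relspan_fmul: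
  assumes s: "s \<in> relspan" and t: "t \<in> carrier formal"
  shows "fmul s t \<in> relspan \<and> fmul t s \<in> relspan"
  using t
proof (induction t rule: formal_carrier_induct)
  case (simple x0 y0)
  let ?t = "simple (cls x0) (cls y0)"
  note bilinear = simple_bilinear[unfolded tcong_def diff_diff_add[symmetric]]
  from s show ?case
  proof (induction s rule: pm.span_induct_alt)
    case (step c r s)
    from step(1) have "fmul r ?t \<in> relspan \<and> fmul ?t r \<in> relspan"
      by (cases r rule: bilinearity_relators_cases)
        (simp_all add: fmul_diff_left fmul_diff_right fmul_scale distrib_left distrib_right
          pm_scale_mult_left pm_scale_mult_right bilinear)
    then show ?case
      using step(2) by (simp add: fmul_add_left fmul_add_right fmul_scale pm.span_add pm.span_scale)
  qed (simp add: pm.span_zero)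
qed (simp_all add: fmul_add_left fmul_add_right fmul_scale pm.span_zero pm.span_add pm.span_scale)

lemma tcong_fmul:
  assumes "s \<approx> s'" "t \<approx> t'" "s' \<in> carrier formal" "t \<in> carrier formal"
  shows "fmul s t \<approx> fmul s' t'"
proof -
  have "fmul s t - fmul s' t' = fmul (s - s') t + fmul s' (t - t')"
    by (simp add: fmul_diff_left fmul_diff_right)
  then show ?thesis
    using relspan_fmul[of "s - s'" t] relspan_fmul[of "t - t'" s'] assms
    by (simp add: tcong_def pm.span_add)
qed

definition tcls :: "formal \<Rightarrow> uq2_tensor" where
  "tcls s = tensor_rel OA OA `` {s}"

lemma mem_tcls: "s \<in> carrier formal \<Longrightarrow> t \<in> tcls s \<longleftrightarrow> t \<in> carrier formal \<and> s \<approx> t"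
  by (simp add: tcls_def tensor_rel_def tcong_def)

lemma tcls_eq_iff:
  assumes "s \<in> carrier formal" "t \<in> carrier formal"
  shows "tcls s = tcls t \<longleftrightarrow> s \<approx> t"
proof
  assume "tcls s = tcls t"
  then show "s \<approx> t" using mem_tcls[OF assms(1), of t] mem_tcls[OF assms(2), of t] assms by simp
next
  assume "s \<approx> t"
  then show "tcls s = tcls t"
    using mem_tcls assms tcong_sym tcong_trans by blast
qed

lemma UN_tcls:
  assumes "s \<in> carrier formal" and "\<And>s'. s' \<in> carrier formal \<Longrightarrow> s \<approx> s' \<Longrightarrow> F s' = Y"
  shows "(\<Union>s'\<in>tcls s. F s') = Y"
proof -
  have "s \<in> tcls s" using assms(1) by (simp add: mem_tcls)
  moreover have "F s' = Y" if "s' \<in> tcls s" for s'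
    using that assms by (simp add: mem_tcls)
  ultimately show ?thesis by auto
qed

lemma AA_ops:
  assumes s: "s \<in> carrier formal"
  shows "t \<in> carrier formal \<Longrightarrow> tcls s \<otimes>\<^bsub>AA\<^esub> tcls t = tcls (fmul s t)"
    and "t \<in> carrier formal \<Longrightarrow> tcls s \<oplus>\<^bsub>AA\<^esub> tcls t = tcls (s + t)"
    and "scale AA c (tcls s) = tcls (pm_scale c s)"
proof -
  have add: "monoid.mult AA = (\<lambda>X Y. \<Union>x\<in>X. \<Union>y\<in>Y. tcls (fmul x y))"
    "add AA = (\<lambda>X Y. \<Union>x\<in>X. \<Union>y\<in>Y. tcls (x + y))"
    "scale AA = (\<lambda>c X. \<Union>x\<in>X. tcls (pm_scale c x))"
    by (simp_all add: tensor_alg_def quot_alg_def tcls_def fmul_def) (simp_all add: formal_tensor_def)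
  show "tcls s \<otimes>\<^bsub>AA\<^esub> tcls t = tcls (fmul s t)" if t: "t \<in> carrier formal"
    unfolding add
    by (intro UN_tcls s t) (simp add: tcls_eq_iff formal_carrier_fmul tcong_fmul tcong_sym s t)
  show "tcls s \<oplus>\<^bsub>AA\<^esub> tcls t = tcls (s + t)" if t: "t \<in> carrier formal"
    unfolding add
    by (intro UN_tcls s t) (simp add: tcls_eq_iff formal_carrier_add tcong_add tcong_sym s t)
  show "scale AA c (tcls s) = tcls (pm_scale c s)"
    unfolding add
    by (intro UN_tcls s) (simp add: tcls_eq_iff formal_carrier_scale tcong_scale tcong_sym s)
qed

lemma AA_carrier: "carrier AA = tcls ` carrier formal"
  by (auto simp: tensor_alg_def quot_alg_def quotient_def tcls_def)

lemma AA_zero: "\<zero>\<^bsub>AA\<^esub> = tcls 0"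
  by (simp add: tensor_alg_def quot_alg_def tcls_def formal_tensor_def)

lemma AA_one: "\<one>\<^bsub>AA\<^esub> = tcls (simple (cls 1) (cls 1))"
  by (simp add: tensor_alg_def quot_alg_def tcls_def simple_def) (simp add: formal_tensor_def)

lemma abelian_monoid_AA: "abelian_monoid AA"
  by (rule abelian_monoidI)
    (auto simp: AA_carrier AA_zero AA_ops formal_carrier_add formal_carrier_0 add_ac)

lemma AA_finsum:
  assumes "finite I" "\<And>i. i \<in> I \<Longrightarrow> f i \<in> carrier formal"
  shows "(\<Oplus>\<^bsub>AA\<^esub>i\<in>I. tcls (f i)) = tcls (\<Sum>i\<in>I. f i)"
  using assms
proof (induction I rule: finite_induct)
  case empty
  interpret abelian_monoid AA by (rule abelian_monoid_AA)
  show ?case by (simp add: AA_zero)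
next
  case (insert i I)
  interpret abelian_monoid AA by (rule abelian_monoid_AA)
  have "(\<Oplus>\<^bsub>AA\<^esub>i\<in>insert i I. tcls (f i)) = tcls (f i) \<oplus>\<^bsub>AA\<^esub> (\<Oplus>\<^bsub>AA\<^esub>i\<in>I. tcls (f i))"
    using insert by (intro finsum_insert) (auto simp: AA_carrier)
  then show ?case using insert by (simp add: AA_ops formal_carrier_sum)
qed

lemma tensor_elt_tcls: "tensor_elt OA OA x y = tcls (simple x y)"
  by (simp add: tensor_elt_def tcls_def simple_def)

section \<open>Separating functionals on the tensor square\<close>

definition choose_rep :: "uq2 \<Rightarrow> free_alg" where
  "choose_rep X = (SOME x. X = cls x)"

lemma cls_choose_rep: "cls (choose_rep (cls x)) = cls x"
  unfolding choose_rep_def by (rule sym, rule someI[of "\<lambda>y. cls x = cls y"]) simp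

definition coeff_fun :: "nat \<Rightarrow> uq2 \<Rightarrow> complex" where
  "coeff_fun k X = coefficient k (choose_rep X)"

lemma coeff_fun_cls: "coeff_fun k (cls x) = coefficient k x"
proof -
  have "univ_norm q (choose_rep (cls x) - x) = 0" using cls_choose_rep by (simp add: cls_eq_iff)
  then have "coefficient k (choose_rep (cls x) - x) = 0" by (rule coefficient_null)
  then show ?thesis
    using coefficient_add[of k "choose_rep (cls x) - x" x] by (simp add: coeff_fun_def)
qed

definition sec_of :: "uq2 \<Rightarrow> uq2_section" where
  "sec_of X = sec_at q (choose_rep X) 0"

lemma sec_of_cls: "sec_of (cls x) = sec_at q x 0"
  unfolding sec_of_def sec_at_def uq2_section.abs_eq_iff section_eq_def
  using cls_choose_rep[of x] by (simp add: cls_eq_iff deformation_parameter.univ_norm_0)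

lemma sec_eval_sec_of: "X \<in> carrier OA \<Longrightarrow> sec_eval (sec_of X) = X"
  by (auto simp: carrier_O sec_of_cls)

definition slice :: "nat \<Rightarrow> formal \<Rightarrow> uq2_section" where
  "slice k s = (\<Sum>x\<in>Poly_Mapping.keys s.
     sec_scale (Poly_Mapping.lookup s x) (sec_scale (coeff_fun k (fst x)) (sec_of (snd x))))"

lemma slice_add: "slice k (s + t) = slice k s + slice k t"
  unfolding slice_def by (rule pm_sum_additive) (simp_all add: sec.scale_left_distrib distrib_right)

lemma slice_0 [simp]: "slice k 0 = 0"
  by (simp add: slice_def)

lemma slice_single: "slice k (Poly_Mapping.single (x, y) c) = sec_scale c (sec_scale (coeff_fun k x) (sec_of y))"
  by (cases "c = 0") (simp_all add: slice_def)

lemma slice_scale: "slice k (pm_scale c s) = sec_scale c (slice k s)"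
proof (induction s rule: pm_induct)
  case (single p z)
  then show ?case by (cases p) (simp add: slice_single)
qed (simp_all add: slice_add pm.scale_right_distrib sec.scale_right_distrib)

lemma slice_diff: "slice k (s - t) = slice k s - slice k t"
  using slice_add[of k "s - t" t] by simp

lemma slice_simple: "slice k (simple x y) = sec_scale (coeff_fun k x) (sec_of y)"
  by (simp add: simple_def slice_single)

lemma slice_sum: "slice k (\<Sum>i\<in>I. f i) = (\<Sum>i\<in>I. slice k (f i))"
  by (induction I rule: infinite_finite_induct) (simp_all add: slice_add)

lemma slice_relspan: "s \<in> relspan \<Longrightarrow> slice k s = 0"
proof (induction s rule: pm.span_induct_alt)
  case (step c r s)
  have at: "sec_at q (x + y) 0 = sec_at q x 0 + sec_at q y 0"
    "sec_at q (pm_scale z x) 0 = sec_scale z (sec_at q x 0)" for x y z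
    by (simp_all add: sec_at_ops)
  from step(1) have "slice k r = 0"
    by (cases r rule: bilinearity_relators_cases)
      (simp_all add: slice_diff slice_simple slice_scale coeff_fun_cls sec_of_cls coefficient_add coefficient_scale
        at sec.scale_right_distrib sec.scale_left_distrib mult.commute)
  then show ?case using step(2) by (simp add: slice_add slice_scale)
qed simp

lemma slice_cong: "s \<approx> t \<Longrightarrow> slice k s = slice k t"
  using slice_relspan[of "s - t" k] by (simp add: tcong_def slice_diff)

end

section \<open>The comultiplication on homogeneous monomials\<close>

lemma (in uq2_relations) b_a_power: "b * a ^ m = q ^ m \<cdot> (a ^ m * b)"
proof (induction m)
  case (Suc m)
  have "b * a ^ Suc m = q \<cdot> (a * (b * a ^ m))"
    by (simp add: mult.assoc[symmetric] ba)
  then show ?case unfolding Suc by (simp add: mult.assoc)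
qed simp

context deformation_parameter
begin

abbreviation "sa \<equiv> sec_gen q Gen_a"
abbreviation "sb \<equiv> sec_gen q Gen_b"
abbreviation "sD \<equiv> sec_gen q Gen_D"

sublocale rel: uq2_relations sec_scale sec_star q sa sb sD
  by (rule sec_relations)

abbreviation "ga \<equiv> free_gen Gen_a"
abbreviation "gb \<equiv> free_gen Gen_b"

definition monomial :: "nat \<Rightarrow> nat \<Rightarrow> free_alg" where
  "monomial n i = ga ^ (n - i) * gb ^ i"

lemma sec_eval_cases: obtains x where "sec_eval y = cls x"
  using sec_eval_carrier[of y] by (auto simp: carrier_O)

lemma cls_gen: "cls (free_gen g) = sec_eval (sec_gen q g)"
  by (simp add: sec_eval_gen uq2_gen_cls)

lemma cls_monomial: "cls (monomial n i) = sec_eval (sa ^ (n - i) * sb ^ i)"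
  by (simp add: monomial_def sec_eval_mult sec_eval_power cls_gen[symmetric] O_pow)

lemma simple_eval_add: "simple (cls x) (sec_eval (y + y')) \<approx> simple (cls x) (sec_eval y) + simple (cls x) (sec_eval y')"
  by (rule sec_eval_cases[of y]; rule sec_eval_cases[of y']) (simp add: sec_eval_add simple_bilinear)

lemma simple_eval_scale: "simple (cls x) (sec_eval (sec_scale c y)) \<approx> pm_scale c (simple (cls x) (sec_eval y))"
  by (rule sec_eval_cases[of y]) (simp add: sec_eval_scale simple_bilinear)

lemma simple_eval_zero: "simple (cls x) (sec_eval 0) \<approx> 0"
  using simple_eval_scale[of x 0 0] by simp

lemma simple_eval_carrier [simp]: "simple (cls x) (sec_eval y) \<in> carrier formal"
  by (rule sec_eval_cases[of y]) simp

lemma fmul_simple_eval: "fmul (simple (cls x) (sec_eval y)) (simple (cls x') (sec_eval y')) = simple (cls (x * x')) (sec_eval (y * y'))"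
  by (rule sec_eval_cases[of y]; rule sec_eval_cases[of y']) (simp add: sec_eval_mult)

definition row :: "nat \<Rightarrow> (nat \<Rightarrow> uq2_section) \<Rightarrow> formal" where
  "row n p = (\<Sum>i\<le>n. simple (cls (monomial n i)) (sec_eval (p i)))"

lemma row_carrier [simp]: "row n p \<in> carrier formal"
  by (simp add: row_def formal_carrier_sum)

lemma gb_monomial: "i \<le> n \<Longrightarrow> cls (gb * monomial n i) = cls (pm_scale (q ^ (n - i)) (monomial (Suc n) (Suc i)))"
proof -
  have "cls (gb * monomial n i) = sec_eval (sb * sa ^ (n - i) * sb ^ i)"
    unfolding O_ops(1)[symmetric] cls_monomial cls_gen by (simp only: sec_eval_mult[symmetric] mult.assoc)
  also have "\<dots> = scale OA (q ^ (n - i)) (cls (monomial (Suc n) (Suc i)))"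
    unfolding rel.b_a_power by (simp add: cls_monomial sec_eval_scale[symmetric] mult.assoc del: O_ops)
  finally show ?thesis by simp
qed

lemma row_step:
  assumes p: "p (Suc n) = 0"
  shows "fmul (simple (cls ga) (sec_eval x) + pm_scale z (simple (cls gb) (sec_eval y))) (row n p) \<approx>
    row (Suc n) (rel.lmul x (sec_scale z y) n p)"
proof -
  let ?m = "\<lambda>i. cls (monomial (Suc n) i)"
  let ?A = "\<Sum>i\<le>n. simple (?m i) (sec_eval (x * p i))"
  let ?B = "\<Sum>i\<le>n. simple (?m (Suc i)) (sec_eval (sec_scale (q ^ (n - i)) (sec_scale z y * p i)))"
  let ?L = "simple (cls ga) (sec_eval x) + pm_scale z (simple (cls gb) (sec_eval y))"
  have "fmul ?L (row n p) =
      (\<Sum>i\<le>n. simple (cls (ga * monomial n i)) (sec_eval (x * p i)) + pm_scale z (simple (cls (gb * monomial n i)) (sec_eval (y * p i))))"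
    by (simp add: row_def fmul_sum_right fmul_add_left fmul_scale fmul_simple_eval)
  also have "\<dots> \<approx> (\<Sum>i\<le>n. simple (?m i) (sec_eval (x * p i)) +
      simple (?m (Suc i)) (sec_eval (sec_scale (q ^ (n - i)) (sec_scale z y * p i))))"
  proof (intro tcong_sum tcong_add)
    fix i assume i: "i \<in> {..n}"
    then have "ga * monomial n i = monomial (Suc n) i"
      by (simp add: monomial_def Suc_diff_le mult.assoc)
    then show "simple (cls (ga * monomial n i)) (sec_eval (x * p i)) \<approx> simple (?m i) (sec_eval (x * p i))" by simp
    obtain u where u: "sec_eval (y * p i) = cls u" by (rule sec_eval_cases)
    have "pm_scale z (simple (cls (gb * monomial n i)) (sec_eval (y * p i))) \<approx>
        pm_scale z (pm_scale (q ^ (n - i)) (simple (?m (Suc i)) (sec_eval (y * p i))))"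
      using i by (intro tcong_scale) (simp add: gb_monomial u simple_bilinear)
    also have "\<dots> = pm_scale (q ^ (n - i) * z) (simple (?m (Suc i)) (sec_eval (y * p i)))"
      by (simp add: mult.commute)
    also have "\<dots> \<approx> simple (?m (Suc i)) (sec_eval (sec_scale (q ^ (n - i) * z) (y * p i)))"
      by (rule tcong_sym[OF simple_eval_scale])
    finally show "pm_scale z (simple (cls (gb * monomial n i)) (sec_eval (y * p i))) \<approx>
        simple (?m (Suc i)) (sec_eval (sec_scale (q ^ (n - i)) (sec_scale z y * p i)))" by simp
  qed
  also have "\<dots> = ?A + 0 +
      (0 + ?B)"
    by (simp add: sum.distrib)
  also have "\<dots> \<approx> (?A + simple (?m (Suc n)) (sec_eval (x * p (Suc n)))) +
      (simple (?m 0) (sec_eval 0) + ?B)"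
    using p by (intro tcong_add tcong_refl tcong_sym[OF simple_eval_zero]) (simp add: tcong_sym[OF simple_eval_zero])
  also have "\<dots> = (\<Sum>i\<le>Suc n. simple (?m i) (sec_eval (x * p i))) + (\<Sum>i\<le>Suc n. simple (?m i)
      (sec_eval (case i of 0 \<Rightarrow> 0 | Suc k \<Rightarrow> sec_scale (q ^ (n - k)) (sec_scale z y * p k))))"
    by (subst (2) sum.atMost_Suc_shift) simp
  also have "\<dots> \<approx> row (Suc n) (rel.lmul x (sec_scale z y) n p)"
    unfolding row_def rel.lmul_def sum.distrib[symmetric]
    by (intro tcong_sum tcong_sym[OF simple_eval_add])
  finally show ?thesis .
qed

definition f_basis :: "nat \<Rightarrow> nat \<Rightarrow> free_alg" where
  "f_basis n k = pm_scale (rel.root_binom n k) (monomial n k)"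

lemma f_basis_independent:
  assumes u: "\<And>i. i \<le> n \<Longrightarrow> u i \<in> carrier OA" "\<And>i. i \<le> n \<Longrightarrow> u' i \<in> carrier OA"
    and eq: "(\<Sum>i\<le>n. simple (cls (f_basis n i)) (u i)) \<approx> (\<Sum>i\<le>n. simple (cls (f_basis n i)) (u' i))"
    and k: "k \<le> n"
  shows "u k = u' k"
proof -
  define z where "z = rel.root_binom n k * (\<Prod>l<n - k. weight_a l)"
  have z: "z \<noteq> 0" by (simp add: z_def weight_a_nonzero)
  have coeff: "coefficient (n - k) (f_basis n i) = (if i = k then z else 0)" if "i \<le> n" for i
    using that k by (auto simp: f_basis_def monomial_def coefficient_scale coefficient_monomial z_def)
  have *: "slice (n - k) (\<Sum>i\<le>n. simple (cls (f_basis n i)) (w i)) = sec_scale z (sec_of (w k))" for w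
  proof -
    have "slice (n - k) (\<Sum>i\<le>n. simple (cls (f_basis n i)) (w i)) = (\<Sum>i\<le>n. if i = k then sec_scale z (sec_of (w i)) else 0)"
      unfolding slice_sum slice_simple coeff_fun_cls by (intro sum.cong) (auto simp: coeff)
    then show ?thesis using k by simp
  qed
  have "sec_scale z (sec_of (u k)) = sec_scale z (sec_of (u' k))"
    using slice_cong[OF eq, of "n - k"] unfolding * .
  then have "sec_of (u k) = sec_of (u' k)" using z by simp
  then show ?thesis using sec_eval_sec_of u k by metis
qed

definition spin :: "nat \<Rightarrow> nat \<Rightarrow> real" where
  "spin n k = - (real n / 2) + real k"

lemma spin_index_eq: "spin_index (real n / 2) = spin n ` {..n}"
  by (auto simp: spin_index_def spin_def)

lemma inj_spin: "inj_on (spin n) A"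
  by (simp add: inj_on_def spin_def)

lemma f_vec_eq:
  assumes "k \<le> n"
  shows "f_vec q (real n / 2) (spin n k) = cls (f_basis n k)"
proof -
  have "real n / 2 - spin n k = real (n - k)" "real n / 2 + spin n k = real k" "2 * (real n / 2) = real n"
    using assms by (simp_all add: spin_def of_nat_diff)
  then show ?thesis
    unfolding f_vec_def Let_def f_basis_def monomial_def uq2_gen_cls O_pow O_ops rel.root_binom_def
    by (simp only: floor_of_nat nat_int)
qed

context
  fixes \<Delta> :: "uq2 \<Rightarrow> uq2_tensor"
  assumes comult: "is_comultiplication q \<Delta>"
begin

lemma comult_mult: "\<Delta> (cls (x * y)) = \<Delta> (cls x) \<otimes>\<^bsub>AA\<^esub> \<Delta> (cls y)"
  and comult_scale: "\<Delta> (cls (pm_scale c x)) = scale AA c (\<Delta> (cls x))"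
  and comult_one: "\<Delta> (cls 1) = tcls (simple (cls 1) (cls 1))"
proof -
  have hom: "star_hom OA AA \<Delta>"
    using comult by (simp add: is_comultiplication_def Let_def)
  show "\<Delta> (cls (x * y)) = \<Delta> (cls x) \<otimes>\<^bsub>AA\<^esub> \<Delta> (cls y)"
    using hom cls_carrier unfolding star_hom_def O_ops(1)[symmetric] by blast
  show "\<Delta> (cls (pm_scale c x)) = scale AA c (\<Delta> (cls x))"
    using hom cls_carrier unfolding star_hom_def O_ops(3)[symmetric] by blast
  show "\<Delta> (cls 1) = tcls (simple (cls 1) (cls 1))"
    using hom by (simp add: star_hom_def AA_one)
qed

lemma comult_gen:
  "\<Delta> (cls ga) = tcls (simple (cls ga) (sec_eval (sa)) +
     pm_scale (- cnj q) (simple (cls gb) (sec_eval (sD * sec_star (sb)))))"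
  "\<Delta> (cls gb) = tcls (simple (cls ga) (sec_eval (sb)) +
     pm_scale 1 (simple (cls gb) (sec_eval (sD * sec_star (sa)))))"
  using comult
  by (simp_all add: is_comultiplication_def Let_def tensor_elt_tcls uq2_gen_cls AA_ops sec_eval_mult
      sec_eval_star sec_eval_gen formal_carrier_scale formal_carrier_add del: pm.scale_minus_left)

lemma comult_monomial:
  "j \<le> n \<Longrightarrow> \<Delta> (cls (monomial n j)) = tcls (row n (\<lambda>i. rel.tau n i j))"
proof (induction n arbitrary: j)
  case 0
  then show ?case by (simp add: monomial_def row_def comult_one sec_eval_one)
next
  case (Suc n)
  have step: "tcls s \<otimes>\<^bsub>AA\<^esub> tcls (row n p) = tcls (row (Suc n) r)"
    if "s \<in> carrier formal" "fmul s (row n p) \<approx> row (Suc n) r" for s p r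
    using that by (simp add: AA_ops tcls_eq_iff formal_carrier_fmul)
  show ?case
  proof (cases "j \<le> n")
    case True
    then have "monomial (Suc n) j = ga * monomial n j" by (simp add: monomial_def Suc_diff_le mult.assoc)
    then have "\<Delta> (cls (monomial (Suc n) j)) = \<Delta> (cls ga) \<otimes>\<^bsub>AA\<^esub> tcls (row n (\<lambda>i. rel.tau n i j))"
      using Suc.IH[OF True] by (simp add: comult_mult)
    also have "\<dots> = tcls (row (Suc n) (rel.lmul (sa) rel.c n (\<lambda>i. rel.tau n i j)))"
      unfolding comult_gen rel.c_def
      by (intro step row_step formal_carrier_add formal_carrier_scale simple_eval_carrier) (simp add: rel.tau_above)
    finally show ?thesis using True by simp
  next
    case False
    then have j: "j = Suc n" using Suc.prems by simp
    have "monomial (Suc n) (Suc n) = gb * monomial n n" by (simp add: monomial_def)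
    then have "\<Delta> (cls (monomial (Suc n) j)) = \<Delta> (cls gb) \<otimes>\<^bsub>AA\<^esub> tcls (row n (\<lambda>i. rel.tau n i n))"
      using Suc.IH[of n] by (simp add: comult_mult j)
    also have "\<dots> = tcls (row (Suc n) (rel.lmul (sb) (sec_scale 1 rel.d) n (\<lambda>i. rel.tau n i n)))"
      unfolding comult_gen rel.d_def
      by (intro step row_step formal_carrier_add formal_carrier_scale simple_eval_carrier) (simp add: rel.tau_above)
    finally show ?thesis by (simp add: j)
  qed
qed

lemma comult_f_basis:
  assumes "j \<le> n"
  shows "\<Delta> (cls (f_basis n j)) = tcls (\<Sum>i\<le>n. simple (cls (f_basis n i)) (sec_eval (rel.t n i j)))"
proof -
  have "pm_scale (rel.root_binom n j) (row n (\<lambda>i. rel.tau n i j)) \<approx> (\<Sum>i\<le>n. simple (cls (f_basis n i)) (sec_eval (rel.t n i j)))"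
    unfolding row_def pm.scale_sum_right
  proof (rule tcong_sum)
    fix i
    obtain u where u: "sec_eval (rel.t n i j) = cls u" by (rule sec_eval_cases)
    have "simple (cls (f_basis n i)) (sec_eval (rel.t n i j)) \<approx> pm_scale (rel.root_binom n i) (simple (cls (monomial n i)) (sec_eval (rel.t n i j)))"
      unfolding f_basis_def u by (rule simple_bilinear)
    also have "\<dots> \<approx> pm_scale (rel.root_binom n i) (pm_scale (rel.root_binom n j / rel.root_binom n i) (simple (cls (monomial n i)) (sec_eval (rel.tau n i j))))"
      unfolding rel.t_def by (intro tcong_scale simple_eval_scale)
    also have "\<dots> = pm_scale (rel.root_binom n j) (simple (cls (monomial n i)) (sec_eval (rel.tau n i j)))"
      by simp
    finally show "pm_scale (rel.root_binom n j) (simple (cls (monomial n i)) (sec_eval (rel.tau n i j))) \<approx>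
        simple (cls (f_basis n i)) (sec_eval (rel.t n i j))"
      by (rule tcong_sym)
  qed
  then show ?thesis
    using assms unfolding f_basis_def[of n j] comult_scale
    by (simp add: comult_monomial AA_ops tcls_eq_iff formal_carrier_scale formal_carrier_sum)
qed

lemma t_coeff_eq:
  assumes "i \<le> n" "j \<le> n"
  shows "t_coeff q \<Delta> (real n / 2) (spin n i) (spin n j) = sec_eval (rel.t n i j)"
proof -
  let ?T = "tensor_elt OA OA" and ?f = "f_vec q (real n / 2)" and ?S = "spin_index (real n / 2)"
  interpret AA: abelian_monoid AA by (rule abelian_monoid_AA)
  define P where "P t \<longleftrightarrow> (\<forall>i\<in>?S. \<forall>j\<in>?S. t i j \<in> carrier OA) \<and>
    (\<forall>j\<in>?S. \<Delta> (?f j) =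
       (\<Oplus>\<^bsub>AA\<^esub>i\<in>?S. ?T (?f i) (t i j)))" for t
  have simple_in: "simple (cls x) u \<in> carrier formal" if "u \<in> carrier OA" for x u
    using that by (auto simp: carrier_O)
  have sum_eq: "(\<Oplus>\<^bsub>AA\<^esub>i\<in>?S. ?T (?f i) (w i)) =
      tcls (\<Sum>i\<le>n. simple (cls (f_basis n i)) (w (spin n i)))"
    if w: "\<And>i. i \<le> n \<Longrightarrow> w (spin n i) \<in> carrier OA" for w
  proof -
    have "(\<Oplus>\<^bsub>AA\<^esub>i\<in>?S. ?T (?f i) (w i)) =
        (\<Oplus>\<^bsub>AA\<^esub>i\<in>{..n}. ?T (?f (spin n i)) (w (spin n i)))"
      unfolding spin_index_eq
      by (rule AA.finsum_reindex) (auto simp: inj_spin tensor_elt_tcls AA_carrier f_vec_eq simple_in w)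
    also have "\<dots> = (\<Oplus>\<^bsub>AA\<^esub>i\<in>{..n}. tcls (simple (cls (f_basis n i)) (w (spin n i))))"
      by (rule AA.finsum_cong) (auto simp: tensor_elt_tcls AA_carrier f_vec_eq simple_in w simp_implies_def)
    also have "\<dots> = tcls (\<Sum>i\<le>n. simple (cls (f_basis n i)) (w (spin n i)))"
      by (rule AA_finsum) (simp_all add: simple_in w)
    finally show ?thesis .
  qed
  define idx where "idx x = nat \<lfloor>x + real n / 2\<rfloor>" for x
  have idx: "idx (spin n k) = k" for k by (simp add: idx_def spin_def)
  have "P (\<lambda>i j. sec_eval (rel.t n (idx i) (idx j)))"
    unfolding P_def
  proof (intro conjI ballI)
    fix j assume "j \<in> ?S"
    then obtain k where k: "k \<le> n" "j = spin n k" by (auto simp: spin_index_eq)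
    show "\<Delta> (?f j) = (\<Oplus>\<^bsub>AA\<^esub>i\<in>?S.
        ?T (?f i) (sec_eval (rel.t n (idx i) (idx j))))"
      by (subst sum_eq) (simp_all add: k f_vec_eq comult_f_basis idx)
  qed simp
  then have "P (SOME t. P t)" by (rule someI[of P])
  then have P: "P (t_coeff q \<Delta> (real n / 2))"
    unfolding t_coeff_def P_def .
  let ?t = "t_coeff q \<Delta> (real n / 2)"
  have carr: "?t (spin n k) (spin n j) \<in> carrier OA" if "k \<le> n" for k
    using P assms that by (auto simp: P_def spin_index_eq)
  have "tcls (\<Sum>i\<le>n. simple (cls (f_basis n i)) (?t (spin n i) (spin n j))) =
      tcls (\<Sum>i\<le>n. simple (cls (f_basis n i)) (sec_eval (rel.t n i j)))"
    using P assms sum_eq[of "\<lambda>i. ?t i (spin n j)", OF carr] comult_f_basis[OF assms(2)]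
    by (auto simp: P_def spin_index_eq f_vec_eq)
  then have "(\<Sum>i\<le>n. simple (cls (f_basis n i)) (?t (spin n i) (spin n j))) \<approx>
      (\<Sum>i\<le>n. simple (cls (f_basis n i)) (sec_eval (rel.t n i j)))"
    by (subst (asm) tcls_eq_iff) (auto intro!: formal_carrier_sum simple_in carr)
  then show ?thesis
    by (rule f_basis_independent[rotated 2]) (use assms carr in auto)
qed

end

section \<open>Transfer of equivalences\<close>

lemma scale_carrier: "x \<in> carrier OA \<Longrightarrow> scale OA z x \<in> carrier OA"
  by (auto simp: carrier_O)

lemma finsum_scale_image:
  assumes "inj_on h K" "finite K" "\<And>k. k \<in> K \<Longrightarrow> w (h k) = sec_eval (w' k)"
  shows "(\<Oplus>\<^bsub>OA\<^esub>x\<in>h ` K. scale OA (y x) (w x)) = sec_eval (\<Sum>k\<in>K. sec_scale (y (h k)) (w' k))"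
proof -
  have "(\<Oplus>\<^bsub>OA\<^esub>x\<in>h ` K. scale OA (y x) (w x)) = (\<Oplus>\<^bsub>OA\<^esub>k\<in>K. scale OA (y (h k)) (w (h k)))"
    using assms by (intro O.finsum_reindex) (auto simp: scale_carrier)
  also have "\<dots> = (\<Oplus>\<^bsub>OA\<^esub>k\<in>K. sec_eval (sec_scale (y (h k)) (w' k)))"
    using assms by (intro O.finsum_cong) (auto simp: sec_eval_scale scale_carrier simp_implies_def)
  also have "\<dots> = sec_eval (\<Sum>k\<in>K. sec_scale (y (h k)) (w' k))"
    using assms by (intro sec_eval_sum[symmetric])
  finally show ?thesis .
qed

lemma corep_equiv_transfer:
  assumes eq: "sec.ceq I u J v"
    and f: "inj_on f I" "index u' = f ` I" "\<And>i j. i \<in> I \<Longrightarrow> j \<in> I \<Longrightarrow> corep.coeff u' (f i) (f j) = sec_eval (u i j)"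
    and g: "inj_on g J" "index v' = g ` J" "\<And>i j. i \<in> J \<Longrightarrow> j \<in> J \<Longrightarrow> corep.coeff v' (g i) (g j) = sec_eval (v i j)"
  shows "corep_equiv OA u' v'"
proof -
  from eq obtain M N where fin: "finite I" "finite J"
    and NM: "meq I I (mprod J N M) mid" and MN: "meq J J (mprod I M N) mid"
    and M: "meq J I (mprod I (sec.em M) u) (mprod J v (sec.em M))"
    by (auto simp: sec.ceq_def sec.intertwines_def)
  define f' where "f' = the_inv_into I f"
  define g' where "g' = the_inv_into J g"
  have f': "f' (f i) = i" if "i \<in> I" for i using that f(1) by (simp add: f'_def the_inv_into_f_f)
  have g': "g' (g i) = i" if "i \<in> J" for i using that g(1) by (simp add: g'_def the_inv_into_f_f)
  have fi: "f i = f j \<longleftrightarrow> i = j" if "i \<in> I" "j \<in> I" for i j using f(1) that by (rule inj_on_eq_iff)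
  have gi: "g i = g j \<longleftrightarrow> i = j" if "i \<in> J" "j \<in> J" for i j using g(1) that by (rule inj_on_eq_iff)
  let ?M = "\<lambda>y x. M (g' y) (f' x)" and ?N = "\<lambda>x y. N (f' x) (g' y)"
  have 1: "(\<Sum>k\<in>index v'. ?N (f i) k * ?M k (f j)) = (if f i = f j then 1 else 0)" if ij: "i \<in> I" "j \<in> I" for i j
  proof -
    have "(\<Sum>k\<in>index v'. ?N (f i) k * ?M k (f j)) = mprod J N M i j"
      unfolding g(2) sum.reindex[OF g(1)] mprod_def using ij by (intro sum.cong) (simp_all add: f' g')
    then show ?thesis using meqD[OF NM ij] ij by (simp add: mid_def fi)
  qed
  have 2: "(\<Sum>k\<in>index u'. ?M (g i) k * ?N k (g j)) = (if g i = g j then 1 else 0)" if ij: "i \<in> J" "j \<in> J" for i j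
  proof -
    have "(\<Sum>k\<in>index u'. ?M (g i) k * ?N k (g j)) = mprod I M N i j"
      unfolding f(2) sum.reindex[OF f(1)] mprod_def using ij by (intro sum.cong) (simp_all add: f' g')
    then show ?thesis using meqD[OF MN ij] ij by (simp add: mid_def gi)
  qed
  have 3: "(\<Oplus>\<^bsub>OA\<^esub>x\<in>index u'. scale OA (?M (g k) x) (corep.coeff u' x (f j))) =
      (\<Oplus>\<^bsub>OA\<^esub>y\<in>index v'. scale OA (?M y (f j)) (corep.coeff v' (g k) y))"
    if kj: "k \<in> J" "j \<in> I" for k j
  proof -
    have "(\<Oplus>\<^bsub>OA\<^esub>x\<in>index u'. scale OA (?M (g k) x) (corep.coeff u' x (f j))) =
        sec_eval (\<Sum>i\<in>I. sec_scale (M k i) (u i j))"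
      unfolding f(2) using kj by (subst finsum_scale_image[OF f(1) fin(1), of _ "\<lambda>i. u i j"]) (simp_all add: f(3) f' g' cong: sum.cong)
    also have "(\<Sum>i\<in>I. sec_scale (M k i) (u i j)) = mprod I (sec.em M) u k j"
      by (simp add: mprod_def sec.em_def)
    also have "\<dots> = mprod J v (sec.em M) k j" by (rule meqD[OF M kj])
    also have "\<dots> = (\<Sum>l\<in>J. sec_scale (M l j) (v k l))"
      by (simp add: mprod_def sec.em_def)
    also have "sec_eval \<dots> = (\<Oplus>\<^bsub>OA\<^esub>y\<in>index v'. scale OA (?M y (f j)) (corep.coeff v' (g k) y))"
      unfolding g(2) using kj by (subst finsum_scale_image[OF g(1) fin(2), of _ "\<lambda>l. v k l"]) (simp_all add: g(3) f' g' cong: sum.cong)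
    finally show ?thesis .
  qed
  show ?thesis
    unfolding corep_equiv_def
  proof (intro exI[of _ ?M] exI[of _ ?N] conjI ballI)
    fix x y assume "x \<in> index u'" "y \<in> index u'"
    then obtain i j where "x = f i" "i \<in> I" "y = f j" "j \<in> I" using f(2) by auto
    then show "(\<Sum>k\<in>index v'. ?N x k * ?M k y) = (if x = y then 1 else 0)" using 1 by blast
  next
    fix x y assume "x \<in> index v'" "y \<in> index v'"
    then obtain i j where "x = g i" "i \<in> J" "y = g j" "j \<in> J" using g(2) by auto
    then show "(\<Sum>k\<in>index u'. ?M x k * ?N k y) = (if x = y then 1 else 0)" using 2 by blast
  next
    fix x y assume "x \<in> index v'" "y \<in> index u'"
    then obtain k j where "x = g k" "k \<in> J" "y = f j" "j \<in> I" using f(2) g(2) by auto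
    then show "(\<Oplus>\<^bsub>OA\<^esub>i\<in>index u'. scale OA (?M x i) (corep.coeff u' i y)) =
        (\<Oplus>\<^bsub>OA\<^esub>l\<in>index v'. scale OA (?M l y) (corep.coeff v' x l))" using 3 by blast
  qed
qed

lemma spin_index_tensor:
  "spin_index (real m / 2) \<times> spin_index (real n / 2) = (\<lambda>(i, k). (spin m i, spin n k)) ` ({..m} \<times> {..n})"
  unfolding spin_index_eq by auto

lemma sec_eval_Dz: "uq2_gen q Gen_D [^]\<^bsub>OA\<^esub> (e::int) = sec_eval (rel.Dz e)"
proof -
  have "inv\<^bsub>OA\<^esub> (uq2_gen q Gen_D [^]\<^bsub>OA\<^esub> k) = sec_eval (sec_star (sD) ^ k)" for k :: nat
  proof (rule O.inv_char)
    have "sD ^ k * sec_star (sD) ^ k = 1 \<and> sec_star (sD) ^ k * sD ^ k = 1"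
    proof (induction k)
      case (Suc k)
      have "sD ^ Suc k * sec_star (sD) ^ Suc k =
          sD * (sD ^ k * sec_star (sD) ^ k) * sec_star (sD)"
        "sec_star (sD) ^ Suc k * sD ^ Suc k =
          sec_star (sD) * (sec_star (sD) ^ k * sD ^ k) * sD"
        by (subst power_Suc, subst power_Suc2, simp only: mult.assoc)+
      then show ?case using Suc by (simp add: rel.DD')
    qed simp
    then show "uq2_gen q Gen_D [^]\<^bsub>OA\<^esub> k \<otimes>\<^bsub>OA\<^esub> sec_eval (sec_star (sD) ^ k) = \<one>\<^bsub>OA\<^esub>"
      "sec_eval (sec_star (sD) ^ k) \<otimes>\<^bsub>OA\<^esub> uq2_gen q Gen_D [^]\<^bsub>OA\<^esub> k = \<one>\<^bsub>OA\<^esub>"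
      by (simp_all only: sec_eval_gen[symmetric] sec_eval_power[symmetric] sec_eval_mult[symmetric] sec_eval_one)
  qed (simp_all add: sec_eval_gen[symmetric] sec_eval_power[symmetric])
  then show ?thesis
    unfolding int_pow_def2 rel.Dz_def
    by (cases "e < 0") (simp_all only: if_True if_False sec_eval_power[symmetric] sec_eval_gen[symmetric])
qed

lemma TD_coeff:
  assumes "is_comultiplication q \<Delta>" and "i \<le> n" "j \<le> n"
  shows "corep.coeff (TD q \<Delta> (real n / 2) e) (spin n i) (spin n j) = sec_eval (rel.t n i j * rel.Dz e)"
  by (simp add: TD_def t_coeff_eq[OF assms] sec_eval_Dz sec_eval_mult)

lemma tensor_TD:
  assumes comult: "is_comultiplication q \<Delta>"
  shows "corep_equiv OA
    (corep_tensor OA (TD q \<Delta> (real n1 / 2) m) (TD q \<Delta> (real n2 / 2) n))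
    (corep_direct_sum OA {0..min n1 n2}
      (\<lambda>r. TD q \<Delta> (real n1 / 2 + real n2 / 2 - real r) (m + n + int r)))"
proof (rule corep_equiv_transfer[OF rel.tensor_decomposition])
  let ?u = "corep_tensor OA (TD q \<Delta> (real n1 / 2) m) (TD q \<Delta> (real n2 / 2) n)"
  let ?v = "corep_direct_sum OA {0..min n1 n2} (\<lambda>r. TD q \<Delta> (real n1 / 2 + real n2 / 2 - real r) (m + n + int r))"
  let ?f = "\<lambda>(i, k). (spin n1 i, spin n2 k)" and ?g = "\<lambda>(r, i). (r :: nat, spin (n1 + n2 - 2 * r) i)"
  have half: "real n1 / 2 + real n2 / 2 - real r = real (n1 + n2 - 2 * r) / 2" if "r \<le> min n1 n2" for r
  proof -
    have "2 * r \<le> n1 + n2" using that by simp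
    then show ?thesis by (simp add: of_nat_diff field_simps)
  qed
  show "inj_on ?f ({..n1} \<times> {..n2})"
    by (auto simp: inj_on_def spin_def)
  show "index ?u = ?f ` ({..n1} \<times> {..n2})"
    by (simp add: corep_tensor_def TD_def spin_index_tensor)
  show "corep.coeff ?u (?f x) (?f y) =
      sec_eval ((\<lambda>(i, k) (j, l). rel.t n1 i j * rel.Dz m * (rel.t n2 k l * rel.Dz n)) x y)"
    if "x \<in> {..n1} \<times> {..n2}" "y \<in> {..n1} \<times> {..n2}" for x y
    using that by (auto simp: corep_tensor_def TD_coeff[OF comult] sec_eval_mult)
  show "inj_on ?g (rel.summands n1 n2)"
    by (auto simp: inj_on_def spin_def)
  have "index ?v =
      (SIGMA r:{0..min n1 n2}. spin (n1 + n2 - 2 * r) ` {..n1 + n2 - 2 * r})"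
  proof -
    have "index ?v =
        (SIGMA r:{0..min n1 n2}. spin_index (real n1 / 2 + real n2 / 2 - real r))"
      by (simp add: corep_direct_sum_def TD_def)
    also have "\<dots> = (SIGMA r:{0..min n1 n2}. spin (n1 + n2 - 2 * r) ` {..n1 + n2 - 2 * r})"
    proof (intro Sigma_cong refl)
      fix r assume "r \<in> {0..min n1 n2}"
      then have "r \<le> min n1 n2" by simp
      then show "spin_index (real n1 / 2 + real n2 / 2 - real r) = spin (n1 + n2 - 2 * r) ` {..n1 + n2 - 2 * r}"
        by (simp only: half spin_index_eq)
    qed
    finally show ?thesis .
  qed
  also have "\<dots> = ?g ` rel.summands n1 n2"
    by (auto simp: rel.summands_def image_iff)
  finally show "index ?v = ?g ` rel.summands n1 n2" .
  show "corep.coeff ?v (?g x) (?g y) =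
      sec_eval (rel.summand_coeff n1 n2 (m + n) x y)"
    if xy: "x \<in> rel.summands n1 n2" "y \<in> rel.summands n1 n2" for x y
  proof -
    obtain r i r' j where eq: "x = (r, i)" "y = (r', j)" by (cases x; cases y) auto
    show ?thesis
    proof (cases "r = r'")
      case True
      have r: "r \<le> min n1 n2" and ij: "i \<le> n1 + n2 - 2 * r" "j \<le> n1 + n2 - 2 * r"
        using xy True by (auto simp: eq rel.summands_def)
      show ?thesis
        unfolding corep_direct_sum_def eq corep.simps True[symmetric] prod.case half[OF r]
        by (simp add: TD_coeff[OF comult ij] rel.summand_coeff_def)
    next
      case False
      then show ?thesis
        by (simp add: eq corep_direct_sum_def rel.summand_coeff_def sec_eval_zero del: O_ops)
    qed
  qed
qed

end

theorem theorem5p3: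
  fixes q :: complex
    and \<Delta> :: "uq2 \<Rightarrow> uq2_tensor"
    and l1 l2 :: real
    and m n :: int
  assumes "0 < cmod q" and "cmod q < 1"
    and "is_comultiplication q \<Delta>"
    and "l1 \<in> half_nats" and "l2 \<in> half_nats"
  shows "corep_equiv (O_Uq2 q)
           (corep_tensor (O_Uq2 q) (TD q \<Delta> l1 m) (TD q \<Delta> l2 n))
           (corep_direct_sum (O_Uq2 q) {0..nat \<lfloor>2 * min l1 l2\<rfloor>}
              (\<lambda>r. TD q \<Delta> (l1 + l2 - real r) (m + n + int r)))"
proof -
  interpret deformation_parameter q
    using assms(1,2) by unfold_locales
  obtain n1 n2 where l: "l1 = real n1 / 2" "l2 = real n2 / 2"
    using assms(4,5) by (auto simp: half_nats_def)
  have "2 * min l1 l2 = real (min n1 n2)"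
    by (simp add: l min_def)
  then have "nat \<lfloor>2 * min l1 l2\<rfloor> = min n1 n2"
    by (simp only: floor_of_nat nat_int)
  then show ?thesis
    using tensor_TD[OF assms(3)] by (simp add: l)
qed

end
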